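(* Let $X$ be a finite dimensional normed space, or a separable Hilbert space, or the space $c_0(\Gamma)$ for an arbitrary set of indices $\Gamma$. Let $\Omega$ be an open subset of $X$ and let $u_0:\overline{\Omega}\to\mathbb{R}$ be a Lipschitz function such that $\mathrm{Lip}(u_0,\partial\Omega)<\mathrm{Lip}(u_0,\overline{\Omega})$. Given $\varepsilon>0$, there exists a function $v:\overline{\Omega}\to\mathbb{R}$ such that $v$ is of class $C^\infty(\Omega)$, $v$ is Lipschitz on $\overline{\Omega}$ with $\mathrm{Lip}(v,\overline{\Omega})\leq\mathrm{Lip}(u_0,\overline{\Omega})$, $v=u_0$ on $\partial\Omega$, and $|u_0-v|\leq\varepsilon$ on $\overline{\Omega}$.
   Context: All spaces are real. For a metric space $(E,d)$ and $f:E\to\mathbb{R}$, $\mathrm{Lip}(f,E):=\inf\{L>0 : |f(x)-f(y)|\leq L\,d(x,y)\text{ for all }x,y\in E\}$; for a subset $S$ of the domain of $f$, $\mathrm{Lip}(f,S)$ means the Lipschitz constant of the restriction of $f$ to $S$ (with the distance induced by the norm of $X$). Smoothness is in the Fréchet sense. $c_0(\Gamma)$ carries its usual sup norm. *)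

theory Defs
  imports "HOL-Analysis.Analysis"
begin

text \<open>
  Real-valued infimum; it is the Lipschitz constant only if \<open>f\<close> is Lipschitz on \<open>S\<close>
  (for other \<open>f\<close> it is the infimum of the empty set, which is unspecified).
\<close>

definition Lip :: "('a::metric_space \<Rightarrow> real) \<Rightarrow> 'a set \<Rightarrow> real" where
  "Lip f S = Inf {L. L > 0 \<and> (\<forall>x\<in>S. \<forall>y\<in>S. \<bar>f x - f y\<bar> \<le> L * dist x y)}"

text \<open>
  The iterated Frechet derivative of order \<open>k\<close> takes its values in the space of bounded
  \<open>k\<close>-linear forms. As the order is not available at the level of types, a \<open>k\<close>-linear form is a
  function on lists, of which only the values on lists of length \<open>k\<close> matter.
\<close>

definition bounded_multilinear_form :: "nat \<Rightarrow> ('a::real_normed_vector list \<Rightarrow> real) \<Rightarrow> bool" where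
  "bounded_multilinear_form k T \<longleftrightarrow>
     (\<forall>vs i. length vs = k \<and> i < k \<longrightarrow> linear (\<lambda>h. T (vs[i := h]))) \<and>
     (\<exists>C. \<forall>vs. length vs = k \<longrightarrow> \<bar>T vs\<bar> \<le> C * prod_list (map norm vs))"

text \<open>
  Frechet differentiability at \<open>x\<close> of a map \<open>F\<close> into the \<open>k\<close>-linear forms with their operator
  norm; the derivative, a linear map into the \<open>k\<close>-linear forms, is given as the
  \<open>(k + 1)\<close>-linear form \<open>T\<close> whose first argument is the increment.
\<close>

definition has_multilinear_derivative ::
  "nat \<Rightarrow> ('a::real_normed_vector \<Rightarrow> 'a list \<Rightarrow> real) \<Rightarrow> ('a list \<Rightarrow> real) \<Rightarrow> 'a \<Rightarrow> bool" where
  "has_multilinear_derivative k F T x \<longleftrightarrow>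
     bounded_multilinear_form (Suc k) T \<and>
     (\<forall>e>0. \<forall>\<^sub>F y in nhds x. \<forall>vs. length vs = k \<longrightarrow>
        \<bar>F y vs - F x vs - T ((y - x) # vs)\<bar> \<le> e * norm (y - x) * prod_list (map norm vs))"

definition Cinfinity_on :: "('a::real_normed_vector) set \<Rightarrow> ('a \<Rightarrow> real) \<Rightarrow> bool" where
  "Cinfinity_on U f \<longleftrightarrow>
     (\<exists>D :: nat \<Rightarrow> 'a \<Rightarrow> 'a list \<Rightarrow> real.
        (\<forall>x\<in>U. D 0 x [] = f x) \<and>
        (\<forall>k. \<forall>x\<in>U. has_multilinear_derivative k (D k) (D (Suc k) x) x))"

text \<open>At order zero this is the library's Frechet derivative.\<close>

lemma has_multilinear_derivative_0_iff:
  "has_multilinear_derivative 0 F T x \<longleftrightarrow>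
     ((\<lambda>y. F y []) has_derivative (\<lambda>h. T [h])) (at x)"
proof -
  have "bounded_multilinear_form (Suc 0) T \<longleftrightarrow> bounded_linear (\<lambda>h. T [h])"
  proof
    assume *: "bounded_multilinear_form (Suc 0) T"
    then have "linear (\<lambda>h. T ([0][0 := h]))"
      unfolding bounded_multilinear_form_def by (metis length_Cons lessI list.size(3))
    moreover obtain C where C: "\<And>vs. length vs = Suc 0 \<Longrightarrow> \<bar>T vs\<bar> \<le> C * prod_list (map norm vs)"
      using * unfolding bounded_multilinear_form_def by blast
    have "norm (T [h]) \<le> norm h * C" for h
      using C[of "[h]"] by (simp add: mult.commute)
    ultimately show "bounded_linear (\<lambda>h. T [h])"
      by (auto simp: bounded_linear_def bounded_linear_axioms_def)
  next
    assume *: "bounded_linear (\<lambda>h. T [h])"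
    then have lin: "linear (\<lambda>h. T [h])"
      by (simp add: bounded_linear.linear)
    obtain K where K: "\<And>h. norm (T [h]) \<le> norm h * K"
      using * bounded_linear.bounded by blast
    show "bounded_multilinear_form (Suc 0) T"
      unfolding bounded_multilinear_form_def
    proof (intro conjI exI[of _ K] allI impI)
      fix vs :: "'a list" and i assume "length vs = Suc 0 \<and> i < Suc 0"
      then show "linear (\<lambda>h. T (vs[i := h]))"
        using lin by (auto simp: length_Suc_conv)
    next
      fix vs :: "'a list" assume "length vs = Suc 0"
      then show "\<bar>T vs\<bar> \<le> K * prod_list (map norm vs)"
        using K by (auto simp: length_Suc_conv mult.commute)
    qed
  qed
  then show ?thesis
    unfolding has_multilinear_derivative_def has_derivative_within_alt eventually_nhds_metric
    by (simp add: dist_norm)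
qed

text \<open>
  \<open>'g c0\<close> is \<open>c\<^sub>0(\<Gamma>)\<close> for the index set \<open>\<Gamma> = UNIV :: 'g set\<close>. No topology on the index type
  is involved.
\<close>

typedef 'g c0 = "{f :: 'g \<Rightarrow> real. \<forall>e>0. finite {i. e \<le> \<bar>f i\<bar>}}"
  morphisms c0_apply Abs_c0
  by (rule exI[of _ "\<lambda>_. 0"]) auto

setup_lifting type_definition_c0

lemma c0_add_aux:
  fixes f g :: "'g \<Rightarrow> real"
  assumes "\<forall>e>0. finite {i. e \<le> \<bar>f i\<bar>}" "\<forall>e>0. finite {i. e \<le> \<bar>g i\<bar>}"
  shows "\<forall>e>0. finite {i. e \<le> \<bar>f i + g i\<bar>}"
proof (intro allI impI)
  fix e :: real assume "e > 0"
  have "{i. e \<le> \<bar>f i + g i\<bar>} \<subseteq> {i. e/2 \<le> \<bar>f i\<bar>} \<union> {i. e/2 \<le> \<bar>g i\<bar>}"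
  proof
    fix i assume "i \<in> {i. e \<le> \<bar>f i + g i\<bar>}"
    then show "i \<in> {i. e/2 \<le> \<bar>f i\<bar>} \<union> {i. e/2 \<le> \<bar>g i\<bar>}"
      using abs_triangle_ineq[of "f i" "g i"] by simp linarith
  qed
  then show "finite {i. e \<le> \<bar>f i + g i\<bar>}"
    using assms \<open>e > 0\<close> by (meson finite_UnI finite_subset half_gt_zero)
qed

lemma c0_diff_aux:
  fixes f g :: "'g \<Rightarrow> real"
  assumes "\<forall>e>0. finite {i. e \<le> \<bar>f i\<bar>}" "\<forall>e>0. finite {i. e \<le> \<bar>g i\<bar>}"
  shows "\<forall>e>0. finite {i. e \<le> \<bar>f i - g i\<bar>}"
  using c0_add_aux[of f "\<lambda>i. - g i"] assms by simp

lemma c0_scale_aux: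
  fixes f :: "'g \<Rightarrow> real"
  assumes "\<forall>e>0. finite {i. e \<le> \<bar>f i\<bar>}"
  shows "\<forall>e>0. finite {i. e \<le> \<bar>c * f i\<bar>}"
proof (intro allI impI)
  fix e :: real assume "e > 0"
  show "finite {i. e \<le> \<bar>c * f i\<bar>}"
  proof (cases "c = 0")
    case False
    then have "{i. e \<le> \<bar>c * f i\<bar>} = {i. e / \<bar>c\<bar> \<le> \<bar>f i\<bar>}"
      by (auto simp: abs_mult field_simps)
    then show ?thesis
      using assms \<open>e > 0\<close> False by simp
  qed (use \<open>e > 0\<close> in simp)
qed

lemma c0_bdd_above:
  fixes f :: "'g \<Rightarrow> real"
  assumes "\<forall>e>0. finite {i. e \<le> \<bar>f i\<bar>}"
  shows "bdd_above (range (\<lambda>i. \<bar>f i\<bar>))"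
proof -
  have "finite {i. 1 \<le> \<bar>f i\<bar>}"
    using assms by simp
  then have "bdd_above ((\<lambda>i. \<bar>f i\<bar>) ` {i. 1 \<le> \<bar>f i\<bar>})"
    by simp
  then obtain M where M: "\<And>i. 1 \<le> \<bar>f i\<bar> \<Longrightarrow> \<bar>f i\<bar> \<le> M"
    by (auto simp: bdd_above_def)
  have "\<bar>f i\<bar> \<le> max 1 M" for i
    using M[of i] by linarith
  then show ?thesis
    by (auto simp: bdd_above_def)
qed

instantiation c0 :: (type) real_vector
begin

lift_definition zero_c0 :: "'a c0" is "\<lambda>_. 0"
  by auto

lift_definition plus_c0 :: "'a c0 \<Rightarrow> 'a c0 \<Rightarrow> 'a c0" is "\<lambda>f g i. f i + g i"
  using c0_add_aux by blast

lift_definition uminus_c0 :: "'a c0 \<Rightarrow> 'a c0" is "\<lambda>f i. - f i"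
  by auto

lift_definition minus_c0 :: "'a c0 \<Rightarrow> 'a c0 \<Rightarrow> 'a c0" is "\<lambda>f g i. f i - g i"
  using c0_diff_aux by blast

lift_definition scaleR_c0 :: "real \<Rightarrow> 'a c0 \<Rightarrow> 'a c0" is "\<lambda>c f i. c * f i"
  using c0_scale_aux by blast

instance
  by standard (transfer; auto simp: algebra_simps)+

end

instantiation c0 :: (type) real_normed_vector
begin

lift_definition norm_c0 :: "'a c0 \<Rightarrow> real" is "\<lambda>f. SUP i. \<bar>f i\<bar>" .

definition dist_c0 :: "'a c0 \<Rightarrow> 'a c0 \<Rightarrow> real"
  where "dist_c0 f g = norm (f - g)"

definition sgn_c0 :: "'a c0 \<Rightarrow> 'a c0"
  where "sgn_c0 f = f /\<^sub>R norm f"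

definition uniformity_c0 :: "('a c0 \<times> 'a c0) filter"
  where "uniformity_c0 = (INF e\<in>{0 <..}. principal {(x, y). dist x y < e})"

definition open_c0 :: "'a c0 set \<Rightarrow> bool"
  where "open_c0 S = (\<forall>x\<in>S. \<forall>\<^sub>F (x', y) in uniformity. x' = x \<longrightarrow> y \<in> S)"

instance
proof
  fix f g :: "'a c0" and c :: real
  have upper: "\<bar>c0_apply f i\<bar> \<le> norm f" for f :: "'a c0" and i
    by transfer (auto intro: cSUP_upper c0_bdd_above)
  have least: "norm f \<le> b" if "\<And>i. \<bar>c0_apply f i\<bar> \<le> b" for f :: "'a c0" and b
    using that by transfer (auto intro: cSUP_least)
  show "norm f = 0 \<longleftrightarrow> f = 0"
  proof
    assume "norm f = 0"
    then have "c0_apply f i = 0" for i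
      using upper[of f i] by simp
    then show "f = 0"
      by transfer auto
  qed (transfer, simp)
  show "norm (f + g) \<le> norm f + norm g"
  proof (rule least)
    fix i
    have "\<bar>c0_apply (f + g) i\<bar> \<le> \<bar>c0_apply f i\<bar> + \<bar>c0_apply g i\<bar>"
      by (simp add: plus_c0.rep_eq abs_triangle_ineq)
    then show "\<bar>c0_apply (f + g) i\<bar> \<le> norm f + norm g"
      using upper[of f i] upper[of g i] by linarith
  qed
  have scale_le: "norm (c *\<^sub>R f) \<le> \<bar>c\<bar> * norm f" for c :: real and f :: "'a c0"
    by (rule least) (simp add: scaleR_c0.rep_eq abs_mult mult_left_mono upper)
  show "norm (c *\<^sub>R f) = \<bar>c\<bar> * norm f"
  proof (cases "c = 0")
    case True
    then show ?thesis
      by simp (transfer, simp)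
  next
    case False
    have "norm f \<le> \<bar>inverse c\<bar> * norm (c *\<^sub>R f)"
      using scale_le[of "inverse c" "c *\<^sub>R f"] False by simp
    then have "\<bar>c\<bar> * norm f \<le> norm (c *\<^sub>R f)"
      using False by (simp add: field_simps)
    then show ?thesis
      using scale_le[of c f] by simp
  qed
qed (simp_all add: dist_c0_def sgn_c0_def uniformity_c0_def open_c0_def)

end

end

theory Submission
  imports Defs "HOL-Computational_Algebra.Polynomial"
begin

text \<open>
  Let \<open>K\<close> be the Lipschitz constant of \<open>u0\<close> on the closure of \<open>\<Omega>\<close> and \<open>K0 < K\<close> the one on the
  boundary. McShane's formula (\<open>inf_cone\<close>) extends \<open>u0\<close> to a \<open>K\<close>-Lipschitz function \<open>U\<close> and its
  restriction to the boundary to a \<open>K0\<close>-Lipschitz function \<open>w\<close>, both on the whole space. With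
  \<open>shrink e t = t - e * arctan t\<close>, the function \<open>f = w + shrink e (U - w)\<close> still equals \<open>u0\<close> on the
  boundary and is uniformly close to it. Its increments are convex combinations of those of \<open>w\<close> and
  of \<open>U\<close> in which \<open>w\<close> has a weight that is bounded below on bounded sets; so over distances at
  least \<open>r\<close> from a given point, \<open>f\<close> stays below slope \<open>K\<close> by a definite amount (\<open>shrink_gap\<close>).

  This slack pays for a smoothing that keeps the constant \<open>K\<close> exactly and whose error tends to \<open>0\<close>
  at the boundary. Take countably many sets \<open>S n\<close> whose small neighbourhoods cover \<open>\<Omega>\<close>. Let
  \<open>\<psi> n\<close> be a smooth \<open>K\<close>-Lipschitz function close to the lower envelope of the upward cones
  \<open>f y + K * dist x y\<close> with \<open>y \<in> S n\<close>, and \<open>s n\<close> one close to the upper envelope of the downward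
  cones, lifted slightly. The function sought is
  \<open>v = min (\<psi> 0) (max (s 0) (min (\<psi> 1) (max (s 1) \<dots>)))\<close>
  with corners rounded off. Rounded minima and maxima are nonexpansive for the sup norm, so \<open>v\<close> is
  \<open>K\<close>-Lipschitz. Near \<open>S n\<close> the lift makes \<open>s n\<close> exceed \<open>\<psi> n\<close>, so the formula stops at level \<open>n\<close>;
  hence \<open>v\<close> is locally given by a finite formula and is smooth. Far from \<open>S n\<close> the slack puts
  \<open>\<psi> n\<close> above \<open>f\<close> and \<open>s n\<close> below \<open>f\<close>, so the error at a point comes only from levels that live
  near it (\<open>nested_min_max_limit\<close>, \<open>fine_approximation_core\<close>).

  It remains to approximate the envelopes uniformly. In a separable inner product space the \<open>S n\<close>
  are single points and \<open>norm (r, x - y)\<close> smooths the cone \<open>dist x y\<close>. In finite dimension and in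
  \<open>c\<^sub>0\<close> every \<open>K\<close>-Lipschitz function is a uniform limit of smooth \<open>K\<close>-Lipschitz ones, by convolution
  in one coordinate direction after the other; averaging over translates keeps the Lipschitz constant.
  In \<open>c\<^sub>0\<close> the function is first composed with a soft thresholding of all coordinates, after which
  only finitely many coordinates matter near each point.
\<close>

section \<open>Multilinear forms and their derivatives\<close>

abbreviation norm_prod :: "'a::real_normed_vector list \<Rightarrow> real" where
  "norm_prod vs \<equiv> prod_list (map norm vs)"

lemma norm_prod_nonneg: "0 \<le> norm_prod vs"
  by (induction vs) auto

lemma bounded_multilinear_form_bound:
  assumes "bounded_multilinear_form k T"
  shows "\<exists>C\<ge>0. \<forall>vs. length vs = k \<longrightarrow> \<bar>T vs\<bar> \<le> C * norm_prod vs"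
proof -
  obtain C where C: "\<And>vs. length vs = k \<Longrightarrow> \<bar>T vs\<bar> \<le> C * norm_prod vs"
    using assms unfolding bounded_multilinear_form_def by blast
  have "\<bar>T vs\<bar> \<le> max 0 C * norm_prod vs" if "length vs = k" for vs
    using C[OF that] mult_right_mono[of C "max 0 C" "norm_prod vs"] norm_prod_nonneg[of vs]
    by linarith
  then show ?thesis by (intro exI[of _ "max 0 C"]) auto
qed

lemma bounded_multilinear_formI:
  assumes "\<And>vs i. length vs = k \<Longrightarrow> i < k \<Longrightarrow> linear (\<lambda>h. T (vs[i := h]))"
    "\<And>vs. length vs = k \<Longrightarrow> \<bar>T vs\<bar> \<le> C * norm_prod vs"
  shows "bounded_multilinear_form k T"
  using assms unfolding bounded_multilinear_form_def by blast

lemma bounded_multilinear_form_linear_hd: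
  assumes "bounded_multilinear_form (Suc k) T" "length vs = k"
  shows "linear (\<lambda>h. T (h # vs))"
proof -
  have *: "\<forall>vs i. length vs = Suc k \<and> i < Suc k \<longrightarrow> linear (\<lambda>h. T (vs[i := h]))"
    using assms(1) unfolding bounded_multilinear_form_def by (rule conjunct1)
  from *[rule_format, of "0 # vs" 0] show ?thesis using assms(2) by simp
qed

lemma bounded_multilinear_form_0: "bounded_multilinear_form 0 T"
  by (rule bounded_multilinear_formI[where C = "\<bar>T []\<bar>"]) auto

lemma bounded_multilinear_form_zero: "bounded_multilinear_form k (\<lambda>_. 0)"
  by (rule bounded_multilinear_formI[where C = 0]) (auto simp: linear_iff)

lemma bounded_multilinear_form_add:
  assumes "bounded_multilinear_form k S" "bounded_multilinear_form k T"
  shows "bounded_multilinear_form k (\<lambda>vs. S vs + T vs)"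
proof -
  obtain C where C: "\<And>vs. length vs = k \<Longrightarrow> \<bar>S vs\<bar> \<le> C * norm_prod vs"
    using bounded_multilinear_form_bound[OF assms(1)] by blast
  obtain D where D: "\<And>vs. length vs = k \<Longrightarrow> \<bar>T vs\<bar> \<le> D * norm_prod vs"
    using bounded_multilinear_form_bound[OF assms(2)] by blast
  show ?thesis
  proof (rule bounded_multilinear_formI[where C = "C + D"])
    fix vs :: "'a list" assume "length vs = k"
    then show "\<bar>S vs + T vs\<bar> \<le> (C + D) * norm_prod vs"
      using C[of vs] D[of vs] by (simp add: distrib_right)
  qed (use assms in \<open>auto simp: bounded_multilinear_form_def intro!: linear_compose_add\<close>)
qed

lemma bounded_multilinear_form_scale:
  assumes "bounded_multilinear_form k S"
  shows "bounded_multilinear_form k (\<lambda>vs. c * S vs)"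
proof -
  obtain C where C: "\<And>vs. length vs = k \<Longrightarrow> \<bar>S vs\<bar> \<le> C * norm_prod vs"
    using bounded_multilinear_form_bound[OF assms(1)] by blast
  show ?thesis
  proof (rule bounded_multilinear_formI[where C = "\<bar>c\<bar> * C"])
    fix vs :: "'a list" assume "length vs = k"
    then show "\<bar>c * S vs\<bar> \<le> \<bar>c\<bar> * C * norm_prod vs"
      using C[of vs] by (simp add: abs_mult mult_left_mono mult.assoc)
  next
    fix vs :: "'a list" and i assume "length vs = k" "i < k"
    then have "linear (\<lambda>h. S (vs[i := h]))"
      using assms by (auto simp: bounded_multilinear_form_def)
    from linear_compose_scale_right[OF this, of c]
    show "linear (\<lambda>h. c * S (vs[i := h]))" by simp
  qed
qed

lemma norm_prod_nths: "norm_prod (nths vs I) * norm_prod (nths vs (- I)) = norm_prod vs"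
proof (induction vs arbitrary: I)
  case (Cons v vs)
  have *: "{j. Suc j \<notin> I} = - {j. Suc j \<in> I}" by auto
  show ?case
    using Cons.IH[of "{j. Suc j \<in> I}"]
    by (simp add: nths_Cons * mult.assoc mult.left_commute)
qed auto

lemma nths_update_notin:
  assumes "i \<notin> I" shows "nths (vs[i := h]) I = nths vs I"
  using assms
proof (induction vs arbitrary: I i)
  case (Cons v vs)
  then show ?case by (cases i) (auto simp: nths_Cons)
qed auto

lemma nths_update_in:
  assumes "i \<in> I" "i < length vs"
  shows "\<exists>p<length (nths vs I). \<forall>h. nths (vs[i := h]) I = (nths vs I)[p := h]"
  using assms
proof (induction vs arbitrary: I i)
  case (Cons v vs)
  show ?case
  proof (cases i)
    case 0
    then show ?thesis using Cons.prems by (intro exI[of _ 0]) (auto simp: nths_Cons)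
  next
    case (Suc j)
    then obtain p where p: "p < length (nths vs {j. Suc j \<in> I})"
      "\<And>h. nths (vs[j := h]) {j. Suc j \<in> I} = (nths vs {j. Suc j \<in> I})[p := h]"
      using Cons.IH[of j "{j. Suc j \<in> I}"] Cons.prems by auto
    show ?thesis
      using p Suc by (intro exI[of _ "if 0 \<in> I then Suc p else p"]) (auto simp: nths_Cons)
  qed
qed auto

lemma length_nths_mask:
  assumes "length vs = k + l" "card (I \<inter> {..<k + l}) = k"
  shows "length (nths vs I) = k" "length (nths vs (- I)) = l"
proof -
  show *: "length (nths vs I) = k"
    using assms by (simp add: length_nths Int_def conj_commute)
  have "card {i. i < length vs \<and> i \<in> - I} = card ({..<k + l} - (I \<inter> {..<k + l}))"
    using assms(1) by (intro arg_cong[where f = card]) auto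
  also have "\<dots> = l"
    using assms(2) by (subst card_Diff_subset) auto
  finally show "length (nths vs (- I)) = l"
    by (simp add: length_nths)
qed

lemma card_shifted_mask:
  assumes "card (I \<inter> {..<n}) = k"
  shows "card (Suc ` I \<inter> {..<Suc n}) = k" "card (insert 0 (Suc ` I) \<inter> {..<Suc n}) = Suc k"
proof -
  have "Suc ` I \<inter> {..<Suc n} = Suc ` (I \<inter> {..<n})" by auto
  then show 1: "card (Suc ` I \<inter> {..<Suc n}) = k"
    using assms by (simp add: card_image)
  have "insert 0 (Suc ` I) \<inter> {..<Suc n} = insert 0 (Suc ` I \<inter> {..<Suc n})" by auto
  then show "card (insert 0 (Suc ` I) \<inter> {..<Suc n}) = Suc k"
    using 1 by (simp add: card_insert_if)
qed

text \<open>
  The entries at the positions in \<open>I\<close> go to the first factor, the others to the second. Choosing by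
  position, instead of cutting the list in two, keeps the product rule within this shape: the increment
  is put in front, so all positions shift by \<open>Suc\<close> and \<open>0\<close> is added to the set or not.
\<close>

definition mask_tensor ::
  "nat set \<Rightarrow> ('a list \<Rightarrow> real) \<Rightarrow> ('a list \<Rightarrow> real) \<Rightarrow> 'a list \<Rightarrow> real" where
  "mask_tensor I S T vs = S (nths vs I) * T (nths vs (- I))"

lemma bounded_multilinear_form_mask_tensor:
  assumes S: "bounded_multilinear_form k S" and T: "bounded_multilinear_form l T"
    and I: "card (I \<inter> {..<k + l}) = k"
  shows "bounded_multilinear_form (k + l) (mask_tensor I S T)"
proof -
  obtain C where C: "C \<ge> 0" "\<And>vs. length vs = k \<Longrightarrow> \<bar>S vs\<bar> \<le> C * norm_prod vs"
    using bounded_multilinear_form_bound[OF S] by blast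
  obtain D where D: "D \<ge> 0" "\<And>vs. length vs = l \<Longrightarrow> \<bar>T vs\<bar> \<le> D * norm_prod vs"
    using bounded_multilinear_form_bound[OF T] by blast
  show ?thesis
  proof (rule bounded_multilinear_formI[where C = "C * D"])
    fix vs :: "'a list" assume len: "length vs = k + l"
    note len' = length_nths_mask[OF len I]
    have "\<bar>mask_tensor I S T vs\<bar> \<le> (C * norm_prod (nths vs I)) * (D * norm_prod (nths vs (- I)))"
      unfolding mask_tensor_def abs_mult using C D len'
      by (intro mult_mono) (auto simp: norm_prod_nonneg)
    also have "\<dots> = C * D * norm_prod vs"
      by (subst norm_prod_nths[of vs I, symmetric]) (simp only: mult_ac)
    finally show "\<bar>mask_tensor I S T vs\<bar> \<le> C * D * norm_prod vs" .
  next
    fix vs :: "'a list" and i assume len: "length vs = k + l" and i: "i < k + l"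
    note len' = length_nths_mask[OF len I]
    show "linear (\<lambda>h. mask_tensor I S T (vs[i := h]))"
    proof (cases "i \<in> I")
      case True
      obtain p where p: "p < length (nths vs I)"
        "\<And>h. nths (vs[i := h]) I = (nths vs I)[p := h]"
        using nths_update_in[of i I vs] True len i by auto
      have "linear (\<lambda>h. S ((nths vs I)[p := h]))"
        using S p(1) len' by (auto simp: bounded_multilinear_form_def)
      from linear_compose_scale_right[OF this, of "T (nths vs (- I))"] show ?thesis
        by (simp add: mask_tensor_def p nths_update_notin True mult.commute)
    next
      case False
      obtain p where p: "p < length (nths vs (- I))"
        "\<And>h. nths (vs[i := h]) (- I) = (nths vs (- I))[p := h]"
        using nths_update_in[of i "- I" vs] False len i by auto
      have "linear (\<lambda>h. T ((nths vs (- I))[p := h]))"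
        using T p(1) len' by (auto simp: bounded_multilinear_form_def)
      from linear_compose_scale_right[OF this, of "S (nths vs I)"] show ?thesis
        by (simp add: mask_tensor_def p nths_update_notin False)
    qed
  qed
qed

lemma has_multilinear_derivativeD:
  assumes "has_multilinear_derivative k F T x" "e > 0"
  shows "\<forall>\<^sub>F y in nhds x. \<forall>vs. length vs = k \<longrightarrow>
        \<bar>F y vs - F x vs - T ((y - x) # vs)\<bar> \<le> e * norm (y - x) * norm_prod vs"
  using assms unfolding has_multilinear_derivative_def by blast

lemma has_multilinear_derivative_zero: "has_multilinear_derivative k (\<lambda>_ _. 0) (\<lambda>_. 0) x"
  unfolding has_multilinear_derivative_def
  by (auto simp: bounded_multilinear_form_zero norm_prod_nonneg intro!: mult_nonneg_nonneg)

lemma has_multilinear_derivative_add: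
  assumes F: "has_multilinear_derivative k F S x" and G: "has_multilinear_derivative k G T x"
  shows "has_multilinear_derivative k (\<lambda>x vs. F x vs + G x vs) (\<lambda>vs. S vs + T vs) x"
  unfolding has_multilinear_derivative_def
proof (intro conjI allI impI)
  show "bounded_multilinear_form (Suc k) (\<lambda>vs. S vs + T vs)"
    using F G by (auto simp: has_multilinear_derivative_def intro: bounded_multilinear_form_add)
next
  fix e :: real assume "e > 0"
  then have e: "e / 2 > 0" by simp
  from has_multilinear_derivativeD[OF F e] has_multilinear_derivativeD[OF G e]
  show "\<forall>\<^sub>F y in nhds x. \<forall>vs. length vs = k \<longrightarrow>
        \<bar>F y vs + G y vs - (F x vs + G x vs) - (S ((y - x) # vs) + T ((y - x) # vs))\<bar>
        \<le> e * norm (y - x) * norm_prod vs"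
  proof eventually_elim
    case (elim y)
    show ?case
    proof (intro allI impI)
      fix vs :: "'a list" assume l: "length vs = k"
      show "\<bar>F y vs + G y vs - (F x vs + G x vs) - (S ((y - x) # vs) + T ((y - x) # vs))\<bar>
        \<le> e * norm (y - x) * norm_prod vs"
        using elim(1)[rule_format, OF l] elim(2)[rule_format, OF l]
        unfolding times_divide_eq_left by argo
    qed
  qed
qed

lemma has_multilinear_derivative_scale:
  assumes F: "has_multilinear_derivative k F S x"
  shows "has_multilinear_derivative k (\<lambda>x vs. c * F x vs) (\<lambda>vs. c * S vs) x"
  unfolding has_multilinear_derivative_def
proof (intro conjI allI impI)
  show "bounded_multilinear_form (Suc k) (\<lambda>vs. c * S vs)"
    using F by (auto simp: has_multilinear_derivative_def intro: bounded_multilinear_form_scale)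
next
  fix e :: real assume "e > 0"
  then have e: "e / (\<bar>c\<bar> + 1) > 0" by simp
  from has_multilinear_derivativeD[OF F e]
  show "\<forall>\<^sub>F y in nhds x. \<forall>vs. length vs = k \<longrightarrow>
        \<bar>c * F y vs - c * F x vs - c * S ((y - x) # vs)\<bar> \<le> e * norm (y - x) * norm_prod vs"
  proof eventually_elim
    case (elim y)
    show ?case
    proof (intro allI impI)
      fix vs :: "'a list" assume "length vs = k"
      have "\<bar>c * F y vs - c * F x vs - c * S ((y - x) # vs)\<bar>
          = \<bar>c\<bar> * \<bar>F y vs - F x vs - S ((y - x) # vs)\<bar>"
        by (simp add: abs_mult[symmetric] algebra_simps)
      also have "\<dots> \<le> (\<bar>c\<bar> + 1) * (e / (\<bar>c\<bar> + 1) * norm (y - x) * norm_prod vs)"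
        using elim \<open>length vs = k\<close> by (intro mult_mono) auto
      also have "\<dots> = e * norm (y - x) * norm_prod vs"
        by simp
      finally show "\<bar>c * F y vs - c * F x vs - c * S ((y - x) # vs)\<bar>
        \<le> e * norm (y - x) * norm_prod vs" .
    qed
  qed
qed

lemma has_multilinear_derivative_lipschitz:
  assumes "has_multilinear_derivative k F T x"
  obtains C where "C \<ge> 0" "\<forall>\<^sub>F y in nhds x. \<forall>vs. length vs = k \<longrightarrow>
     \<bar>F y vs - F x vs\<bar> \<le> C * norm (y - x) * norm_prod vs"
proof -
  obtain C where C: "C \<ge> 0" "\<And>vs. length vs = Suc k \<Longrightarrow> \<bar>T vs\<bar> \<le> C * norm_prod vs"
    using bounded_multilinear_form_bound[of "Suc k" T] assms unfolding has_multilinear_derivative_def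
    by blast
  show thesis
  proof (rule that[of "C + 1"])
    from has_multilinear_derivativeD[OF assms zero_less_one]
    show "\<forall>\<^sub>F y in nhds x. \<forall>vs. length vs = k \<longrightarrow>
       \<bar>F y vs - F x vs\<bar> \<le> (C + 1) * norm (y - x) * norm_prod vs"
    proof eventually_elim
      case (elim y)
      show ?case
      proof (intro allI impI)
        fix vs :: "'a list" assume l: "length vs = k"
        show "\<bar>F y vs - F x vs\<bar> \<le> (C + 1) * norm (y - x) * norm_prod vs"
          using C(2)[of "(y - x) # vs"] l elim[rule_format, OF l] by (simp add: algebra_simps)
      qed
    qed
  qed (use C in simp)
qed

text \<open>
  The product rule. With \<open>a\<close>, \<open>b\<close> the remainders of \<open>F\<close>, \<open>G\<close>, the remainder of the product is
  \<open>a * G x + F x * b + (F y - F x) * (G y - G x)\<close>; the last term is quadratic in \<open>norm (y - x)\<close>.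
\<close>

lemma has_multilinear_derivative_mask_tensor:
  assumes F: "has_multilinear_derivative k F S x" and G: "has_multilinear_derivative l G T x"
    and bF: "bounded_multilinear_form k (F x)" and bG: "bounded_multilinear_form l (G x)"
    and I: "card (I \<inter> {..<k + l}) = k"
  shows "has_multilinear_derivative (k + l) (\<lambda>x. mask_tensor I (F x) (G x))
    (\<lambda>vs. mask_tensor (insert 0 (Suc ` I)) S (G x) vs + mask_tensor (Suc ` I) (F x) T vs) x"
proof -
  have bS: "bounded_multilinear_form (Suc k) S" and bT: "bounded_multilinear_form (Suc l) T"
    using F G by (auto simp: has_multilinear_derivative_def)
  note c2 = card_shifted_mask(1)[OF I] and c1 = card_shifted_mask(2)[OF I]
  have b1: "bounded_multilinear_form (Suc (k + l)) (mask_tensor (insert 0 (Suc ` I)) S (G x))"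
    using bounded_multilinear_form_mask_tensor[OF bS bG, of "insert 0 (Suc ` I)"] c1 by simp
  have b2: "bounded_multilinear_form (Suc (k + l)) (mask_tensor (Suc ` I) (F x) T)"
    using bounded_multilinear_form_mask_tensor[OF bF bT, of "Suc ` I"] c2 by simp
  have n1: "nths (h # vs) (insert 0 (Suc ` I)) = h # nths vs I"
    "nths (h # vs) (- insert 0 (Suc ` I)) = nths vs (- I)"
    "nths (h # vs) (Suc ` I) = nths vs I"
    "nths (h # vs) (- (Suc ` I)) = h # nths vs (- I)" for h and vs :: "'a list"
  proof -
    have s: "{j. Suc j \<in> insert 0 (Suc ` I)} = I" "{j. Suc j \<in> - insert 0 (Suc ` I)} = - I"
      "{j. Suc j \<in> Suc ` I} = I" "{j. Suc j \<in> - (Suc ` I)} = - I" by auto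
    show "nths (h # vs) (insert 0 (Suc ` I)) = h # nths vs I"
      "nths (h # vs) (- insert 0 (Suc ` I)) = nths vs (- I)"
      "nths (h # vs) (Suc ` I) = nths vs I"
      "nths (h # vs) (- (Suc ` I)) = h # nths vs (- I)"
      unfolding nths_Cons s by auto
  qed
  obtain C where C: "C \<ge> 0" "\<And>vs. length vs = k \<Longrightarrow> \<bar>F x vs\<bar> \<le> C * norm_prod vs"
    using bounded_multilinear_form_bound[OF bF] by blast
  obtain D where D: "D \<ge> 0" "\<And>vs. length vs = l \<Longrightarrow> \<bar>G x vs\<bar> \<le> D * norm_prod vs"
    using bounded_multilinear_form_bound[OF bG] by blast
  obtain L where L: "L \<ge> 0" "\<forall>\<^sub>F y in nhds x. \<forall>vs. length vs = k \<longrightarrow>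
     \<bar>F y vs - F x vs\<bar> \<le> L * norm (y - x) * norm_prod vs"
    using F by (rule has_multilinear_derivative_lipschitz)
  obtain M where M: "M \<ge> 0" "\<forall>\<^sub>F y in nhds x. \<forall>vs. length vs = l \<longrightarrow>
     \<bar>G y vs - G x vs\<bar> \<le> M * norm (y - x) * norm_prod vs"
    using G by (rule has_multilinear_derivative_lipschitz)
  show ?thesis
    unfolding has_multilinear_derivative_def
  proof (intro conjI allI impI)
    fix e :: real assume "e > 0"
    define e' where "e' = e / (C + D + L * M + 1)"
    have e': "e' > 0"
      using \<open>e > 0\<close> C D L M by (simp add: e'_def add_nonneg_pos)
    have "\<forall>\<^sub>F y in nhds x. norm (y - x) < e'"
      using e' by (auto simp: eventually_nhds_metric dist_norm)
    with has_multilinear_derivativeD[OF F e'] has_multilinear_derivativeD[OF G e'] L(2) M(2)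
    show "\<forall>\<^sub>F y in nhds x. \<forall>vs. length vs = k + l \<longrightarrow>
        \<bar>mask_tensor I (F y) (G y) vs - mask_tensor I (F x) (G x) vs
          - (mask_tensor (insert 0 (Suc ` I)) S (G x) ((y - x) # vs)
             + mask_tensor (Suc ` I) (F x) T ((y - x) # vs))\<bar>
        \<le> e * norm (y - x) * norm_prod vs"
    proof eventually_elim
      case (elim y)
      show ?case
      proof (intro allI impI)
        fix vs :: "'a list" assume len: "length vs = k + l"
        define us ws where "us = nths vs I" and "ws = nths vs (- I)"
        have lus: "length us = k" and lws: "length ws = l"
          using length_nths_mask[OF len I] by (auto simp: us_def ws_def)
        define p q h where "p = norm_prod us" and "q = norm_prod ws" and "h = norm (y - x)"
        have pq: "p \<ge> 0" "q \<ge> 0" "h \<ge> 0" "norm_prod vs = p * q"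
          using norm_prod_nths[of vs I]
          by (auto simp: p_def q_def us_def ws_def h_def norm_prod_nonneg)
        define a b c d where "a = F y us - F x us - S ((y - x) # us)" and
          "b = G y ws - G x ws - T ((y - x) # ws)" and
          "c = F y us - F x us" and "d = G y ws - G x ws"
        have a: "\<bar>a\<bar> \<le> e' * h * p" and b: "\<bar>b\<bar> \<le> e' * h * q" and c: "\<bar>c\<bar> \<le> L * h * p"
          and d: "\<bar>d\<bar> \<le> M * h * q" and h: "h \<le> e'"
          using elim lus lws by (auto simp: a_def b_def c_def d_def p_def q_def h_def)
        have "mask_tensor I (F y) (G y) vs - mask_tensor I (F x) (G x) vs
          - (mask_tensor (insert 0 (Suc ` I)) S (G x) ((y - x) # vs)
             + mask_tensor (Suc ` I) (F x) T ((y - x) # vs))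
          = a * G x ws + F x us * b + c * d"
          unfolding mask_tensor_def n1 us_def[symmetric] ws_def[symmetric]
          by (simp add: a_def b_def c_def d_def algebra_simps)
        also have "\<bar>\<dots>\<bar> \<le> \<bar>a\<bar> * \<bar>G x ws\<bar> + \<bar>F x us\<bar> * \<bar>b\<bar> + \<bar>c\<bar> * \<bar>d\<bar>"
          by (simp only: abs_mult[symmetric])
        also have "\<dots> \<le> (e' * h * p) * (D * q) + (C * p) * (e' * h * q) + (L * h * p) * (M * h * q)"
        proof (intro add_mono mult_mono)
          show "\<bar>G x ws\<bar> \<le> D * q" "\<bar>F x us\<bar> \<le> C * p"
            using C(2)[OF lus] D(2)[OF lws] by (simp_all add: p_def q_def)
          show "0 \<le> e' * h * p" "0 \<le> C * p" "0 \<le> L * h * p"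
            using e' pq L(1) C(1) by simp_all
        qed (rule a b c d abs_ge_zero)+
        also have "\<dots> = (D * e' + C * e' + L * M * h) * (h * p * q)"
          by (simp add: algebra_simps)
        also have "\<dots> \<le> (D * e' + C * e' + L * M * e') * (h * p * q)"
          using h pq L M by (intro mult_right_mono add_left_mono mult_left_mono) auto
        also have "\<dots> \<le> ((C + D + L * M + 1) * e') * (h * p * q)"
          using e' pq by (intro mult_right_mono) (auto simp: algebra_simps)
        also have "(C + D + L * M + 1) * e' = e"
        proof -
          have "C + D + L * M + 1 > 0" using C D L M by (simp add: add_nonneg_pos)
          then show ?thesis by (simp add: e'_def)
        qed
        finally show "\<bar>mask_tensor I (F y) (G y) vs - mask_tensor I (F x) (G x) vs
          - (mask_tensor (insert 0 (Suc ` I)) S (G x) ((y - x) # vs)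
             + mask_tensor (Suc ` I) (F x) T ((y - x) # vs))\<bar>
          \<le> e * norm (y - x) * norm_prod vs"
          by (simp add: pq h_def mult.assoc)
      qed
    qed
  qed (intro bounded_multilinear_form_add b1 b2)
qed

text \<open>
  The difference of two derivatives is of smaller order than \<open>t\<close> along a ray \<open>x + t *\<^sub>R h\<close> and
  homogeneous in \<open>t\<close>, hence zero. Uniqueness holds only on lists of the right length, which is why the
  values of forms are compared on these lists alone.
\<close>

lemma has_multilinear_derivative_unique:
  assumes F: "has_multilinear_derivative k F S x" and G: "has_multilinear_derivative k G T x"
    and eq: "\<forall>\<^sub>F y in nhds x. \<forall>vs. length vs = k \<longrightarrow> F y vs = G y vs"
    and len: "length ws = Suc k"
  shows "S ws = T ws"
proof (rule ccontr)
  assume ne: "S ws \<noteq> T ws"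
  obtain h vs where ws: "ws = h # vs" and l: "length vs = k"
    using len by (cases ws) auto
  define c where "c = \<bar>S ws - T ws\<bar>"
  define M where "M = norm h * norm_prod vs"
  have c: "c > 0" and M: "M \<ge> 0"
    using ne by (auto simp: c_def M_def norm_prod_nonneg)
  define e where "e = c / (4 * (M + 1))"
  have e: "e > 0" using c M by (auto simp: e_def intro!: divide_pos_pos mult_pos_pos)
  from has_multilinear_derivativeD[OF F e] has_multilinear_derivativeD[OF G e] eq
  have ev: "\<forall>\<^sub>F y in nhds x. \<bar>S ((y - x) # vs) - T ((y - x) # vs)\<bar> \<le> 2 * e * norm (y - x) * norm_prod vs"
  proof eventually_elim
    case (elim y)
    have "F x vs = G x vs" using eq l by (auto dest: eventually_nhds_x_imp_x)
    moreover have "F y vs = G y vs" using elim(3) l by auto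
    ultimately show ?case
      using elim(1)[rule_format, OF l] elim(2)[rule_format, OF l] by simp
  qed
  have lim: "((\<lambda>t. x + t *\<^sub>R h) \<longlongrightarrow> x + 0 *\<^sub>R h) (at_right 0)"
    by (intro tendsto_intros)
  have "\<forall>\<^sub>F t in at_right 0. \<bar>S ((x + t *\<^sub>R h - x) # vs) - T ((x + t *\<^sub>R h - x) # vs)\<bar>
      \<le> 2 * e * norm (x + t *\<^sub>R h - x) * norm_prod vs"
    by (rule eventually_compose_filterlim[OF ev]) (use lim in simp)
  moreover have "\<forall>\<^sub>F t::real in at_right 0. t > 0"
    by (simp add: eventually_at_filter)
  ultimately have "\<forall>\<^sub>F t::real in at_right 0. t > 0 \<and> \<bar>S ((t *\<^sub>R h) # vs) - T ((t *\<^sub>R h) # vs)\<bar>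
      \<le> 2 * e * norm (t *\<^sub>R h) * norm_prod vs"
    by eventually_elim auto
  then obtain t :: real where t: "t > 0"
    "\<bar>S ((t *\<^sub>R h) # vs) - T ((t *\<^sub>R h) # vs)\<bar> \<le> 2 * e * norm (t *\<^sub>R h) * norm_prod vs"
    using eventually_happens'[OF trivial_limit_at_right_real] by blast
  have "linear (\<lambda>h. S (h # vs))" "linear (\<lambda>h. T (h # vs))"
    using F G l by (auto simp: has_multilinear_derivative_def intro: bounded_multilinear_form_linear_hd)
  then have lin: "S ((t *\<^sub>R h) # vs) = t * S ws" "T ((t *\<^sub>R h) # vs) = t * T ws"
    using ws by (auto dest: linear_scale)
  have "t * c = \<bar>t * S ws - t * T ws\<bar>"
    using t(1) by (simp add: c_def abs_mult right_diff_distrib[symmetric])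
  also have "\<dots> \<le> t * (2 * e * M)"
    using t unfolding lin by (simp add: M_def mult_ac)
  finally have "t * c \<le> t * (2 * e * M)" .
  then have "c \<le> 2 * e * M" using t(1) by simp
  also have "\<dots> \<le> 2 * e * (M + 1)" using e by simp
  also have "\<dots> = c / 2" using M by (simp add: e_def field_simps)
  finally show False using c by simp
qed

section \<open>Smoothness by coinduction\<close>

text \<open>
  Infinite differentiability of a function with values in the \<open>k\<close>-linear forms. Boundedness of the
  values \<open>F x\<close> is required in addition, as differentiability speaks only of increments of \<open>F\<close> and the
  product rule needs it.
\<close>

coinductive smooth_form ::
  "('a::real_normed_vector) set \<Rightarrow> nat \<Rightarrow> ('a \<Rightarrow> 'a list \<Rightarrow> real) \<Rightarrow> bool" for U where
  smooth_form_step: "(\<And>x. x \<in> U \<Longrightarrow> bounded_multilinear_form k (F x)) \<Longrightarrow>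
   (\<And>x. x \<in> U \<Longrightarrow> has_multilinear_derivative k F (G x) x) \<Longrightarrow>
   smooth_form U (Suc k) G \<Longrightarrow> smooth_form U k F"

abbreviation smooth_on :: "('a::real_normed_vector) set \<Rightarrow> ('a \<Rightarrow> real) \<Rightarrow> bool" where
  "smooth_on U f \<equiv> smooth_form U 0 (\<lambda>x _. f x)"

lemma smooth_formD:
  assumes "smooth_form U k F"
  shows "\<forall>x\<in>U. bounded_multilinear_form k (F x)"
    "\<exists>G. (\<forall>x\<in>U. has_multilinear_derivative k F (G x) x) \<and> smooth_form U (Suc k) G"
  using assms by (cases rule: smooth_form.cases; blast)+

lemma Cinfinity_on_if_smooth_on:
  assumes "smooth_on U f"
  shows "Cinfinity_on U f"
proof -
  have "\<exists>D. \<forall>k. (smooth_form U k (D k) \<and> (k = 0 \<longrightarrow> D k = (\<lambda>x _. f x))) \<and>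
     (\<forall>x\<in>U. has_multilinear_derivative k (D k) (D (Suc k) x) x)"
    by (rule dependent_nat_choice) (use assms smooth_formD(2) in \<open>blast+\<close>)
  then obtain D where "\<And>k. smooth_form U k (D k)" "D 0 = (\<lambda>x _. f x)"
    "\<And>k x. x \<in> U \<Longrightarrow> has_multilinear_derivative k (D k) (D (Suc k) x) x" by metis
  then show ?thesis
    unfolding Cinfinity_on_def by (intro exI[of _ D]) auto
qed

lemma smooth_form_zero: "smooth_form U k (\<lambda>_ _. 0)"
proof (coinduction arbitrary: k)
  case smooth_form
  show ?case
    by (intro exI[of _ "\<lambda>_ _. 0"] exI[of _ k])
      (auto simp: bounded_multilinear_form_zero has_multilinear_derivative_zero)
qed

text \<open>
  A coinduction up to algebra: a class of form-valued functions need not be closed under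
  differentiation itself, it suffices that the derivatives lie in the class generated from it by
  sums, multiples and tensor products.
\<close>

inductive form_closure ::
  "(nat \<Rightarrow> ('a::real_normed_vector \<Rightarrow> 'a list \<Rightarrow> real) \<Rightarrow> bool) \<Rightarrow>
   nat \<Rightarrow> ('a \<Rightarrow> 'a list \<Rightarrow> real) \<Rightarrow> bool" for B where
  base: "B k F \<Longrightarrow> form_closure B k F"
| zero: "form_closure B k (\<lambda>_ _. 0)"
| add: "form_closure B k F \<Longrightarrow> form_closure B k G \<Longrightarrow> form_closure B k (\<lambda>x vs. F x vs + G x vs)"
| scale: "form_closure B k F \<Longrightarrow> form_closure B k (\<lambda>x vs. c * F x vs)"
| tensor: "form_closure B k F \<Longrightarrow> form_closure B l G \<Longrightarrow> card (I \<inter> {..<k + l}) = k \<Longrightarrow>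
     form_closure B (k + l) (\<lambda>x. mask_tensor I (F x) (G x))"

lemma smooth_form_closure:
  assumes base: "\<And>k F. B k F \<Longrightarrow> (\<forall>x\<in>U. bounded_multilinear_form k (F x)) \<and>
     (\<exists>G. (\<forall>x\<in>U. has_multilinear_derivative k F (G x) x) \<and> form_closure B (Suc k) G)"
    and F: "form_closure B k F"
  shows "smooth_form U k F"
proof -
  have step: "(\<forall>x\<in>U. bounded_multilinear_form k (F x)) \<and>
     (\<exists>G. (\<forall>x\<in>U. has_multilinear_derivative k F (G x) x) \<and> form_closure B (Suc k) G)"
    if "form_closure B k F" for k F
    using that
  proof induction
    case (base k F)
    then show ?case using assms(1) by blast
  next
    case (zero k)
    then show ?case
      by (auto intro!: exI[of _ "\<lambda>_ _. 0"] form_closure.zero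
          simp: bounded_multilinear_form_zero has_multilinear_derivative_zero)
  next
    case (add k F G)
    then obtain F' G' where "form_closure B (Suc k) F'" "form_closure B (Suc k) G'"
      "\<forall>x\<in>U. has_multilinear_derivative k F (F' x) x"
      "\<forall>x\<in>U. has_multilinear_derivative k G (G' x) x" by blast
    then show ?case using add
      by (auto intro!: exI[of _ "\<lambda>x vs. F' x vs + G' x vs"] form_closure.add
          bounded_multilinear_form_add has_multilinear_derivative_add)
  next
    case (scale k F c)
    then obtain F' where "form_closure B (Suc k) F'"
      "\<forall>x\<in>U. has_multilinear_derivative k F (F' x) x" by blast
    then show ?case using scale
      by (auto intro!: exI[of _ "\<lambda>x vs. c * F' x vs"] form_closure.scale
          bounded_multilinear_form_scale has_multilinear_derivative_scale)
  next
    case (tensor k F l G I)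
    then obtain F' G' where F': "form_closure B (Suc k) F'"
        "\<forall>x\<in>U. has_multilinear_derivative k F (F' x) x"
      and G': "form_closure B (Suc l) G'"
      "\<forall>x\<in>U. has_multilinear_derivative l G (G' x) x" by blast
    note c2 = card_shifted_mask(1)[OF tensor.hyps(3)] and c1 = card_shifted_mask(2)[OF tensor.hyps(3)]
    have 1: "form_closure B (Suc (k + l)) (\<lambda>x. mask_tensor (insert 0 (Suc ` I)) (F' x) (G x))"
      using form_closure.tensor[OF F'(1) tensor.hyps(2), of "insert 0 (Suc ` I)"] c1 by simp
    have 2: "form_closure B (Suc (k + l)) (\<lambda>x. mask_tensor (Suc ` I) (F x) (G' x))"
      using form_closure.tensor[OF tensor.hyps(1) G'(1), of "Suc ` I"] c2 by simp
    show ?case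
    proof (intro conjI ballI exI)
      show "form_closure B (Suc (k + l)) (\<lambda>x vs. mask_tensor (insert 0 (Suc ` I)) (F' x) (G x) vs +
          mask_tensor (Suc ` I) (F x) (G' x) vs)"
        using 1 2 by (rule form_closure.add)
    qed (use tensor F' G' in \<open>auto intro!: bounded_multilinear_form_mask_tensor
          has_multilinear_derivative_mask_tensor\<close>)
  qed
  show ?thesis
    using F
  proof (coinduction arbitrary: k F)
    case smooth_form
    from step[OF smooth_form] obtain G where
      "\<forall>x\<in>U. has_multilinear_derivative k F (G x) x" "form_closure B (Suc k) G" by blast
    with step[OF smooth_form] show ?case
      by (intro exI[of _ k] exI[of _ F] exI[of _ G]) simp
  qed
qed

lemma form_closure_smooth_form:
  assumes "form_closure (smooth_form U) k F" shows "smooth_form U k F"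
proof (rule smooth_form_closure[OF _ assms])
  fix k F assume F: "smooth_form U k F"
  obtain G where "\<forall>x\<in>U. has_multilinear_derivative k F (G x) x" "smooth_form U (Suc k) G"
    using smooth_formD(2)[OF F] by blast
  then show "(\<forall>x\<in>U. bounded_multilinear_form k (F x)) \<and>
     (\<exists>G. (\<forall>x\<in>U. has_multilinear_derivative k F (G x) x) \<and>
       form_closure (smooth_form U) (Suc k) G)"
    using smooth_formD(1)[OF F] by (auto intro!: exI[of _ G] form_closure.base)
qed

lemma smooth_form_add:
  "smooth_form U k F \<Longrightarrow> smooth_form U k G \<Longrightarrow> smooth_form U k (\<lambda>x vs. F x vs + G x vs)"
  by (rule form_closure_smooth_form[OF form_closure.add[OF form_closure.base form_closure.base]])

lemma smooth_form_scale:
  "smooth_form U k F \<Longrightarrow> smooth_form U k (\<lambda>x vs. c * F x vs)"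
  by (rule form_closure_smooth_form[OF form_closure.scale[OF form_closure.base]])

text \<open>
  Local smooth representatives glue: their derivatives agree where the domains overlap, by uniqueness,
  so choosing any derivative at each point gives again a function with local smooth representatives.
\<close>

lemma smooth_form_local:
  assumes "open U"
    and "\<And>x. x \<in> U \<Longrightarrow> \<exists>V F'. open V \<and> x \<in> V \<and> smooth_form V k F' \<and>
       (\<forall>y\<in>V. \<forall>vs. length vs = k \<longrightarrow> F y vs = F' y vs)"
  shows "smooth_form U k F"
  using assms(2)
proof (coinduction arbitrary: k F)
  case (smooth_form k F)
  define G where "G x = (SOME T. has_multilinear_derivative k F T x)" for x
  have transfer: "bounded_multilinear_form k (F x) \<and> has_multilinear_derivative k F T x"
    if "open V" "x \<in> V" and bF': "bounded_multilinear_form k (F' x)"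
      and F'T: "has_multilinear_derivative k F' T x"
      and eq: "\<And>y vs. y \<in> V \<Longrightarrow> length vs = k \<Longrightarrow> F y vs = F' y vs" for V x F' T
  proof
    obtain C where C: "\<And>vs. length vs = k \<Longrightarrow> \<bar>F' x vs\<bar> \<le> C * norm_prod vs"
      using bounded_multilinear_form_bound[OF bF'] by blast
    show "bounded_multilinear_form k (F x)"
      by (rule bounded_multilinear_formI[where C = C])
        (use bF' C in \<open>auto simp: bounded_multilinear_form_def eq[OF \<open>x \<in> V\<close>]\<close>)
    have V: "\<forall>\<^sub>F y in nhds x. y \<in> V" using that by (simp add: eventually_nhds_in_open)
    show "has_multilinear_derivative k F T x"
      unfolding has_multilinear_derivative_def
    proof (intro conjI allI impI)
      fix e :: real assume "e > 0"
      from V has_multilinear_derivativeD[OF F'T this]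
      show "\<forall>\<^sub>F y in nhds x. \<forall>vs. length vs = k \<longrightarrow>
        \<bar>F y vs - F x vs - T ((y - x) # vs)\<bar> \<le> e * norm (y - x) * norm_prod vs"
        by eventually_elim (simp add: eq \<open>x \<in> V\<close>)
    qed (use F'T in \<open>simp add: has_multilinear_derivative_def\<close>)
  qed
  have loc: "\<exists>V G'. open V \<and> x \<in> V \<and> smooth_form V (Suc k) G' \<and>
      (\<forall>y\<in>V. bounded_multilinear_form k (F y) \<and> has_multilinear_derivative k F (G' y) y)"
    if x: "x \<in> U" for x
  proof -
    obtain V F' where V: "open V" "x \<in> V" "smooth_form V k F'"
       "\<forall>y\<in>V. \<forall>vs. length vs = k \<longrightarrow> F y vs = F' y vs"
      using smooth_form[rule_format, OF x] by blast
    obtain G' where G': "\<forall>x\<in>V. has_multilinear_derivative k F' (G' x) x"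
        "smooth_form V (Suc k) G'"
      using smooth_formD(2)[OF V(3)] by blast
    have "bounded_multilinear_form k (F y) \<and> has_multilinear_derivative k F (G' y) y"
      if "y \<in> V" for y
      by (rule transfer[OF V(1) that]) (use smooth_formD(1)[OF V(3)] G' V(4) that in auto)
    then show ?thesis using V(1,2) G'(2) by blast
  qed
  have G: "has_multilinear_derivative k F (G y) y"
    if "has_multilinear_derivative k F T y" for y T
    unfolding G_def
    by (rule someI[where P = "\<lambda>T. has_multilinear_derivative k F T y"]) (rule that)
  have "\<exists>V G'. open V \<and> x \<in> V \<and> smooth_form V (Suc k) G' \<and>
       (\<forall>y\<in>V. \<forall>vs. length vs = Suc k \<longrightarrow> G y vs = G' y vs)" if x: "x \<in> U" for x
  proof -
    obtain V G' where V: "open V" "x \<in> V" "smooth_form V (Suc k) G'"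
      "\<forall>y\<in>V. bounded_multilinear_form k (F y) \<and> has_multilinear_derivative k F (G' y) y"
      using loc[OF x] by blast
    have "G y vs = G' y vs" if "y \<in> V" "length vs = Suc k" for y vs
    proof (rule has_multilinear_derivative_unique[where F = F and G = F and k = k and x = y])
      show G': "has_multilinear_derivative k F (G' y) y" using V(4) that by blast
      show "has_multilinear_derivative k F (G y) y" by (rule G[OF G'])
    qed (use that in auto)
    then show ?thesis using V(1-3) by blast
  qed
  moreover have "bounded_multilinear_form k (F x) \<and> has_multilinear_derivative k F (G x) x"
    if "x \<in> U" for x
    using loc[OF that] G by blast
  ultimately show ?case
    by (intro exI[of _ k] exI[of _ F] exI[of _ G]) simp
qed

lemma smooth_on_differentiable:
  assumes "smooth_on U f"
  obtains G where "smooth_form U 1 G"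
    "\<And>x. x \<in> U \<Longrightarrow> (f has_derivative (\<lambda>h. G x [h])) (at x)"
  using smooth_formD(2)[OF assms] by (auto simp: has_multilinear_derivative_0_iff)

coinductive smooth_real :: "real set \<Rightarrow> (real \<Rightarrow> real) \<Rightarrow> bool" for S where
  smooth_real_step: "(\<And>t. t \<in> S \<Longrightarrow> (g has_real_derivative g' t) (at t)) \<Longrightarrow> smooth_real S g' \<Longrightarrow>
    smooth_real S g"

lemma smooth_realD:
  assumes "smooth_real S g"
  shows "\<exists>g'. (\<forall>t\<in>S. (g has_real_derivative g' t) (at t)) \<and> smooth_real S g'"
  using assms by (cases rule: smooth_real.cases) blast

lemma has_multilinear_derivative_one_form:
  assumes f: "(f has_derivative f') (at x)" and T: "\<And>h. T [h] = f' h"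
  shows "has_multilinear_derivative 0 (\<lambda>x _. f x) T x"
  using f by (simp add: has_multilinear_derivative_0_iff T)

text \<open>
  The form in which the closure principle is used below: \<open>A\<close> is a class of scalar functions whose
  derivatives are built from members of \<open>A\<close> and from forms already known to be smooth.
\<close>

lemma smooth_on_if_derivative_closed:
  fixes A :: "('a::real_normed_vector \<Rightarrow> real) set" and U
  defines "B \<equiv> \<lambda>k F. smooth_form U k F \<or> (k = 0 \<and> (\<exists>a\<in>A. F = (\<lambda>x _. a x)))"
  assumes step: "\<And>a. a \<in> A \<Longrightarrow> \<exists>G. (\<forall>x\<in>U. has_multilinear_derivative 0 (\<lambda>x _. a x) (G x) x) \<and>
      form_closure B 1 G"
    and u: "u \<in> A"
  shows "smooth_on U u"
proof -
  have "form_closure B 0 (\<lambda>x _. u x)"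
    using u by (intro form_closure.base) (auto simp: B_def)
  then show ?thesis
  proof (rule smooth_form_closure[rotated])
    fix k F assume "B k F"
    then consider "smooth_form U k F" | a where "k = 0" "a \<in> A" "F = (\<lambda>x _. a x)"
      by (auto simp: B_def)
    then show "(\<forall>x\<in>U. bounded_multilinear_form k (F x)) \<and>
     (\<exists>G. (\<forall>x\<in>U. has_multilinear_derivative k F (G x) x) \<and> form_closure B (Suc k) G)"
    proof cases
      case 1
      obtain G where G: "\<forall>x\<in>U. has_multilinear_derivative k F (G x) x" "smooth_form U (Suc k) G"
        using smooth_formD(2)[OF 1] by blast
      have "form_closure B (Suc k) G" using G(2) by (intro form_closure.base) (simp add: B_def)
      then show ?thesis using G(1) smooth_formD(1)[OF 1] by blast
    next
      case 2
      then show ?thesis using step[OF 2(2)] by (simp add: bounded_multilinear_form_0)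
    qed
  qed
qed

text \<open>
  The class \<open>A\<close> consists of all \<open>g \<circ> f\<close> with \<open>g\<close> smooth on \<open>S\<close>, since the derivative of \<open>g \<circ> f\<close> is
  \<open>(g' \<circ> f) \<otimes> Df\<close>. This takes the place of the formula of Faa di Bruno.
\<close>

lemma smooth_on_compose:
  assumes f: "smooth_on U f" and g: "smooth_real S g" and fS: "f ` U \<subseteq> S"
  shows "smooth_on U (\<lambda>x. g (f x))"
proof (rule smooth_on_if_derivative_closed[where A = "{\<lambda>x. g (f x) |g. smooth_real S g}"])
  obtain Df where Df: "smooth_form U 1 Df"
    "\<And>x. x \<in> U \<Longrightarrow> (f has_derivative (\<lambda>h. Df x [h])) (at x)"
    using f by (rule smooth_on_differentiable) blast
  let ?A = "{\<lambda>x. g (f x) |g. smooth_real S g}"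
  let ?B = "\<lambda>k F. smooth_form U k F \<or> (k = 0 \<and> (\<exists>a\<in>?A. F = (\<lambda>x _. a x)))"
  fix a assume "a \<in> ?A"
  then obtain g where g: "smooth_real S g" "a = (\<lambda>x. g (f x))" by blast
  obtain g' where g': "\<And>t. t \<in> S \<Longrightarrow> (g has_real_derivative g' t) (at t)" "smooth_real S g'"
    using smooth_realD[OF g(1)] by blast
  let ?G = "\<lambda>x. mask_tensor {} (\<lambda>_. g' (f x)) (Df x)"
  have "form_closure ?B (0 + 1) ?G"
    by (intro form_closure.tensor form_closure.base) (use Df g' in auto)
  moreover have "has_multilinear_derivative 0 (\<lambda>x _. a x) (?G x) x" if "x \<in> U" for x
  proof -
    have "((\<lambda>y. g (f y)) has_derivative (\<lambda>h. g' (f x) * Df x [h])) (at x)"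
      using has_derivative_compose[OF Df(2)[OF that]
          g'(1)[unfolded has_field_derivative_def, of "f x"]] fS that by auto
    then show ?thesis
      unfolding g by (rule has_multilinear_derivative_one_form) (simp add: mask_tensor_def)
  qed
  ultimately show "\<exists>G. (\<forall>x\<in>U. has_multilinear_derivative 0 (\<lambda>x _. a x) (G x) x) \<and> form_closure ?B 1 G"
    by (intro exI[of _ ?G]) simp
qed (use g in blast)

lemma smooth_form_linear:
  assumes "bounded_linear b"
  shows "smooth_form U 1 (\<lambda>_ vs. b (hd vs))"
proof (rule smooth_form_step)
  show "smooth_form U (Suc 1) (\<lambda>_ _. 0)" by (rule smooth_form_zero)
  have "bounded_multilinear_form 1 (\<lambda>vs. b (hd vs))"
  proof -
    interpret bounded_linear b by fact
    obtain K where K: "\<And>x. norm (b x) \<le> norm x * K" using bounded by blast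
    show ?thesis
      by (rule bounded_multilinear_formI[where C = K])
        (use linear K in \<open>auto simp: length_Suc_conv mult.commute\<close>)
  qed
  then show "bounded_multilinear_form 1 (\<lambda>vs. b (hd vs))" .
  show "has_multilinear_derivative 1 (\<lambda>_ vs. b (hd vs)) (\<lambda>_. 0) x" for x
    unfolding has_multilinear_derivative_def
    by (auto simp: bounded_multilinear_form_zero norm_prod_nonneg intro!: mult_nonneg_nonneg)
qed

lemma smooth_on_if_finite_coordinates:
  assumes b: "\<And>e. e \<in> S \<Longrightarrow> bounded_linear (b e)" and S: "finite S"
    and step: "\<And>a. a \<in> A \<Longrightarrow> \<exists>a'. (\<forall>e\<in>S. a' e \<in> A) \<and>
      (\<forall>x\<in>U. (a has_derivative (\<lambda>h. \<Sum>e\<in>S. a' e x * b e h)) (at x))"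
    and u: "u \<in> A"
  shows "smooth_on U u"
proof (rule smooth_on_if_derivative_closed[OF _ u])
  let ?B = "\<lambda>k F. smooth_form U k F \<or> (k = 0 \<and> (\<exists>a\<in>A. F = (\<lambda>x _. a x)))"
  fix a assume "a \<in> A"
  then obtain a' where a': "\<And>e. e \<in> S \<Longrightarrow> a' e \<in> A"
    "\<And>x. x \<in> U \<Longrightarrow> (a has_derivative (\<lambda>h. \<Sum>e\<in>S. a' e x * b e h)) (at x)"
    using step by blast
  let ?G = "\<lambda>T x vs. \<Sum>e\<in>T. mask_tensor {} (\<lambda>_. a' e x) (\<lambda>vs. b e (hd vs)) vs"
  have "form_closure ?B 1 (?G T)" if "T \<subseteq> S" for T
    using finite_subset[OF that S] that
  proof induction
    case empty
    then show ?case by (simp add: form_closure.zero)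
  next
    case (insert e T)
    have "form_closure ?B (0 + 1) (\<lambda>x. mask_tensor {} (\<lambda>_. a' e x) (\<lambda>vs. b e (hd vs)))"
      by (intro form_closure.tensor form_closure.base)
        (use insert a' smooth_form_linear[OF b] in auto)
    then have "form_closure ?B 1 (\<lambda>x. mask_tensor {} (\<lambda>_. a' e x) (\<lambda>vs. b e (hd vs)))"
      by simp
    from form_closure.add[OF this insert.IH] show ?case
      using insert by simp
  qed
  moreover have "has_multilinear_derivative 0 (\<lambda>x _. a x) (?G S x) x" if "x \<in> U" for x
    by (rule has_multilinear_derivative_one_form[OF a'(2)[OF that]]) (simp add: mask_tensor_def)
  ultimately show "\<exists>G. (\<forall>x\<in>U. has_multilinear_derivative 0 (\<lambda>x _. a x) (G x) x) \<and> form_closure ?B 1 G"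
    by (intro exI[of _ "?G S"]) simp
qed

section \<open>Smooth functions of one variable and convolution kernels\<close>

lemma smooth_real_zero: "smooth_real S (\<lambda>_. 0)"
proof (coinduction)
  case smooth_real
  show ?case by (intro exI[of _ "\<lambda>_. 0"]) auto
qed

lemma smooth_real_affine:
  assumes "smooth_real UNIV g"
  shows "smooth_real UNIV (\<lambda>t. k * g (a + c * t))"
  using assms
proof (coinduction arbitrary: g k)
  case smooth_real
  obtain g' where g': "\<forall>t\<in>UNIV. (g has_real_derivative g' t) (at t)" "smooth_real UNIV g'"
    using smooth_realD[OF smooth_real] by blast
  have d: "((\<lambda>t. k * g (a + c * t)) has_real_derivative (k * c) * g' (a + c * t)) (at t)" for t
  proof -
    have "((\<lambda>t. g (a + c * t)) has_real_derivative g' (a + c * t) * c) (at t)"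
      by (rule DERIV_chain2[where f = g]) (use g'(1) in \<open>auto intro!: derivative_eq_intros\<close>)
    from DERIV_cmult[OF this, of k] show ?thesis by (simp add: mult_ac)
  qed
  have "\<exists>h k'. (\<lambda>t. (k * c) * g' (a + c * t)) = (\<lambda>t. k' * h (a + c * t)) \<and> smooth_real UNIV h"
    using g'(2) by (intro exI[of _ g'] exI[of _ "k * c"]) simp
  with d show ?case
    by (intro exI[of _ "\<lambda>t. k * g (a + c * t)"] exI[of _ "\<lambda>t. (k * c) * g' (a + c * t)"]) simp
qed

text \<open>
  A product differentiates to a sum of two products; finite sums of products are closed under
  differentiation, so the coinduction runs over these.
\<close>

lemma smooth_real_sum_list_products:
  assumes "\<forall>(a, b) \<in> set l. smooth_real S a \<and> smooth_real S b"
  shows "smooth_real S (\<lambda>t. \<Sum>(a, b)\<leftarrow>l. a t * b t)"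
  using assms
proof (coinduction arbitrary: l)
  case smooth_real
  have "\<exists>d. \<forall>a. smooth_real S a \<longrightarrow>
      (\<forall>t\<in>S. (a has_real_derivative d a t) (at t)) \<and> smooth_real S (d a)"
    using smooth_realD[of S] by (intro choice) blast
  then obtain d where d: "\<And>a t. smooth_real S a \<Longrightarrow> t \<in> S \<Longrightarrow> (a has_real_derivative d a t) (at t)"
    "\<And>a. smooth_real S a \<Longrightarrow> smooth_real S (d a)" by blast
  define l' where "l' = concat (map (\<lambda>(a, b). [(d a, b), (a, d b)]) l)"
  have l': "\<forall>(a, b) \<in> set l'. smooth_real S a \<and> smooth_real S b"
    using smooth_real d(2) by (auto simp: l'_def)
  have D: "((\<lambda>t. \<Sum>(a, b)\<leftarrow>l. a t * b t) has_real_derivative (\<Sum>(a, b)\<leftarrow>l'. a t * b t)) (at t)"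
    if t: "t \<in> S" for t
    using smooth_real unfolding l'_def
  proof (induction l)
    case (Cons p l)
    obtain a b where p: "p = (a, b)" by (cases p)
    have "((\<lambda>t. a t * b t + (\<Sum>(a, b)\<leftarrow>l. a t * b t)) has_real_derivative
      (d a t * b t + d b t * a t) + (\<Sum>(a, b)\<leftarrow>concat (map (\<lambda>(a, b). [(d a, b), (a, d b)]) l). a t * b t)) (at t)"
      using Cons p t by (intro DERIV_add DERIV_mult d(1)) auto
    then show ?case by (simp add: p algebra_simps)
  qed simp
  have "\<exists>k. (\<lambda>t. \<Sum>(a, b)\<leftarrow>l'. a t * b t) = (\<lambda>t. \<Sum>(a, b)\<leftarrow>k. a t * b t) \<and>
          (\<forall>(a, b)\<in>set k. smooth_real S a \<and> smooth_real S b)"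
    using l' by blast
  with D show ?case
    by (intro exI[of _ "\<lambda>t. \<Sum>(a, b)\<leftarrow>l. a t * b t"] exI[of _ "\<lambda>t. \<Sum>(a, b)\<leftarrow>l'. a t * b t"])
      simp
qed

lemma smooth_real_mult:
  assumes "smooth_real S a" "smooth_real S b"
  shows "smooth_real S (\<lambda>t. a t * b t)"
  using smooth_real_sum_list_products[of "[(a, b)]" S] assms by simp

lemma poly_exp_tendsto_0: "((\<lambda>s::real. s ^ k * poly p s * exp (- s)) \<longlongrightarrow> 0) at_top"
proof (induction p arbitrary: k)
  case (pCons a p)
  have "((\<lambda>s::real. a * (s ^ k / exp s) + s ^ Suc k * poly p s * exp (- s)) \<longlongrightarrow> a * 0 + 0) at_top"
    by (intro tendsto_add tendsto_mult tendsto_const tendsto_power_div_exp_0 pCons.IH)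
  moreover have "a * (s ^ k / exp s) + s ^ Suc k * poly p s * exp (- s)
      = s ^ k * poly (pCons a p) s * exp (- s)" for s :: real
    by (simp add: exp_minus field_simps)
  ultimately show ?case by simp
qed simp

text \<open>
  All derivatives of the standard flat function are of this form: \<open>flat_exp p\<close> differentiates to
  \<open>flat_exp q\<close> with \<open>q(s) = s^2 * (p(s) - p'(s))\<close> where \<open>s = 1 / t\<close>.
\<close>

definition flat_exp :: "real poly \<Rightarrow> real \<Rightarrow> real" where
  "flat_exp p t = (if t > 0 then poly p (1 / t) * exp (- (1 / t)) else 0)"

lemma smooth_real_flat_exp: "smooth_real UNIV (flat_exp p)"
proof (coinduction arbitrary: p)
  case smooth_real
  define q where "q = [:0, 0, 1:] * (p - pderiv p)"
  have "(flat_exp p has_real_derivative flat_exp q t) (at t)" for t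
  proof -
    consider "t > 0" | "t = 0" | "t < 0" by linarith
    then show ?thesis
    proof cases
      case 1
      have "((\<lambda>t. poly p (1 / t) * exp (- (1 / t))) has_real_derivative
         (poly (pderiv p) (1 / t) * (- (1 / t ^ 2))) * exp (- (1 / t))
         + (exp (- (1 / t)) * (1 / t ^ 2)) * poly p (1 / t)) (at t)"
        using 1
        by (intro DERIV_mult DERIV_chain2[OF poly_DERIV] DERIV_chain2[OF DERIV_exp])
          (auto intro!: derivative_eq_intros simp: power2_eq_square)
      also have "(poly (pderiv p) (1 / t) * (- (1 / t ^ 2))) * exp (- (1 / t))
         + (exp (- (1 / t)) * (1 / t ^ 2)) * poly p (1 / t) = flat_exp q t"
        using 1 by (simp add: flat_exp_def q_def field_simps power2_eq_square)
      finally show ?thesis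
        by (rule has_field_derivative_transform_within_open[where S = "{0<..}"])
          (use 1 in \<open>auto simp: flat_exp_def\<close>)
    next
      case 2
      have "((\<lambda>h. (1 / h) ^ 1 * poly p (1 / h) * exp (- (1 / h))) \<longlongrightarrow> 0) (at_right (0::real))"
        using filterlim_compose[OF poly_exp_tendsto_0[of 1 p] filterlim_inverse_at_top_right]
        by (simp add: divide_inverse)
      then have R: "((\<lambda>h. flat_exp p h / h) \<longlongrightarrow> 0) (at_right 0)"
        by (rule Lim_transform_eventually)
          (auto simp: flat_exp_def eventually_at_filter)
      have L: "((\<lambda>h. flat_exp p h / h) \<longlongrightarrow> 0) (at_left 0)"
        by (rule Lim_transform_eventually[OF tendsto_const])
          (auto simp: flat_exp_def eventually_at_filter)
      have "((\<lambda>h. flat_exp p h / h) \<longlongrightarrow> 0) (at 0)"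
        using L R by (simp add: filterlim_split_at)
      then show ?thesis
        using 2 by (simp add: DERIV_def flat_exp_def)
    next
      case 3
      have "((\<lambda>t. 0) has_real_derivative flat_exp q t) (at t)"
        using 3 by (simp add: flat_exp_def)
      then show ?thesis
        by (rule has_field_derivative_transform_within_open[where S = "{..<0}"])
          (use 3 in \<open>auto simp: flat_exp_def\<close>)
    qed
  qed
  then show ?case by (intro exI[of _ "flat_exp p"] exI[of _ "flat_exp q"]) auto
qed

definition kernel :: "(real \<Rightarrow> real) \<Rightarrow> bool" where
  "kernel \<rho> \<longleftrightarrow> smooth_real UNIV \<rho> \<and> (\<forall>t. 1 < \<bar>t\<bar> \<longrightarrow> \<rho> t = 0)"

lemma kernel_derivative:
  assumes "kernel \<rho>"
  obtains \<rho>' where "kernel \<rho>'" "\<And>t. (\<rho> has_real_derivative \<rho>' t) (at t)"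
proof -
  obtain \<rho>' where d: "\<forall>t\<in>UNIV. (\<rho> has_real_derivative \<rho>' t) (at t)" and s: "smooth_real UNIV \<rho>'"
    using smooth_realD[of UNIV \<rho>] assms unfolding kernel_def by blast
  have "\<rho>' t = 0" if "1 < \<bar>t\<bar>" for t
  proof -
    have "open {t::real. 1 < \<bar>t\<bar>}" by (intro open_Collect_less continuous_intros)
    then have "((\<lambda>_. 0) has_real_derivative \<rho>' t) (at t)"
      by (rule has_field_derivative_transform_within_open[OF d[rule_format, OF UNIV_I]])
        (use assms that in \<open>auto simp: kernel_def\<close>)
    then show ?thesis using DERIV_unique[OF _ DERIV_const] by blast
  qed
  then show thesis using that s d by (auto simp: kernel_def)
qed

lemma kernel_continuous:
  assumes "kernel \<rho>" shows "continuous_on S \<rho>"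
proof -
  obtain \<rho>' where "\<And>t. (\<rho> has_real_derivative \<rho>' t) (at t)"
    using kernel_derivative[OF assms] by blast
  then show ?thesis
    by (intro continuous_at_imp_continuous_on ballI DERIV_isCont)
qed

lemma kernel_bounded:
  assumes "kernel \<rho>"
  obtains B where "B \<ge> 0" "\<And>t. \<bar>\<rho> t\<bar> \<le> B"
proof -
  have "compact (\<rho> ` {-1..1})"
    by (intro compact_continuous_image kernel_continuous assms) auto
  then obtain B where B: "\<forall>y\<in>\<rho> ` {-1..1}. norm y \<le> B"
    using compact_imp_bounded bounded_iff by metis
  have "\<bar>\<rho> t\<bar> \<le> max 0 B" for t
    using B assms by (cases "t \<in> {-1..1}") (auto simp: kernel_def le_max_iff_disj)
  then show thesis using that[of "max 0 B"] by auto
qed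

text \<open>
  A second order bound that is uniform in \<open>t\<close>: it is what lets differentiation pass under the
  integral sign below.
\<close>

lemma kernel_taylor:
  assumes "kernel \<rho>" and d: "\<And>t. (\<rho> has_real_derivative \<rho>' t) (at t)" and "kernel \<rho>'"
  obtains C where "C \<ge> 0" "\<And>t s. \<bar>\<rho> (t + s) - \<rho> t - s * \<rho>' t\<bar> \<le> C * s\<^sup>2"
proof -
  obtain \<rho>'' where k: "kernel \<rho>''" and d2: "\<And>t. (\<rho>' has_real_derivative \<rho>'' t) (at t)"
    using kernel_derivative[OF assms(3)] by blast
  obtain C where C: "C \<ge> 0" "\<And>t. \<bar>\<rho>'' t\<bar> \<le> C" using kernel_bounded[OF k] by blast
  have lip: "\<bar>\<rho>' a - \<rho>' b\<bar> \<le> C * \<bar>a - b\<bar>" for a b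
    using field_differentiable_bound[of UNIV \<rho>' \<rho>'' C a b] d2 C by auto
  have "\<bar>\<rho> (t + s) - \<rho> t - s * \<rho>' t\<bar> \<le> C * s\<^sup>2" for t s
  proof -
    let ?g = "\<lambda>x. \<rho> x - x * \<rho>' t"
    have "\<bar>?g (t + s) - ?g t\<bar> \<le> (C * \<bar>s\<bar>) * \<bar>(t + s) - t\<bar>"
    proof -
      have "norm (?g (t + s) - ?g t) \<le> (C * \<bar>s\<bar>) * norm ((t + s) - t)"
      proof (rule field_differentiable_bound[where S = "closed_segment t (t + s)"])
        fix z assume z: "z \<in> closed_segment t (t + s)"
        show "(?g has_field_derivative (\<rho>' z - 1 * \<rho>' t)) (at z within closed_segment t (t + s))"
          by (intro DERIV_diff DERIV_cmult_right DERIV_ident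
              has_field_derivative_at_within[OF d])
        have "\<bar>z - t\<bar> \<le> \<bar>s\<bar>" using z segment_bound(1)[OF z] by simp
        then show "norm (\<rho>' z - 1 * \<rho>' t) \<le> C * \<bar>s\<bar>"
          using lip[of z t] C(1) mult_left_mono[of "\<bar>z - t\<bar>" "\<bar>s\<bar>" C] by simp
      qed auto
      then show ?thesis by simp
    qed
    then show ?thesis by (simp add: algebra_simps power2_eq_square abs_mult_self_eq)
  qed
  with C show thesis using that by blast
qed

lemma integrable_kernel_mult:
  fixes v :: "real \<Rightarrow> real"
  assumes "kernel \<rho>" "continuous_on UNIV v"
  shows "integrable lborel (\<lambda>t. \<rho> t * v t)"
proof -
  have "integrable lborel (\<lambda>t. indicator {-1..1} t *\<^sub>R (\<rho> t * v t))"
    by (intro borel_integrable_compact continuous_intros kernel_continuous assms(1)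
        continuous_on_subset[OF assms(2)]) auto
  also have "(\<lambda>t. indicator {-1..1} t *\<^sub>R (\<rho> t * v t)) = (\<lambda>t. \<rho> t * v t)"
  proof
    fix t :: real
    show "indicator {-1..1} t *\<^sub>R (\<rho> t * v t) = \<rho> t * v t"
    proof (cases "1 < \<bar>t\<bar>")
      case True
      then show ?thesis using assms(1) by (simp add: kernel_def)
    next
      case False
      then have "t \<in> {-1..1}" by auto
      then show ?thesis by simp
    qed
  qed
  finally show ?thesis .
qed

lemma integrable_kernel: "kernel \<rho> \<Longrightarrow> integrable lborel \<rho>"
  using integrable_kernel_mult[of \<rho> "\<lambda>_. 1"] by simp

definition mollifier :: "(real \<Rightarrow> real) \<Rightarrow> bool" where
  "mollifier \<rho> \<longleftrightarrow> kernel \<rho> \<and> (\<forall>t. \<rho> t \<ge> 0) \<and> (\<forall>t. \<rho> (- t) = \<rho> t) \<and> (LINT t|lborel. \<rho> t) = 1"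

lemma mollifier_exists: "\<exists>\<rho>. mollifier \<rho>"
proof -
  define \<beta> where "\<beta> t = flat_exp [:1:] (1 + t) * flat_exp [:1:] (1 - t)" for t
  have "smooth_real UNIV (\<lambda>t. 1 * flat_exp [:1:] (1 + 1 * t))"
    "smooth_real UNIV (\<lambda>t. 1 * flat_exp [:1:] (1 + (-1) * t))"
    by (intro smooth_real_affine smooth_real_flat_exp)+
  then have sm: "smooth_real UNIV \<beta>"
    unfolding \<beta>_def using smooth_real_mult by force
  have "kernel \<beta>" using sm by (auto simp: kernel_def \<beta>_def flat_exp_def)
  define I where "I = (LINT t|lborel. \<beta> t)"
  have nn: "\<beta> t \<ge> 0" for t by (auto simp: \<beta>_def flat_exp_def)
  have lb: "exp (-4) * indicator {-1/2..1/2::real} t \<le> \<beta> t" for t :: real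
  proof (cases "t \<in> {-1/2..1/2}")
    case True
    then have "1 / (1 + t) \<le> 2" "1 / (1 - t) \<le> 2" by (auto simp: field_simps)
    then have "exp (-4) \<le> exp (- (1 / (1 + t)) + - (1 / (1 - t)))" by (simp only: exp_le_cancel_iff)
    also have "\<dots> = \<beta> t" using True unfolding exp_add by (auto simp: \<beta>_def flat_exp_def)
    finally show ?thesis using True by simp
  qed (use nn in auto)
  have "(LINT t|lborel. exp (-4) * indicator {-1/2..1/2::real} t) \<le> I"
    unfolding I_def using lb
    by (intro integral_mono integrable_mult_right integrable_kernel[OF \<open>kernel \<beta>\<close>]) auto
  then have "I > 0" by simp (smt (verit) exp_gt_zero)
  have k: "kernel (\<lambda>t. (1 / I) * \<beta> t)"
    using smooth_real_affine[OF sm, of "1 / I" 0 1] \<open>kernel \<beta>\<close> by (auto simp: kernel_def)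
  have "mollifier (\<lambda>t. (1 / I) * \<beta> t)"
    unfolding mollifier_def
  proof (intro conjI allI)
    show "kernel (\<lambda>t. (1 / I) * \<beta> t)" by (rule k)
    show "(1 / I) * \<beta> t \<ge> 0" for t using nn \<open>I > 0\<close> by simp
    show "(1 / I) * \<beta> (- t) = (1 / I) * \<beta> t" for t by (simp add: \<beta>_def mult.commute)
    show "(LINT t|lborel. (1 / I) * \<beta> t) = 1" using \<open>I > 0\<close> by (simp add: I_def)
  qed
  then show ?thesis by blast
qed

section \<open>Convolution along one direction\<close>

text \<open>
  Convolution along the line through \<open>x\<close> with direction \<open>e\<close>. In an arbitrary normed space this only
  smooths in the direction \<open>e\<close>, but being an average of translates it never increases a Lipschitz
  constant, whatever the norm.
\<close>

definition dconv ::
  "(real \<Rightarrow> real) \<Rightarrow> 'a::real_normed_vector \<Rightarrow> ('a \<Rightarrow> real) \<Rightarrow> 'a \<Rightarrow> real" where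
  "dconv \<rho> e u x = (LINT t|lborel. \<rho> t * u (x - t *\<^sub>R e))"

lemma lipschitz_abs:
  assumes "L-lipschitz_on UNIV u" shows "\<bar>u x - u y\<bar> \<le> L * dist x y"
  using lipschitz_onD[OF assms, of x y] by (simp add: dist_real_def)

lemma lipschitz_absI:
  assumes "\<And>x y. \<bar>u x - u y\<bar> \<le> L * dist x y" "0 \<le> L" shows "L-lipschitz_on S u"
  using assms by (auto intro!: lipschitz_onI simp: dist_real_def)

lemma continuous_on_line:
  fixes u :: "'a::real_normed_vector \<Rightarrow> real"
  assumes "L-lipschitz_on UNIV u"
  shows "continuous_on S (\<lambda>t. u (x - t *\<^sub>R e))"
  by (rule continuous_on_compose2[OF lipschitz_on_continuous_on[OF assms]])
    (auto intro!: continuous_intros)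

lemma dconv_integrable:
  fixes u :: "'a::real_normed_vector \<Rightarrow> real"
  assumes "kernel \<rho>" "L-lipschitz_on UNIV u"
  shows "integrable lborel (\<lambda>t. \<rho> t * u (x - t *\<^sub>R e))"
  by (rule integrable_kernel_mult[OF assms(1) continuous_on_line[OF assms(2)]])

lemma kernel_integral_bound:
  assumes k: "kernel \<rho>" and c: "integrable lborel (\<lambda>t. \<rho> t * v t)"
    and b: "\<And>t. \<bar>t\<bar> \<le> 1 \<Longrightarrow> \<bar>v t\<bar> \<le> M"
  shows "\<bar>LINT t|lborel. \<rho> t * v t\<bar> \<le> (LINT t|lborel. \<bar>\<rho> t\<bar>) * M"
proof -
  have "\<bar>LINT t|lborel. \<rho> t * v t\<bar> \<le> (LINT t|lborel. \<bar>\<rho> t * v t\<bar>)"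
    using integral_norm_bound[of lborel "\<lambda>t. \<rho> t * v t"] by simp
  also have "\<dots> \<le> (LINT t|lborel. \<bar>\<rho> t\<bar> * M)"
  proof (rule integral_mono)
    show "integrable lborel (\<lambda>t. \<bar>\<rho> t * v t\<bar>)" using c by (rule integrable_abs)
    show "integrable lborel (\<lambda>t. \<bar>\<rho> t\<bar> * M)"
      using integrable_kernel[OF k] by (intro integrable_mult_left integrable_abs)
    show "\<bar>\<rho> t * v t\<bar> \<le> \<bar>\<rho> t\<bar> * M" for t
    proof (cases "1 < \<bar>t\<bar>")
      case True
      then show ?thesis using k by (simp add: kernel_def)
    next
      case False
      then show ?thesis using b[of t] by (simp add: abs_mult mult_left_mono)
    qed
  qed
  finally show ?thesis by simp
qed

lemma dconv_diff:
  assumes "kernel \<rho>" "L-lipschitz_on UNIV u" "M-lipschitz_on UNIV w"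
  shows "dconv \<rho> e u x - dconv \<rho> e w y = (LINT t|lborel. \<rho> t * (u (x - t *\<^sub>R e) - w (y - t *\<^sub>R e)))"
    "integrable lborel (\<lambda>t. \<rho> t * (u (x - t *\<^sub>R e) - w (y - t *\<^sub>R e)))"
  using dconv_integrable[OF assms(1,2), of x e] dconv_integrable[OF assms(1,3), of y e]
  by (simp_all add: dconv_def right_diff_distrib)

lemma dconv_lipschitz:
  assumes k: "kernel \<rho>" and u: "L-lipschitz_on UNIV u"
  shows "((LINT t|lborel. \<bar>\<rho> t\<bar>) * L)-lipschitz_on UNIV (dconv \<rho> e u)"
proof (rule lipschitz_absI)
  fix x y
  show "\<bar>dconv \<rho> e u x - dconv \<rho> e u y\<bar> \<le> (LINT t|lborel. \<bar>\<rho> t\<bar>) * L * dist x y"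
    unfolding dconv_diff(1)[OF k u u] mult.assoc
  proof (rule kernel_integral_bound[OF k dconv_diff(2)[OF k u u]])
    show "\<bar>u (x - t *\<^sub>R e) - u (y - t *\<^sub>R e)\<bar> \<le> L * dist x y" for t
      using lipschitz_abs[OF u, of "x - t *\<^sub>R e" "y - t *\<^sub>R e"] by (simp add: dist_norm)
  qed
  show "0 \<le> (LINT t|lborel. \<bar>\<rho> t\<bar>) * L"
    using lipschitz_on_nonneg[OF u] by (intro mult_nonneg_nonneg integral_nonneg_AE) auto
qed

text \<open>
  The quadratic remainder, uniform in \<open>x\<close>, makes the relation stable under averaging over translates
  (\<open>has_dir_deriv_dconv_other\<close>) without any exchange of limits.
\<close>

definition has_dir_deriv ::
  "'a::real_normed_vector \<Rightarrow> ('a \<Rightarrow> real) \<Rightarrow> ('a \<Rightarrow> real) \<Rightarrow> bool" where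
  "has_dir_deriv e u u' \<longleftrightarrow>
     (\<exists>C\<ge>0. \<forall>x s. \<bar>s\<bar> \<le> 1 \<longrightarrow> \<bar>u (x + s *\<^sub>R e) - u x - s * u' x\<bar> \<le> C * s\<^sup>2)"

lemma has_dir_deriv_dconv_other:
  assumes k: "kernel \<rho>" and u: "L-lipschitz_on UNIV u" and u': "L'-lipschitz_on UNIV u'"
    and d: "has_dir_deriv f u u'"
  shows "has_dir_deriv f (dconv \<rho> e u) (dconv \<rho> e u')"
proof -
  obtain C where C: "C \<ge> 0"
    "\<And>x s. \<bar>s\<bar> \<le> 1 \<Longrightarrow> \<bar>u (x + s *\<^sub>R f) - u x - s * u' x\<bar> \<le> C * s\<^sup>2"
    using d unfolding has_dir_deriv_def by blast
  have "\<bar>dconv \<rho> e u (x + s *\<^sub>R f) - dconv \<rho> e u x - s * dconv \<rho> e u' x\<bar>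
     \<le> ((LINT t|lborel. \<bar>\<rho> t\<bar>) * C) * s\<^sup>2" if s: "\<bar>s\<bar> \<le> 1" for x s
  proof -
    let ?v = "\<lambda>t. u (x + s *\<^sub>R f - t *\<^sub>R e) - u (x - t *\<^sub>R e) - s * u' (x - t *\<^sub>R e)"
    note i = dconv_diff(2)[OF k u u, of "x + s *\<^sub>R f" e x]
      integrable_mult_right[OF dconv_integrable[OF k u', of x e], of s]
    have eq: "\<rho> t * ?v t = \<rho> t * (u (x + s *\<^sub>R f - t *\<^sub>R e) - u (x - t *\<^sub>R e))
        - s * (\<rho> t * u' (x - t *\<^sub>R e))" for t by (simp add: algebra_simps)
    have "integrable lborel (\<lambda>t. \<rho> t * ?v t)"
      unfolding eq using i by (rule Bochner_Integration.integrable_diff)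
    moreover have "\<bar>?v t\<bar> \<le> C * s\<^sup>2" for t
      using C(2)[OF s, of "x - t *\<^sub>R e"] by (simp add: algebra_simps)
    ultimately have "\<bar>LINT t|lborel. \<rho> t * ?v t\<bar> \<le> (LINT t|lborel. \<bar>\<rho> t\<bar>) * (C * s\<^sup>2)"
      by (intro kernel_integral_bound[OF k]) auto
    moreover have "dconv \<rho> e u (x + s *\<^sub>R f) - dconv \<rho> e u x - s * dconv \<rho> e u' x
       = (LINT t|lborel. \<rho> t * ?v t)"
      unfolding eq using i dconv_diff(1)[OF k u u, of e "x + s *\<^sub>R f" x]
      by (subst Bochner_Integration.integral_diff) (auto simp: dconv_def)
    ultimately show ?thesis by (simp add: mult.assoc)
  qed
  moreover have "0 \<le> (LINT t|lborel. \<bar>\<rho> t\<bar>) * C" using C(1) by simp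
  ultimately show ?thesis unfolding has_dir_deriv_def by blast
qed

lemma kernel_shift_integral:
  assumes k: "kernel \<rho>"
  shows "(LINT t|lborel. \<rho> t * v t) = (LINT t|lborel. \<rho> (t + s) * v (t + s))"
  using lborel_integral_real_affine[of 1 "\<lambda>t. \<rho> t * v t" s] by (simp add: add.commute)

lemma kernel_derivative_integral:
  assumes k: "kernel \<rho>" and k': "kernel \<rho>'" and d: "\<And>t. (\<rho> has_real_derivative \<rho>' t) (at t)"
  shows "(LINT t|lborel. \<rho>' t) = 0"
proof -
  have "(LINT t|lborel. \<rho>' t) = (LINT t|lborel. \<rho>' t * indicator {-2..2} t)"
  proof (intro Bochner_Integration.integral_cong refl)
    fix t :: real
    show "\<rho>' t = \<rho>' t * indicator {-2..2} t"
    proof (cases "1 < \<bar>t\<bar>")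
      case True
      then show ?thesis using k' by (simp add: kernel_def)
    next
      case False
      then have "t \<in> {-2..2}" by auto
      then show ?thesis by simp
    qed
  qed
  also have "\<dots> = \<rho> 2 - \<rho> (-2)"
    by (rule integral_FTC_Icc_real)
      (use d kernel_continuous[OF k', of UNIV] in \<open>auto simp: continuous_on_eq_continuous_at\<close>)
  finally show ?thesis using k by (simp add: kernel_def)
qed

text \<open>
  After a shift of the variable the increment falls on the kernel. As \<open>u\<close> may be unbounded, \<open>u x\<close> is
  subtracted first, which is possible because \<open>\<rho> (t + s) - \<rho> t - s * \<rho>' t\<close> has integral \<open>0\<close>.
\<close>

lemma has_dir_deriv_dconv_same:
  assumes k: "kernel \<rho>" and k': "kernel \<rho>'" and d: "\<And>t. (\<rho> has_real_derivative \<rho>' t) (at t)"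
    and u: "L-lipschitz_on UNIV u"
  shows "has_dir_deriv e (dconv \<rho> e u) (dconv \<rho>' e u)"
proof -
  obtain C where C: "C \<ge> 0" "\<And>t s. \<bar>\<rho> (t + s) - \<rho> t - s * \<rho>' t\<bar> \<le> C * s\<^sup>2"
    using kernel_taylor[OF k d k'] by blast
  have L: "L \<ge> 0" using u by (rule lipschitz_on_nonneg)
  have "\<bar>dconv \<rho> e u (x + s *\<^sub>R e) - dconv \<rho> e u x - s * dconv \<rho>' e u x\<bar>
     \<le> (C * (2 * L * norm e) * 4) * s\<^sup>2" if s: "\<bar>s\<bar> \<le> 1" for x s
  proof -
    let ?w = "\<lambda>t. \<rho> (t + s) - \<rho> t - s * \<rho>' t"
    let ?u = "\<lambda>t. u (x - t *\<^sub>R e)"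
    have ks: "integrable lborel (\<lambda>t. \<rho> (t + s) * v t)" if "continuous_on UNIV v" for v :: "real \<Rightarrow> real"
    proof -
      have "integrable lborel (\<lambda>t. \<rho> t * v (t - s))"
        by (intro integrable_kernel_mult k continuous_on_compose2[OF that] continuous_intros) auto
      from lborel_integrable_real_affine[OF this, of 1 s] show ?thesis
        by (simp add: add.commute)
    qed
    have int: "integrable lborel (\<lambda>t. ?w t * v t)" if "continuous_on UNIV v" for v :: "real \<Rightarrow> real"
    proof -
      have "integrable lborel (\<lambda>t. \<rho> (t + s) * v t - \<rho> t * v t - s * (\<rho>' t * v t))"
        by (intro Bochner_Integration.integrable_diff integrable_mult_right ks
            integrable_kernel_mult k k' that)
      then show ?thesis by (simp add: algebra_simps)
    qed
    have split: "(LINT t|lborel. ?w t * v t) = (LINT t|lborel. \<rho> (t + s) * v t)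
        - (LINT t|lborel. \<rho> t * v t) - s * (LINT t|lborel. \<rho>' t * v t)"
      if "continuous_on UNIV v" for v :: "real \<Rightarrow> real"
    proof -
      have "(LINT t|lborel. ?w t * v t)
        = (LINT t|lborel. \<rho> (t + s) * v t - \<rho> t * v t - s * (\<rho>' t * v t))"
        by (simp add: algebra_simps)
      also have "\<dots> = (LINT t|lborel. \<rho> (t + s) * v t)
        - (LINT t|lborel. \<rho> t * v t) - (LINT t|lborel. s * (\<rho>' t * v t))"
        using ks[OF that] integrable_kernel_mult[OF k that] integrable_kernel_mult[OF k' that]
        by (subst Bochner_Integration.integral_diff Bochner_Integration.integral_diff;
            (intro Bochner_Integration.integrable_diff integrable_mult_right)?; simp)+
      finally show ?thesis by simp
    qed
    have cu: "continuous_on UNIV ?u" by (rule continuous_on_line[OF u])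
    have "dconv \<rho> e u (x + s *\<^sub>R e) = (LINT t|lborel. \<rho> (t + s) * ?u t)"
      unfolding dconv_def by (subst kernel_shift_integral[OF k, of _ s]) (simp add: algebra_simps)
    then have "dconv \<rho> e u (x + s *\<^sub>R e) - dconv \<rho> e u x - s * dconv \<rho>' e u x
        = (LINT t|lborel. ?w t * ?u t)"
      using split[OF cu] by (simp add: dconv_def)
    also have "\<dots> = (LINT t|lborel. ?w t * (?u t - u x))"
    proof -
      have "(LINT t|lborel. ?w t * 1) = 0"
        using split[of "\<lambda>_. 1"] kernel_derivative_integral[OF k k' d]
          kernel_shift_integral[OF k, of "\<lambda>_. 1" s] by simp
      then show ?thesis
        using int[OF cu] int[of "\<lambda>_. 1"] by (simp add: right_diff_distrib)
    qed
    also have "\<bar>\<dots>\<bar> \<le> (LINT t|lborel. \<bar>?w t * (?u t - u x)\<bar>)"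
      using integral_norm_bound[of lborel "\<lambda>t. ?w t * (?u t - u x)"] by simp
    also have "\<dots> \<le> (LINT t|lborel. (C * s\<^sup>2 * (2 * L * norm e)) * indicator {-2..2::real} t)"
    proof (rule integral_mono)
      show "integrable lborel (\<lambda>t. \<bar>?w t * (?u t - u x)\<bar>)"
        by (intro integrable_abs int continuous_intros cu)
      show "integrable lborel (\<lambda>t::real. (C * s\<^sup>2 * (2 * L * norm e)) * indicator {-2..2::real} t)"
        by (intro integrable_mult_right) simp
      show "\<bar>?w t * (?u t - u x)\<bar> \<le> (C * s\<^sup>2 * (2 * L * norm e)) * indicator {-2..2::real} t" for t
      proof (cases "t \<in> {-2..2}")
        case True
        have "\<bar>?u t - u x\<bar> \<le> L * (\<bar>t\<bar> * norm e)"
          using lipschitz_abs[OF u, of "x - t *\<^sub>R e" x] by (simp add: dist_norm)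
        also have "\<dots> \<le> L * (2 * norm e)"
          using True L by (intro mult_left_mono mult_right_mono) auto
        finally have "\<bar>?u t - u x\<bar> \<le> 2 * L * norm e" by simp
        then show ?thesis
          using True C(1) C(2)[of t s] unfolding abs_mult
          by (simp add: mult_mono)
      next
        case False
        then have "1 < \<bar>t\<bar>" "1 < \<bar>t + s\<bar>" using s by auto
        then show ?thesis using k k' False by (simp add: kernel_def)
      qed
    qed
    also have "\<dots> = (C * (2 * L * norm e) * 4) * s\<^sup>2" by simp
    finally show ?thesis .
  qed
  moreover have "0 \<le> C * (2 * L * norm e) * 4" using C(1) L by simp
  ultimately show ?thesis unfolding has_dir_deriv_def by blast
qed

text \<open>
  All iterated derivatives in the directions of \<open>S\<close> exist and are Lipschitz. The Lipschitz bounds will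
  turn directional derivatives into Frechet derivatives.
\<close>

coinductive dir_smooth :: "('a::real_normed_vector) set \<Rightarrow> ('a \<Rightarrow> real) \<Rightarrow> bool" for S where
  dir_smooth_step: "L-lipschitz_on UNIV u \<Longrightarrow> (\<And>e. e \<in> S \<Longrightarrow> has_dir_deriv e u (u' e)) \<Longrightarrow>
   (\<And>e. e \<in> S \<Longrightarrow> dir_smooth S (u' e)) \<Longrightarrow> dir_smooth S u"

lemma dir_smoothD:
  assumes "dir_smooth S u"
  shows "\<exists>L. L-lipschitz_on UNIV u"
    "\<exists>u'. \<forall>e\<in>S. has_dir_deriv e u (u' e) \<and> dir_smooth S (u' e)"
  using assms by (cases rule: dir_smooth.cases; blast)+

lemma dir_smooth_empty: "L-lipschitz_on UNIV u \<Longrightarrow> dir_smooth {} u"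
  by (rule dir_smooth_step) auto

text \<open>
  The invariant of the coinduction is "some kernel convolved with some function smooth along \<open>S\<close>": a
  derivative along \<open>e\<close> changes the kernel, one along another direction changes the function.
\<close>

lemma dir_smooth_dconv:
  assumes "kernel \<rho>" "dir_smooth S u"
  shows "dir_smooth (insert e S) (dconv \<rho> e u)"
  using assms
proof (coinduction arbitrary: \<rho> u)
  case (dir_smooth \<rho> u)
  obtain L where L: "L-lipschitz_on UNIV u" using dir_smoothD(1)[OF dir_smooth(2)] by blast
  obtain u' where u': "\<And>f. f \<in> S \<Longrightarrow> has_dir_deriv f u (u' f)" "\<And>f. f \<in> S \<Longrightarrow> dir_smooth S (u' f)"
    using dir_smoothD(2)[OF dir_smooth(2)] by blast
  obtain \<rho>' where \<rho>': "kernel \<rho>'" "\<And>t. (\<rho> has_real_derivative \<rho>' t) (at t)"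
    using kernel_derivative[OF dir_smooth(1)] by blast
  define w where "w f = (if f = e then dconv \<rho>' e u else dconv \<rho> e (u' f))" for f
  have 1: "has_dir_deriv f (dconv \<rho> e u) (w f)" if f: "f \<in> insert e S" for f
  proof (cases "f = e")
    case True
    then show ?thesis using has_dir_deriv_dconv_same[OF dir_smooth(1) \<rho>' L] by (simp add: w_def)
  next
    case False
    then have fS: "f \<in> S" using f by simp
    obtain L' where "L'-lipschitz_on UNIV (u' f)" using dir_smoothD(1)[OF u'(2)[OF fS]] by blast
    from has_dir_deriv_dconv_other[OF dir_smooth(1) L this u'(1)[OF fS]] False
    show ?thesis by (simp add: w_def)
  qed
  have 2: "\<exists>\<rho> u. w f = dconv \<rho> e u \<and> kernel \<rho> \<and> dir_smooth S u" if f: "f \<in> insert e S" for f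
  proof (cases "f = e")
    case True
    then show ?thesis using \<rho>'(1) dir_smooth(2)
      by (intro exI[of _ \<rho>'] exI[of _ u]) (simp add: w_def)
  next
    case False
    then show ?thesis using dir_smooth(1) u'(2)[of f] f
      by (intro exI[of _ \<rho>] exI[of _ "u' f"]) (simp add: w_def)
  qed
  show ?case
    using dconv_lipschitz[OF dir_smooth(1) L, of e] 1 2
    by (intro exI[of _ "(LINT t|lborel. \<bar>\<rho> t\<bar>) * L"] exI[of _ "dconv \<rho> e u"] exI[of _ w]) simp
qed

lemma mollifier_kernel: "mollifier \<rho> \<Longrightarrow> kernel \<rho>"
  by (simp add: mollifier_def)

lemma mollifier_abs_integral: "mollifier \<rho> \<Longrightarrow> (LINT t|lborel. \<bar>\<rho> t\<bar>) = 1"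
  by (simp add: mollifier_def)

lemma mollifier_dconv_lipschitz:
  "mollifier \<rho> \<Longrightarrow> L-lipschitz_on UNIV u \<Longrightarrow> L-lipschitz_on UNIV (dconv \<rho> e u)"
  using dconv_lipschitz[OF mollifier_kernel, of \<rho> L u e] by (simp add: mollifier_abs_integral)

lemma mollifier_dconv_close:
  assumes m: "mollifier \<rho>" and u: "L-lipschitz_on UNIV u"
    and b: "\<And>t. \<bar>t\<bar> \<le> 1 \<Longrightarrow> \<bar>u (x - t *\<^sub>R e) - c\<bar> \<le> M"
  shows "\<bar>dconv \<rho> e u x - c\<bar> \<le> M"
proof -
  have k: "kernel \<rho>" using m by (rule mollifier_kernel)
  have c: "0-lipschitz_on UNIV (\<lambda>_::'a. c)" by (auto intro!: lipschitz_onI)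
  have "dconv \<rho> e (\<lambda>_. c) x = c" using m by (simp add: dconv_def mollifier_def)
  then have "\<bar>dconv \<rho> e u x - c\<bar> = \<bar>LINT t|lborel. \<rho> t * (u (x - t *\<^sub>R e) - c)\<bar>"
    using dconv_diff(1)[OF k u c, of e x x] by simp
  also have "\<dots> \<le> (LINT t|lborel. \<bar>\<rho> t\<bar>) * M"
    by (rule kernel_integral_bound[OF k dconv_diff(2)[OF k u c] b])
  finally show ?thesis using mollifier_abs_integral[OF m] by simp
qed

lemma dconv_commute:
  assumes k: "kernel \<rho>" and k': "kernel \<sigma>" and u: "L-lipschitz_on UNIV u"
  shows "dconv \<rho> e (dconv \<sigma> f u) = dconv \<sigma> f (dconv \<rho> e u)"
proof
  fix x
  let ?F = "\<lambda>(t, s). \<rho> t * \<sigma> s * u (x - t *\<^sub>R e - s *\<^sub>R f)"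
  have cu: "continuous_on UNIV u" using u by (rule lipschitz_on_continuous_on)
  have "continuous_on ({-1..1} \<times> {-1..1}) (\<lambda>p. \<rho> (fst p) * \<sigma> (snd p) * u (x - fst p *\<^sub>R e - snd p *\<^sub>R f))"
    by (intro continuous_intros continuous_on_compose2[OF kernel_continuous[OF k, of UNIV]]
      continuous_on_compose2[OF kernel_continuous[OF k', of UNIV]] continuous_on_compose2[OF cu]) auto
  then have "continuous_on ({-1..1} \<times> {-1..1}) ?F" by (simp add: case_prod_beta)
  then have "integrable lborel (\<lambda>p. indicator ({-1..1} \<times> {-1..1}) p *\<^sub>R ?F p)"
    by (intro borel_integrable_compact compact_Times) auto
  also have "(\<lambda>p. indicator ({-1..1} \<times> {-1..1}) p *\<^sub>R ?F p) = ?F"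
  proof
    fix p :: "real \<times> real"
    have "p \<in> {-1..1} \<times> {-1..1} \<or> 1 < \<bar>fst p\<bar> \<or> 1 < \<bar>snd p\<bar>" by (cases p) auto
    then show "indicator ({-1..1} \<times> {-1..1}) p *\<^sub>R ?F p = ?F p"
      using k k' by (auto simp: kernel_def case_prod_beta)
  qed
  finally have "integrable (lborel \<Otimes>\<^sub>M lborel) ?F" by (simp add: lborel_prod)
  from lborel_pair.Fubini_integral[of "\<lambda>t s. ?F (t, s)"] this
  have F: "(LINT s|lborel. LINT t|lborel. \<rho> t * \<sigma> s * u (x - t *\<^sub>R e - s *\<^sub>R f))
      = (LINT t|lborel. LINT s|lborel. \<rho> t * \<sigma> s * u (x - t *\<^sub>R e - s *\<^sub>R f))" by simp
  have "dconv \<rho> e (dconv \<sigma> f u) x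
      = (LINT t|lborel. LINT s|lborel. \<rho> t * \<sigma> s * u (x - t *\<^sub>R e - s *\<^sub>R f))"
    unfolding dconv_def by (simp add: mult.assoc)
  also have "\<dots> = (LINT s|lborel. LINT t|lborel. \<sigma> s * (\<rho> t * u (x - s *\<^sub>R f - t *\<^sub>R e)))"
    unfolding F[symmetric]
    by (intro Bochner_Integration.integral_cong refl) (simp add: algebra_simps)
  also have "\<dots> = dconv \<sigma> f (dconv \<rho> e u) x"
    unfolding dconv_def by simp
  finally show "dconv \<rho> e (dconv \<sigma> f u) x = dconv \<sigma> f (dconv \<rho> e u) x" .
qed

lemma smooth_real_dir_smooth:
  assumes "dir_smooth {1::real} u" shows "smooth_real UNIV u"
  using assms
proof (coinduction arbitrary: u)
  case smooth_real
  obtain u' where u': "has_dir_deriv 1 u u'" "dir_smooth {1} u'"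
    using dir_smoothD(2)[OF smooth_real] by blast
  obtain C where C: "C \<ge> 0" "\<And>x s. \<bar>s\<bar> \<le> 1 \<Longrightarrow> \<bar>u (x + s) - u x - s * u' x\<bar> \<le> C * s\<^sup>2"
    using u'(1) unfolding has_dir_deriv_def by auto
  have "(u has_real_derivative u' x) (at x)" for x
    unfolding DERIV_def
  proof (rule LIM_I)
    fix r :: real assume r: "r > 0"
    show "\<exists>s>0. \<forall>h. h \<noteq> 0 \<and> norm (h - 0) < s \<longrightarrow> norm ((u (x + h) - u x) / h - u' x) < r"
    proof (intro exI conjI allI impI)
      show "min 1 (r / (C + 1)) > 0" using r C by simp
      fix h :: real assume h: "h \<noteq> 0 \<and> norm (h - 0) < min 1 (r / (C + 1))"
      have "\<bar>(u (x + h) - u x) / h - u' x\<bar> = \<bar>u (x + h) - u x - h * u' x\<bar> / \<bar>h\<bar>"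
        using h by (simp add: abs_divide[symmetric] diff_divide_distrib)
      also have "\<dots> \<le> C * h\<^sup>2 / \<bar>h\<bar>"
        using C(2)[of h x] h by (intro divide_right_mono) auto
      also have "\<dots> = C * \<bar>h\<bar>" using h by (simp add: power2_eq_square abs_if)
      also have "\<dots> \<le> (C + 1) * \<bar>h\<bar>" by (intro mult_right_mono) auto
      also have "\<dots> < r" using h C(1) by (simp add: pos_less_divide_eq mult.commute)
      finally show "norm ((u (x + h) - u x) / h - u' x) < r" by simp
    qed
  qed
  with u'(2) show ?case by (intro exI[of _ u] exI[of _ u']) simp
qed

text \<open>
  The convolution of the absolute value with an even kernel; away from \<open>[-1, 1]\<close> the absolute value is
  affine on the support of the kernel, and an even kernel reproduces affine functions.
\<close>

lemma smooth_abs_exists: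
  "\<exists>\<alpha>. smooth_real UNIV \<alpha> \<and> (\<forall>t. \<bar>t\<bar> \<ge> 1 \<longrightarrow> \<alpha> t = \<bar>t\<bar>) \<and> (\<forall>s t. \<bar>\<alpha> s - \<alpha> t\<bar> \<le> \<bar>s - t\<bar>)"
proof -
  obtain \<rho> where m: "mollifier \<rho>" using mollifier_exists by blast
  have k: "kernel \<rho>" using m by (rule mollifier_kernel)
  have l: "1-lipschitz_on UNIV (abs :: real \<Rightarrow> real)"
    by (auto intro!: lipschitz_onI simp: dist_real_def)
  define \<alpha> where "\<alpha> = dconv \<rho> (1::real) abs"
  have int: "integrable lborel (\<lambda>s. \<rho> s * (a + b * s))" for a b
    by (intro integrable_kernel_mult k continuous_intros)
  have "(LINT s|lborel. \<rho> s * s) = (LINT s|lborel. \<rho> (- s) * (- s))"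
    using lborel_integral_real_affine[of "-1" "\<lambda>s. \<rho> s * s" 0] by simp
  also have "\<dots> = - (LINT s|lborel. \<rho> s * s)" using m by (simp add: mollifier_def)
  finally have z: "(LINT s|lborel. \<rho> s * s) = 0" by simp
  have lin: "(LINT s|lborel. \<rho> s * (a + b * s)) = a" for a b
  proof -
    have "(LINT s|lborel. \<rho> s * (a + b * s)) = (LINT s|lborel. a * \<rho> s + b * (\<rho> s * s))"
      by (simp add: algebra_simps)
    also have "\<dots> = a * 1 + b * 0"
      using integrable_kernel[OF k] int[of 0 1] m z
      by (subst Bochner_Integration.integral_add) (auto simp: mollifier_def)
    finally show ?thesis by simp
  qed
  have far: "\<alpha> t = \<bar>t\<bar>" if "\<bar>t\<bar> \<ge> 1" for t
  proof -
    have "\<alpha> t = (LINT s|lborel. \<rho> s * (\<bar>t\<bar> + (- sgn t) * s))"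
      unfolding \<alpha>_def dconv_def
    proof (intro Bochner_Integration.integral_cong refl)
      fix s :: real
      show "\<rho> s * \<bar>t - s *\<^sub>R 1\<bar> = \<rho> s * (\<bar>t\<bar> + (- sgn t) * s)"
      proof (cases "1 < \<bar>s\<bar>")
        case True
        then show ?thesis using k by (simp add: kernel_def)
      next
        case False
        then show ?thesis using that by (auto simp: sgn_if abs_if)
      qed
    qed
    then show ?thesis by (simp only: lin)
  qed
  have "smooth_real UNIV \<alpha>"
    unfolding \<alpha>_def
    by (rule smooth_real_dir_smooth) (rule dir_smooth_dconv[OF k dir_smooth_empty[OF l]])
  moreover have "\<bar>\<alpha> s - \<alpha> t\<bar> \<le> \<bar>s - t\<bar>" for s t
    using lipschitz_abs[OF mollifier_dconv_lipschitz[OF m l, of 1], of s t]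
    by (simp add: \<alpha>_def dist_real_def)
  ultimately show ?thesis using far by blast
qed

section \<open>From directional to Frechet smoothness\<close>

text \<open>
  The directions are added one at a time; moving the base point of a directional derivative by a
  multiple of \<open>norm h\<close> changes it by as much, since it is Lipschitz, and it is multiplied by a
  coefficient of size \<open>norm h\<close>.
\<close>

lemma dir_smooth_partial_sums:
  fixes a :: "'a::real_normed_vector \<Rightarrow> real" and b :: "'a \<Rightarrow> 'a \<Rightarrow> real"
  assumes T: "finite T"
    and d: "\<And>e. e \<in> T \<Longrightarrow> has_dir_deriv e a (a' e)"
    and lip: "\<And>e. e \<in> T \<Longrightarrow> \<exists>L. L-lipschitz_on UNIV (a' e)"
    and b: "\<And>e. e \<in> T \<Longrightarrow> bounded_linear (b e)"
  shows "\<exists>C\<ge>0. \<forall>x h. (\<forall>e\<in>T. \<bar>b e h\<bar> \<le> 1) \<longrightarrow>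
    \<bar>a (x + (\<Sum>e\<in>T. b e h *\<^sub>R e)) - a x - (\<Sum>e\<in>T. a' e x * b e h)\<bar> \<le> C * (norm h)\<^sup>2"
  using assms
proof (induction T)
  case empty
  then show ?case by (intro exI[of _ 0]) auto
next
  case (insert e T)
  obtain C where C: "C \<ge> 0" "\<And>x h. (\<forall>e\<in>T. \<bar>b e h\<bar> \<le> 1) \<Longrightarrow>
    \<bar>a (x + (\<Sum>e\<in>T. b e h *\<^sub>R e)) - a x - (\<Sum>e\<in>T. a' e x * b e h)\<bar> \<le> C * (norm h)\<^sup>2"
    using insert by auto
  obtain D where D: "D \<ge> 0" "\<And>x s. \<bar>s\<bar> \<le> 1 \<Longrightarrow> \<bar>a (x + s *\<^sub>R e) - a x - s * a' e x\<bar> \<le> D * s\<^sup>2"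
    using insert.prems(1)[of e] unfolding has_dir_deriv_def by auto
  obtain L where L: "L-lipschitz_on UNIV (a' e)" using insert.prems(2)[of e] by auto
  then have L0: "L \<ge> 0" by (rule lipschitz_on_nonneg)
  obtain B where B: "B \<ge> 0" "\<And>h. \<bar>b e h\<bar> \<le> B * norm h"
    using bounded_linear.nonneg_bounded[OF insert.prems(3)[of e]] by (auto simp: mult.commute)
  have bl: "bounded_linear (\<lambda>h. \<Sum>e\<in>T. b e h *\<^sub>R e)"
    using insert.prems(3) by (intro bounded_linear_sum bounded_linear_scaleR_const) auto
  obtain M where M: "M \<ge> 0" "\<And>h. norm (\<Sum>e\<in>T. b e h *\<^sub>R e) \<le> norm h * M"
    using bounded_linear.nonneg_bounded[OF bl] by blast
  show ?case
  proof (intro exI conjI allI impI)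
    show "0 \<le> D * B\<^sup>2 + L * M * B + C" using C D L0 M B by simp
    fix x h assume h: "\<forall>f\<in>insert e T. \<bar>b f h\<bar> \<le> 1"
    define z where "z = (\<Sum>e\<in>T. b e h *\<^sub>R e)"
    have 1: "\<bar>a (x + z + b e h *\<^sub>R e) - a (x + z) - b e h * a' e (x + z)\<bar> \<le> D * B\<^sup>2 * (norm h)\<^sup>2"
    proof -
      have "(b e h)\<^sup>2 \<le> (B * norm h)\<^sup>2" using B(2)[of h] abs_le_square_iff by fastforce
      then have "D * (b e h)\<^sup>2 \<le> D * B\<^sup>2 * (norm h)\<^sup>2"
        using D(1) mult_left_mono[of "(b e h)\<^sup>2" "(B * norm h)\<^sup>2" D]
        by (simp add: power_mult_distrib mult.assoc)
      then show ?thesis using D(2)[of "b e h" "x + z"] h by force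
    qed
    have 2: "\<bar>b e h * a' e (x + z) - b e h * a' e x\<bar> \<le> L * M * B * (norm h)\<^sup>2"
    proof -
      have "\<bar>b e h * a' e (x + z) - b e h * a' e x\<bar> = \<bar>b e h\<bar> * \<bar>a' e (x + z) - a' e x\<bar>"
        by (simp add: abs_mult[symmetric] right_diff_distrib)
      also have "\<dots> \<le> (B * norm h) * (L * (M * norm h))"
      proof (rule mult_mono)
        have "\<bar>a' e (x + z) - a' e x\<bar> \<le> L * norm z"
          using lipschitz_abs[OF L, of "x + z" x] by (simp add: dist_norm)
        also have "\<dots> \<le> L * (M * norm h)" using M(2)[of h] L0 by (simp add: z_def mult_left_mono mult.commute)
        finally show "\<bar>a' e (x + z) - a' e x\<bar> \<le> L * (M * norm h)" .
      qed (use B in auto)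
      finally show ?thesis by (simp add: power2_eq_square mult_ac)
    qed
    have 3: "\<bar>a (x + z) - a x - (\<Sum>e\<in>T. a' e x * b e h)\<bar> \<le> C * (norm h)\<^sup>2"
      unfolding z_def using C(2)[of h x] h by simp
    have s: "x + (\<Sum>e\<in>insert e T. b e h *\<^sub>R e) = x + z + b e h *\<^sub>R e"
      using insert.hyps by (simp add: z_def algebra_simps)
    have s2: "(\<Sum>e\<in>insert e T. a' e x * b e h) = b e h * a' e x + (\<Sum>e\<in>T. a' e x * b e h)"
      using insert.hyps by simp
    show "\<bar>a (x + (\<Sum>e\<in>insert e T. b e h *\<^sub>R e)) - a x - (\<Sum>e\<in>insert e T. a' e x * b e h)\<bar>
       \<le> (D * B\<^sup>2 + L * M * B + C) * (norm h)\<^sup>2"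
      unfolding s s2 distrib_right using 1 2 3 by linarith
  qed
qed

text \<open>
  A function that on \<open>V\<close> depends only on the finitely many coordinates \<open>b e\<close>, and is smooth along the
  vectors dual to them, is smooth on \<open>V\<close>. The class \<open>A\<close> used for the closure principle contains the
  dependence on the coordinates as well; derivatives inherit it as limits of difference quotients.
\<close>

lemma smooth_on_if_dir_smooth:
  fixes u :: "'a::real_normed_vector \<Rightarrow> real" and b :: "'a \<Rightarrow> 'a \<Rightarrow> real"
  assumes u: "dir_smooth S u" and S: "finite S" and V: "open V"
    and b: "\<And>e. e \<in> S \<Longrightarrow> bounded_linear (b e)"
    and dual: "\<And>e f. e \<in> S \<Longrightarrow> f \<in> S \<Longrightarrow> b e f = of_bool (e = f)"
    and loc: "\<And>x y. x \<in> V \<Longrightarrow> y \<in> V \<Longrightarrow> \<forall>e\<in>S. b e x = b e y \<Longrightarrow> u x = u y"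
  shows "smooth_on V u"
proof -
  define A where "A = {a. dir_smooth S a \<and>
    (\<forall>x\<in>V. \<forall>y\<in>V. (\<forall>e\<in>S. b e x = b e y) \<longrightarrow> a x = a y)}"
  have "\<exists>a'. (\<forall>e\<in>S. a' e \<in> A) \<and>
      (\<forall>x\<in>V. (a has_derivative (\<lambda>h. \<Sum>e\<in>S. a' e x * b e h)) (at x))" if a: "a \<in> A" for a
  proof -
    have sm: "dir_smooth S a" and
      al: "\<And>x y. x \<in> V \<Longrightarrow> y \<in> V \<Longrightarrow> (\<forall>e\<in>S. b e x = b e y) \<Longrightarrow> a x = a y"
      using a unfolding A_def by blast+
    obtain a' where a': "\<And>e. e \<in> S \<Longrightarrow> has_dir_deriv e a (a' e)" "\<And>e. e \<in> S \<Longrightarrow> dir_smooth S (a' e)"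
      using dir_smoothD(2)[OF sm] by blast
    have "a' e x = a' e y"
      if e: "e \<in> S" and x: "x \<in> V" and y: "y \<in> V" and xy: "\<forall>e\<in>S. b e x = b e y" for e x y
    proof (rule ccontr)
      assume ne: "a' e x \<noteq> a' e y"
      obtain C where C: "C \<ge> 0" "\<And>x s. \<bar>s\<bar> \<le> 1 \<Longrightarrow> \<bar>a (x + s *\<^sub>R e) - a x - s * a' e x\<bar> \<le> C * s\<^sup>2"
        using a'(1)[OF e] unfolding has_dir_deriv_def by auto
      have ev: "\<forall>\<^sub>F s in at_right 0. z + s *\<^sub>R e \<in> V" if "z \<in> V" for z
      proof (rule topological_tendstoD[OF _ V])
        have "((\<lambda>s. z + s *\<^sub>R e) \<longlongrightarrow> z + 0 *\<^sub>R e) (at_right 0)"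
          by (intro tendsto_intros)
        then show "((\<lambda>s. z + s *\<^sub>R e) \<longlongrightarrow> z) (at_right 0)" by simp
      qed (rule that)
      note ev[OF x] ev[OF y]
      moreover have "\<forall>\<^sub>F s::real in at_right 0. 0 < s"
        by (simp add: eventually_at_filter)
      moreover have "\<forall>\<^sub>F s::real in at_right 0. s < min 1 (\<bar>a' e x - a' e y\<bar> / (2 * (C + 1)))"
        by (rule order_tendstoD(2)[OF tendsto_ident_at]) (use C ne in auto)
      ultimately have "\<forall>\<^sub>F s in at_right 0. x + s *\<^sub>R e \<in> V \<and> y + s *\<^sub>R e \<in> V \<and> 0 < s \<and>
          s < min 1 (\<bar>a' e x - a' e y\<bar> / (2 * (C + 1)))"
        by eventually_elim auto
      then obtain s where s: "x + s *\<^sub>R e \<in> V" "y + s *\<^sub>R e \<in> V" "0 < s" "s < 1"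
          "s < \<bar>a' e x - a' e y\<bar> / (2 * (C + 1))"
        using eventually_happens'[OF trivial_limit_at_right_real] by fastforce
      have bs: "\<forall>f\<in>S. b f (x + s *\<^sub>R e) = b f (y + s *\<^sub>R e)"
        using b xy by (simp add: linear_add bounded_linear.linear)
      \<comment> \<open>the two difference quotients coincide, so the derivatives differ by at most \<open>2 * C * s\<close>\<close>
      have "a (x + s *\<^sub>R e) = a (y + s *\<^sub>R e)" "a x = a y"
        using al[OF s(1,2) bs] al[OF x y xy] by auto
      then have "\<bar>s * a' e x - s * a' e y\<bar> \<le> 2 * (C * s\<^sup>2)"
        using C(2)[of s x] C(2)[of s y] s by linarith
      then have "s * \<bar>a' e x - a' e y\<bar> \<le> s * (2 * C * s)"
        using s by (simp add: abs_mult right_diff_distrib[symmetric] power2_eq_square mult_ac)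
      then have "\<bar>a' e x - a' e y\<bar> \<le> 2 * C * s" using s(3) by simp
      also have "\<dots> \<le> 2 * (C + 1) * s" using s by simp
      also have "\<dots> < \<bar>a' e x - a' e y\<bar>" using s(5) C(1) by (simp add: pos_less_divide_eq mult_ac)
      finally show False by simp
    qed
    then have a'A: "a' e \<in> A" if "e \<in> S" for e
      using a'(2)[OF that] that unfolding A_def by blast
    obtain C where C: "C \<ge> 0" "\<And>x h. (\<forall>e\<in>S. \<bar>b e h\<bar> \<le> 1) \<Longrightarrow>
      \<bar>a (x + (\<Sum>e\<in>S. b e h *\<^sub>R e)) - a x - (\<Sum>e\<in>S. a' e x * b e h)\<bar> \<le> C * (norm h)\<^sup>2"
      using dir_smooth_partial_sums[where b = b, OF S a'(1) dir_smoothD(1)[OF a'(2)] b] by blast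
    have bl: "bounded_linear (\<lambda>h. \<Sum>e\<in>S. b e h *\<^sub>R e)"
      using b by (intro bounded_linear_sum bounded_linear_scaleR_const) auto
    have "(a has_derivative (\<lambda>h. \<Sum>e\<in>S. a' e x * b e h)) (at x)" if x: "x \<in> V" for x
      unfolding has_derivative_at_alt
    proof (intro conjI allI impI)
      show "bounded_linear (\<lambda>h. \<Sum>e\<in>S. a' e x * b e h)"
        using b by (intro bounded_linear_sum bounded_linear_const_mult) auto
      fix r :: real assume r: "r > 0"
      have t0: "((\<lambda>y. y - x) \<longlongrightarrow> 0) (nhds x)"
        by (rule tendsto_eq_intros refl filterlim_ident | simp)+
      have "\<forall>\<^sub>F y in nhds x. x + (\<Sum>e\<in>S. b e (y - x) *\<^sub>R e) \<in> V"
      proof (rule topological_tendstoD[OF _ V])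
        have "((\<lambda>y. x + (\<Sum>e\<in>S. b e (y - x) *\<^sub>R e)) \<longlongrightarrow> x + (\<Sum>e\<in>S. b e 0 *\<^sub>R e)) (nhds x)"
          by (intro tendsto_add tendsto_const bounded_linear.tendsto[OF bl] t0)
        then show "((\<lambda>y. x + (\<Sum>e\<in>S. b e (y - x) *\<^sub>R e)) \<longlongrightarrow> x) (nhds x)"
          using linear_0[OF bounded_linear.linear[OF bl]] by simp
      qed (rule x)
      moreover have "\<forall>\<^sub>F y in nhds x. y \<in> V" using V x by (rule eventually_nhds_in_open)
      moreover have "\<forall>\<^sub>F y in nhds x. \<forall>e\<in>S. \<bar>b e (y - x)\<bar> < 1"
      proof (intro eventually_ball_finite[OF S] ballI)
        fix e assume "e \<in> S"
        have "((\<lambda>y. \<bar>b e (y - x)\<bar>) \<longlongrightarrow> \<bar>b e 0\<bar>) (nhds x)"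
          by (intro tendsto_rabs bounded_linear.tendsto[OF b[OF \<open>e \<in> S\<close>]] t0)
        then show "\<forall>\<^sub>F y in nhds x. \<bar>b e (y - x)\<bar> < 1"
          by (rule order_tendstoD(2))
            (simp add: linear_0[OF bounded_linear.linear[OF b[OF \<open>e \<in> S\<close>]]])
      qed
      moreover have "\<forall>\<^sub>F y in nhds x. C * norm (y - x) < r"
      proof (rule order_tendstoD(2))
        show "((\<lambda>y. C * norm (y - x)) \<longlongrightarrow> C * norm (0::'a)) (nhds x)"
          by (intro tendsto_mult tendsto_const tendsto_norm t0)
      qed (use r in simp)
      ultimately have "\<forall>\<^sub>F y in nhds x.
          norm (a y - a x - (\<Sum>e\<in>S. a' e x * b e (y - x))) \<le> r * norm (y - x)"
      proof eventually_elim
        case (elim y)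
        \<comment> \<open>moving from \<open>x\<close> to \<open>?z\<close> uses only the directions in \<open>S\<close>, and \<open>?z\<close> has the coordinates of \<open>y\<close>\<close>
        let ?z = "x + (\<Sum>e\<in>S. b e (y - x) *\<^sub>R e)"
        have "b f ?z = b f y" if f: "f \<in> S" for f
        proof -
          have lf: "linear (b f)" using b[OF f] by (rule bounded_linear.linear)
          have "b f ?z = b f x + (\<Sum>e\<in>S. b e (y - x) * b f e)"
            by (simp add: linear_add[OF lf] linear_sum[OF lf] linear_scale[OF lf])
          also have "(\<Sum>e\<in>S. b e (y - x) * b f e) = (\<Sum>e\<in>S. if e = f then b e (y - x) else 0)"
            using dual f by (intro sum.cong) auto
          also have "\<dots> = b f (y - x)" using S f by simp
          finally show ?thesis by (simp add: linear_diff[OF lf])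
        qed
        then have eq: "a y = a ?z" using al[of y ?z] elim by auto
        have "\<bar>a ?z - a x - (\<Sum>e\<in>S. a' e x * b e (y - x))\<bar> \<le> C * (norm (y - x))\<^sup>2"
          by (rule C(2)) (use elim in \<open>auto intro: less_imp_le\<close>)
        also have "\<dots> \<le> r * norm (y - x)"
          using elim mult_right_mono[of "C * norm (y - x)" r "norm (y - x)"]
          by (simp add: power2_eq_square mult.assoc)
        finally show ?case unfolding eq by simp
      qed
      then show "\<exists>d>0. \<forall>y. norm (y - x) < d \<longrightarrow>
          norm (a y - a x - (\<Sum>e\<in>S. a' e x * b e (y - x))) \<le> r * norm (y - x)"
        by (simp add: eventually_nhds_metric dist_norm)
    qed
    then show ?thesis using a'A by blast
  qed
  moreover have "u \<in> A" using u loc unfolding A_def by blast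
  ultimately show ?thesis
    by (intro smooth_on_if_finite_coordinates[where A = A and b = b, OF b S])
qed

section \<open>Nested smooth minima and maxima\<close>

definition smooth_abs :: "real \<Rightarrow> real" where
  "smooth_abs = (SOME \<alpha>. smooth_real UNIV \<alpha> \<and> (\<forall>t. \<bar>t\<bar> \<ge> 1 \<longrightarrow> \<alpha> t = \<bar>t\<bar>) \<and>
     (\<forall>s t. \<bar>\<alpha> s - \<alpha> t\<bar> \<le> \<bar>s - t\<bar>))"

lemma smooth_abs:
  "smooth_real UNIV smooth_abs" "\<bar>t\<bar> \<ge> 1 \<Longrightarrow> smooth_abs t = \<bar>t\<bar>"
  "\<bar>smooth_abs s - smooth_abs t\<bar> \<le> \<bar>s - t\<bar>"
  using someI_ex[OF smooth_abs_exists] unfolding smooth_abs_def[symmetric] by blast+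

definition scaled_abs :: "real \<Rightarrow> real \<Rightarrow> real" where
  "scaled_abs \<delta> c = \<delta> * smooth_abs ((1 / \<delta>) * c)"

text \<open>
  The corner of \<open>max a b = (a + b + \<bar>a - b\<bar>) / 2\<close> is rounded off on the strip \<open>\<bar>a - b\<bar> < \<delta>\<close> only; outside
  it the values are exact, and this exactness is what makes the nested formula below terminate.
\<close>

definition smooth_max :: "real \<Rightarrow> real \<Rightarrow> real \<Rightarrow> real" where
  "smooth_max \<delta> a b = (a + b + scaled_abs \<delta> (a - b)) / 2"

definition smooth_min :: "real \<Rightarrow> real \<Rightarrow> real \<Rightarrow> real" where
  "smooth_min \<delta> a b = (a + b - scaled_abs \<delta> (a - b)) / 2"

lemma scaled_abs:
  assumes "\<delta> > 0"
  shows "\<bar>scaled_abs \<delta> c - scaled_abs \<delta> d\<bar> \<le> \<bar>c - d\<bar>"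
    "\<bar>c\<bar> \<ge> \<delta> \<Longrightarrow> scaled_abs \<delta> c = \<bar>c\<bar>"
proof -
  have "\<bar>scaled_abs \<delta> c - scaled_abs \<delta> d\<bar>
      = \<delta> * \<bar>smooth_abs ((1 / \<delta>) * c) - smooth_abs ((1 / \<delta>) * d)\<bar>"
    unfolding scaled_abs_def using assms by (simp add: right_diff_distrib[symmetric] abs_mult)
  also have "\<dots> \<le> \<delta> * \<bar>(1 / \<delta>) * c - (1 / \<delta>) * d\<bar>"
    using assms smooth_abs(3) by (intro mult_left_mono) auto
  also have "\<dots> = \<bar>\<delta> * ((1 / \<delta>) * c - (1 / \<delta>) * d)\<bar>" using assms by (simp add: abs_mult)
  also have "\<delta> * ((1 / \<delta>) * c - (1 / \<delta>) * d) = c - d" using assms by (simp add: field_simps)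
  finally show "\<bar>scaled_abs \<delta> c - scaled_abs \<delta> d\<bar> \<le> \<bar>c - d\<bar>" .
  show "scaled_abs \<delta> c = \<bar>c\<bar>" if "\<bar>c\<bar> \<ge> \<delta>"
    unfolding scaled_abs_def
    using assms that by (subst smooth_abs(2)) (auto simp: abs_mult field_simps)
qed

lemma scaled_abs_ge:
  assumes "\<delta> > 0"
  shows "\<bar>c\<bar> \<le> scaled_abs \<delta> c"
proof (cases "\<bar>c\<bar> \<ge> \<delta>")
  case False
  then show ?thesis
    using scaled_abs(1)[OF assms, of c \<delta>] scaled_abs(1)[OF assms, of c "-\<delta>"]
      scaled_abs(2)[OF assms, of \<delta>] scaled_abs(2)[OF assms, of "-\<delta>"] by linarith
qed (simp add: scaled_abs(2)[OF assms])

text \<open>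
  The rounded minimum and maximum are nonexpansive for the sup norm, by
  \<open>\<bar>p + q\<bar> + \<bar>p - q\<bar> = 2 * max \<bar>p\<bar> \<bar>q\<bar>\<close>.
\<close>

lemma half_sum_diff_le_max:
  fixes a b a' b' s t :: real
  assumes "\<bar>s - t\<bar> \<le> \<bar>(a - b) - (a' - b')\<bar>"
  shows "\<bar>(a + b + s) / 2 - (a' + b' + t) / 2\<bar> \<le> max \<bar>a - a'\<bar> \<bar>b - b'\<bar>"
proof -
  define p q r where "p = a - a'" and "q = b - b'" and "r = s - t"
  have "\<bar>r\<bar> \<le> \<bar>p - q\<bar>" using assms by (simp add: p_def q_def r_def algebra_simps)
  moreover have "\<bar>p + q\<bar> + \<bar>p - q\<bar> \<le> 2 * max \<bar>p\<bar> \<bar>q\<bar>"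
    by (auto simp: abs_if max_def)
  ultimately have "\<bar>p + q + r\<bar> \<le> 2 * max \<bar>p\<bar> \<bar>q\<bar>"
    using abs_triangle_ineq[of "p + q" r] by linarith
  moreover have eq: "(a + b + s) / 2 - (a' + b' + t) / 2 = (p + q + r) / 2"
    by (simp add: p_def q_def r_def field_simps)
  ultimately show ?thesis unfolding eq p_def[symmetric] q_def[symmetric] by simp
qed

lemma smooth_max:
  assumes "\<delta> > 0"
  shows "b + \<delta> \<le> a \<Longrightarrow> smooth_max \<delta> a b = a"
    and "a \<le> smooth_max \<delta> a b" "b \<le> smooth_max \<delta> a b"
    and "a \<le> c - \<delta> \<Longrightarrow> b \<le> c \<Longrightarrow> smooth_max \<delta> a b \<le> c"
    and "\<bar>smooth_max \<delta> a b - smooth_max \<delta> a' b'\<bar> \<le> max \<bar>a - a'\<bar> \<bar>b - b'\<bar>"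
proof -
  show "b + \<delta> \<le> a \<Longrightarrow> smooth_max \<delta> a b = a"
    using scaled_abs(2)[OF assms, of "a - b"] assms by (simp add: smooth_max_def)
  show "a \<le> smooth_max \<delta> a b" "b \<le> smooth_max \<delta> a b"
    using scaled_abs_ge[OF assms, of "a - b"] by (simp_all add: smooth_max_def abs_le_iff)
  show "smooth_max \<delta> a b \<le> c" if "a \<le> c - \<delta>" "b \<le> c"
  proof -
    have "scaled_abs \<delta> (- \<delta>) = \<delta>" using scaled_abs(2)[OF assms, of "- \<delta>"] assms by simp
    then have "scaled_abs \<delta> (a - b) - \<delta> \<le> \<bar>a - b + \<delta>\<bar>"
      using scaled_abs(1)[OF assms, of "a - b" "- \<delta>"] by (simp add: abs_le_iff)
    then show ?thesis
      using that by (simp add: smooth_max_def abs_if split: if_splits)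
  qed
  show "\<bar>smooth_max \<delta> a b - smooth_max \<delta> a' b'\<bar> \<le> max \<bar>a - a'\<bar> \<bar>b - b'\<bar>"
    unfolding smooth_max_def by (rule half_sum_diff_le_max) (rule scaled_abs(1)[OF assms])
qed

lemma smooth_min:
  assumes "\<delta> > 0"
  shows "a + \<delta> \<le> b \<Longrightarrow> smooth_min \<delta> a b = a"
    and "smooth_min \<delta> a b \<le> b"
    and "c + \<delta> \<le> a \<Longrightarrow> c \<le> b \<Longrightarrow> c \<le> smooth_min \<delta> a b"
    and "\<bar>smooth_min \<delta> a b - smooth_min \<delta> a' b'\<bar> \<le> max \<bar>a - a'\<bar> \<bar>b - b'\<bar>"
proof -
  show "a + \<delta> \<le> b \<Longrightarrow> smooth_min \<delta> a b = a"
    using scaled_abs(2)[OF assms, of "a - b"] assms by (simp add: smooth_min_def)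
  show "smooth_min \<delta> a b \<le> b"
    using scaled_abs_ge[OF assms, of "a - b"] by (simp add: smooth_min_def abs_le_iff)
  show "c \<le> smooth_min \<delta> a b" if "c + \<delta> \<le> a" "c \<le> b"
  proof -
    have "scaled_abs \<delta> \<delta> = \<delta>" using scaled_abs(2)[OF assms, of \<delta>] assms by simp
    then have "scaled_abs \<delta> (a - b) - \<delta> \<le> \<bar>a - b - \<delta>\<bar>"
      using scaled_abs(1)[OF assms, of "a - b" \<delta>] by (simp add: abs_le_iff)
    then show ?thesis
      using that by (simp add: smooth_min_def abs_if split: if_splits)
  qed
  show "\<bar>smooth_min \<delta> a b - smooth_min \<delta> a' b'\<bar> \<le> max \<bar>a - a'\<bar> \<bar>b - b'\<bar>"
    using half_sum_diff_le_max[of "- scaled_abs \<delta> (a - b)" "- scaled_abs \<delta> (a' - b')" a b a' b']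
      scaled_abs(1)[OF assms, of "a - b" "a' - b'"]
    by (simp add: smooth_min_def abs_minus_commute)
qed

lemma smooth_on_smooth_max_min:
  assumes "smooth_on U f" "smooth_on U g"
  shows "smooth_on U (\<lambda>x. smooth_max \<delta> (f x) (g x))" "smooth_on U (\<lambda>x. smooth_min \<delta> (f x) (g x))"
proof -
  have d: "smooth_on U (\<lambda>x. f x - g x)"
    using smooth_form_add[OF assms(1) smooth_form_scale[OF assms(2), of "-1"]] by simp
  have "smooth_real UNIV (\<lambda>t. (\<delta> / 2) * smooth_abs (0 + (1 / \<delta>) * t))"
    by (rule smooth_real_affine[OF smooth_abs(1)])
  from smooth_on_compose[OF d this] have a: "smooth_on U (\<lambda>x. \<delta> / 2 * smooth_abs ((1 / \<delta>) * (f x - g x)))"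
    by simp
  have s: "smooth_on U (\<lambda>x. (1/2) * (f x + g x))"
    by (intro smooth_form_scale smooth_form_add assms)
  show "smooth_on U (\<lambda>x. smooth_max \<delta> (f x) (g x))"
    using smooth_form_add[OF s a] by (simp add: smooth_max_def scaled_abs_def add_divide_distrib)
  show "smooth_on U (\<lambda>x. smooth_min \<delta> (f x) (g x))"
    using smooth_form_add[OF s smooth_form_scale[OF a, of "-1"]]
    by (simp add: smooth_min_def scaled_abs_def add_divide_distrib diff_divide_distrib)
qed

lemma lipschitz_on_smooth_max_min:
  assumes "\<delta> > 0" "K-lipschitz_on UNIV f" "K-lipschitz_on UNIV g"
  shows "K-lipschitz_on UNIV (\<lambda>x. smooth_max \<delta> (f x) (g x))"
    "K-lipschitz_on UNIV (\<lambda>x. smooth_min \<delta> (f x) (g x))"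
proof -
  note l = lipschitz_abs[OF assms(2)] lipschitz_abs[OF assms(3)]
  have m: "max \<bar>f x - f y\<bar> \<bar>g x - g y\<bar> \<le> K * dist x y" for x y using l by simp
  show "K-lipschitz_on UNIV (\<lambda>x. smooth_max \<delta> (f x) (g x))"
    by (rule lipschitz_absI[OF order_trans[OF smooth_max(5)[OF assms(1)] m]])
      (rule lipschitz_on_nonneg[OF assms(2)])
  show "K-lipschitz_on UNIV (\<lambda>x. smooth_min \<delta> (f x) (g x))"
    by (rule lipschitz_absI[OF order_trans[OF smooth_min(4)[OF assms(1)] m]])
      (rule lipschitz_on_nonneg[OF assms(2)])
qed

text \<open>
  \<open>nested_min_max \<psi> s \<delta> N k\<close> runs through the levels \<open>k, \<dots>, k + N\<close>. A level replaces the value \<open>W\<close> of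
  the later ones by \<open>min (\<psi> k) (max (s k) W)\<close>, rounded.
\<close>

primrec nested_min_max ::
  "(nat \<Rightarrow> 'a \<Rightarrow> real) \<Rightarrow> (nat \<Rightarrow> 'a \<Rightarrow> real) \<Rightarrow> (nat \<Rightarrow> real) \<Rightarrow> nat \<Rightarrow> nat \<Rightarrow> 'a \<Rightarrow> real" where
  "nested_min_max \<psi> s \<delta> 0 = (\<lambda>k x. \<psi> k x)"
| "nested_min_max \<psi> s \<delta> (Suc N) = (\<lambda>k x. smooth_min (\<delta> k) (\<psi> k x)
     (smooth_max (\<delta> k) (s k x) (nested_min_max \<psi> s \<delta> N (Suc k) x)))"

text \<open>
  Where \<open>\<psi> j + \<delta> j \<le> s j\<close>, level \<open>j\<close> returns \<open>\<psi> j\<close> whatever the later levels are.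
\<close>

lemma nested_min_max_stable:
  assumes \<delta>: "\<And>n. \<delta> n > 0" and j: "\<psi> j x + \<delta> j \<le> s j x" and "k \<le> j" "j \<le> k + N"
  shows "nested_min_max \<psi> s \<delta> N k x = nested_min_max \<psi> s \<delta> (j - k) k x"
  using assms(3,4)
proof (induction N arbitrary: k)
  case (Suc N)
  show ?case
  proof (cases "k = j")
    case True
    have "\<psi> j x + \<delta> j \<le> smooth_max (\<delta> j) (s j x) (nested_min_max \<psi> s \<delta> N (Suc j) x)"
      using j smooth_max(2)[OF \<delta>] order_trans by blast
    then show ?thesis using True smooth_min(1)[OF \<delta>] by simp
  next
    case False
    then have "j - k = Suc (j - Suc k)" "Suc k \<le> j" using Suc.prems by auto
    then show ?thesis using Suc.IH[of "Suc k"] Suc.prems by simp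
  qed
qed auto

text \<open>
  The rounding errors do not add up over the levels: rounding pushes below \<open>a\<close> only if both arguments
  are close to \<open>a\<close>, which the margin \<open>\<delta> n\<close> excludes.
\<close>

lemma nested_min_max_ge:
  assumes \<delta>: "\<And>n. \<delta> n > 0" and "\<And>n. a + \<delta> n \<le> \<psi> n x"
  shows "a \<le> nested_min_max \<psi> s \<delta> N k x"
proof (induction N arbitrary: k)
  case 0
  show ?case using assms(2)[of k] \<delta>[of k] by simp
next
  case (Suc N)
  have "a \<le> smooth_max (\<delta> k) (s k x) (nested_min_max \<psi> s \<delta> N (Suc k) x)"
    using Suc[of "Suc k"] smooth_max(3)[OF \<delta>] order_trans by blast
  then show ?case using smooth_min(3)[OF \<delta> assms(2)] by simp
qed

lemma nested_min_max_le:
  assumes \<delta>: "\<And>n. \<delta> n > 0" and s: "\<And>n. s n x \<le> b - \<delta> n" and "\<psi> (k + N) x \<le> b"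
  shows "nested_min_max \<psi> s \<delta> N k x \<le> b"
  using assms(3)
proof (induction N arbitrary: k)
  case (Suc N)
  have "smooth_max (\<delta> k) (s k x) (nested_min_max \<psi> s \<delta> N (Suc k) x) \<le> b"
    using Suc by (intro smooth_max(4)[OF \<delta> s]) simp
  then show ?case using smooth_min(2)[OF \<delta>] order_trans by simp blast
qed simp

lemma nested_min_max_smooth:
  assumes "\<And>n. smooth_on U (\<psi> n)" "\<And>n. smooth_on U (s n)"
  shows "smooth_on U (nested_min_max \<psi> s \<delta> N k)"
proof (induction N arbitrary: k)
  case (Suc N)
  show ?case
    unfolding nested_min_max.simps
    by (rule smooth_on_smooth_max_min(2)[OF assms(1) smooth_on_smooth_max_min(1)[OF assms(2) Suc]])
qed (use assms in simp)

lemma nested_min_max_lipschitz: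
  assumes \<delta>: "\<And>n. \<delta> n > 0" and "\<And>n. K-lipschitz_on UNIV (\<psi> n)" "\<And>n. K-lipschitz_on UNIV (s n)"
  shows "K-lipschitz_on UNIV (nested_min_max \<psi> s \<delta> N k)"
proof (induction N arbitrary: k)
  case (Suc N)
  show ?case
    unfolding nested_min_max.simps
    by (rule lipschitz_on_smooth_max_min(2)[OF \<delta> assms(2)
          lipschitz_on_smooth_max_min(1)[OF \<delta> assms(3) Suc]])
qed (use assms in simp)

text \<open>
  Any two points of \<open>\<Omega>\<close>, however far apart, see the same finite formula once \<open>N\<close> is large; this gives the
  Lipschitz bound on \<open>\<Omega>\<close> at once.
\<close>

lemma nested_min_max_limit:
  fixes \<psi> s :: "nat \<Rightarrow> 'a::real_normed_vector \<Rightarrow> real"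
  assumes \<Omega>: "open \<Omega>" and \<delta>: "\<And>n. \<delta> n > 0"
    and sm: "\<And>n. smooth_on UNIV (\<psi> n)" "\<And>n. smooth_on UNIV (s n)"
    and lip: "\<And>n. K-lipschitz_on UNIV (\<psi> n)" "\<And>n. K-lipschitz_on UNIV (s n)"
    and A: "\<And>x n. x \<in> \<Omega> \<Longrightarrow> A x + \<delta> n \<le> \<psi> n x"
    and B: "\<And>x n. x \<in> \<Omega> \<Longrightarrow> s n x \<le> B x - \<delta> n"
    and cover: "\<And>x. x \<in> \<Omega> \<Longrightarrow> \<exists>n V. open V \<and> x \<in> V \<and> (\<forall>y\<in>V. \<psi> n y + \<delta> n \<le> s n y)"
  shows "\<exists>v. smooth_on \<Omega> v \<and> K-lipschitz_on \<Omega> v \<and> (\<forall>x\<in>\<Omega>. A x \<le> v x \<and> v x \<le> B x)"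
proof -
  define j where "j x = (LEAST n. \<psi> n x + \<delta> n \<le> s n x)" for x
  define v where "v x = nested_min_max \<psi> s \<delta> (j x) 0 x" for x
  have jx: "\<psi> (j x) x + \<delta> (j x) \<le> s (j x) x" if "x \<in> \<Omega>" for x
    using cover[OF that] unfolding j_def by (metis (mono_tags, lifting) LeastI)
  have veq: "v x = nested_min_max \<psi> s \<delta> N 0 x" if "\<psi> n x + \<delta> n \<le> s n x" "n \<le> N" for x n N
  proof -
    have "j x \<le> N" using that Least_le[of "\<lambda>n. \<psi> n x + \<delta> n \<le> s n x" n] by (simp add: j_def)
    moreover have "\<psi> (j x) x + \<delta> (j x) \<le> s (j x) x"
      unfolding j_def by (rule LeastI[of "\<lambda>n. \<psi> n x + \<delta> n \<le> s n x"]) (rule that)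
    ultimately show ?thesis
      using nested_min_max_stable[of \<delta> \<psi> "j x" x s 0 N] \<delta> by (simp add: v_def)
  qed
  have "smooth_on \<Omega> v"
  proof (rule smooth_form_local[OF \<Omega>])
    fix x assume "x \<in> \<Omega>"
    then obtain n V where V: "open V" "x \<in> V" "\<forall>y\<in>V. \<psi> n y + \<delta> n \<le> s n y"
      using cover by blast
    have "smooth_on UNIV (nested_min_max \<psi> s \<delta> n 0)"
      by (rule nested_min_max_smooth[OF sm])
    then have "smooth_on V v"
    proof -
      have "smooth_on V (nested_min_max \<psi> s \<delta> n 0)"
        by (rule smooth_form_local[OF V(1)])
          (use \<open>smooth_on UNIV (nested_min_max \<psi> s \<delta> n 0)\<close> in blast)
      then show ?thesis
        by (intro smooth_form_local[OF V(1)] exI[of _ V] exI[of _ "\<lambda>x _. nested_min_max \<psi> s \<delta> n 0 x"])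
          (use V veq in auto)
    qed
    then show "\<exists>V F'. open V \<and> x \<in> V \<and> smooth_form V 0 F' \<and>
       (\<forall>y\<in>V. \<forall>vs. length vs = 0 \<longrightarrow> v y = F' y vs)"
      using V by (intro exI[of _ V] exI[of _ "\<lambda>x _. v x"]) auto
  qed
  moreover have "K-lipschitz_on \<Omega> v"
  proof (rule lipschitz_onI)
    fix x y assume "x \<in> \<Omega>" "y \<in> \<Omega>"
    then have "v x = nested_min_max \<psi> s \<delta> (max (j x) (j y)) 0 x"
      "v y = nested_min_max \<psi> s \<delta> (max (j x) (j y)) 0 y"
      using veq[OF jx] by (auto simp del: max_def)
    then show "dist (v x) (v y) \<le> K * dist x y"
      using lipschitz_onD[OF nested_min_max_lipschitz[OF \<delta> lip]] by simp
  qed (rule lipschitz_on_nonneg[OF lip(1)])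
  moreover have "A x \<le> v x" "v x \<le> B x" if x: "x \<in> \<Omega>" for x
  proof -
    show "A x \<le> v x" unfolding v_def 
      by (rule nested_min_max_ge[where \<delta> = \<delta> and \<psi> = \<psi>]) (rule \<delta>, rule A[OF x])
    have "\<psi> (j x) x \<le> B x" using jx[OF x] B[OF x, of "j x"] \<delta>[of "j x"] by linarith
    then show "v x \<le> B x" unfolding v_def 
      by (intro nested_min_max_le[where \<delta> = \<delta> and \<psi> = \<psi> and s = s] \<delta> B[OF x]) simp
  qed
  ultimately show ?thesis by blast
qed

section \<open>Approximation with a tolerance that varies from point to point\<close>

lemma smooth_form_const: "smooth_on U (\<lambda>_. c)"
  by (rule smooth_form_step[OF bounded_multilinear_form_0 has_multilinear_derivative_one_form smooth_form_zero])
    (auto intro!: derivative_eq_intros)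

text \<open>
  For \<open>f\<close> that is \<open>K\<close>-Lipschitz on \<open>S\<close> this is McShane's extension of \<open>f\<close>, the largest one with
  constant \<open>K\<close>. For the upper envelope of downward cones the negative of \<open>inf_cone K (- f) S\<close> is used.
\<close>

definition inf_cone :: "real \<Rightarrow> ('a::metric_space \<Rightarrow> real) \<Rightarrow> 'a set \<Rightarrow> 'a \<Rightarrow> real" where
  "inf_cone K f S x = (INF y\<in>S. f y + K * dist x y)"

lemma lipschitz_on_abs:
  assumes "L-lipschitz_on S u" "x \<in> S" "y \<in> S" shows "\<bar>u x - u y\<bar> \<le> L * dist x y"
  using lipschitz_onD[OF assms] by (simp add: dist_real_def)

lemma inf_cone_bdd_below:
  assumes f: "K-lipschitz_on S f"
  shows "bdd_below ((\<lambda>y. f y + K * dist x y) ` S)"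
proof (cases "S = {}")
  case False
  then obtain y0 where y0: "y0 \<in> S" by blast
  have K: "K \<ge> 0" using f by (rule lipschitz_on_nonneg)
  have "f y0 - K * dist x y0 \<le> f y + K * dist x y" if y: "y \<in> S" for y
  proof -
    have "f y0 - f y \<le> K * dist y0 y" using lipschitz_on_abs[OF f y0 y] by linarith
    also have "\<dots> \<le> K * (dist x y0 + dist x y)"
      using K dist_triangle3[of y0 y x] by (intro mult_left_mono) (auto simp: dist_commute)
    finally show ?thesis by (simp add: algebra_simps)
  qed
  then show ?thesis by (intro bdd_belowI2) blast
qed simp

lemma inf_cone_le:
  assumes "K-lipschitz_on S f" "y \<in> S"
  shows "inf_cone K f S x \<le> f y + K * dist x y"
  unfolding inf_cone_def by (rule cINF_lower[OF inf_cone_bdd_below[OF assms(1)] assms(2)])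

lemma inf_cone_ge:
  assumes "S \<noteq> {}" "\<And>y. y \<in> S \<Longrightarrow> c \<le> f y + K * dist x y"
  shows "c \<le> inf_cone K f S x"
  unfolding inf_cone_def by (rule cINF_greatest[OF assms])

lemma inf_cone_lipschitz:
  assumes f: "K-lipschitz_on S f" and S: "S \<noteq> {}"
  shows "K-lipschitz_on UNIV (inf_cone K f S)"
proof -
  have K: "K \<ge> 0" using f by (rule lipschitz_on_nonneg)
  have 1: "inf_cone K f S x - K * dist x y \<le> inf_cone K f S y" for x y
  proof (rule inf_cone_ge[OF S])
    fix z assume z: "z \<in> S"
    have "K * dist x z \<le> K * (dist x y + dist y z)"
      using K by (intro mult_left_mono dist_triangle)
    then show "inf_cone K f S x - K * dist x y \<le> f z + K * dist y z"
      using inf_cone_le[OF f z, of x] by (simp add: algebra_simps)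
  qed
  show ?thesis
  proof (rule lipschitz_absI[OF _ K])
    show "\<bar>inf_cone K f S x - inf_cone K f S y\<bar> \<le> K * dist x y" for x y
      using 1[of x y] 1[of y x] by (simp add: dist_commute abs_le_iff)
  qed
qed

lemma inf_cone_eq:
  assumes f: "K-lipschitz_on S f" and x: "x \<in> S"
  shows "inf_cone K f S x = f x"
proof (rule antisym)
  show "inf_cone K f S x \<le> f x" using inf_cone_le[OF f x, of x] by simp
  show "f x \<le> inf_cone K f S x"
  proof (rule inf_cone_ge)
    show "f x \<le> f y + K * dist x y" if "y \<in> S" for y
      using lipschitz_on_abs[OF f x that] by linarith
  qed (use x in blast)
qed

definition smoothly_approximable :: "real \<Rightarrow> ('a::real_normed_vector \<Rightarrow> real) \<Rightarrow> bool" where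
  "smoothly_approximable K g \<longleftrightarrow>
     (\<forall>d>0. \<exists>h. smooth_on UNIV h \<and> K-lipschitz_on UNIV h \<and> (\<forall>x. \<bar>h x - g x\<bar> \<le> d))"

text \<open>
  Cones with vertex \<open>y\<close> act only within distance \<open>r\<close>, where the tolerance is large enough, since farther
  out \<open>f\<close> keeps a distance of \<open>8 * \<kappa>\<close> from them. The factor \<open>8\<close> leaves room for the approximation of
  two cones, the lift of one of them, and the rounding, all of size \<open>\<kappa>\<close>.
\<close>

definition admissible_scale ::
  "('a::metric_space \<Rightarrow> real) \<Rightarrow> real \<Rightarrow> ('a \<Rightarrow> real) \<Rightarrow> 'a \<Rightarrow> real \<Rightarrow> real \<Rightarrow> bool" where
  "admissible_scale f K \<eta> y r \<kappa> \<longleftrightarrow>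
     (\<forall>x. r \<le> dist x y \<longrightarrow> \<bar>f x - f y\<bar> \<le> K * dist x y - 8 * \<kappa>) \<and>
     (\<forall>x. dist x y < r \<longrightarrow> 8 * \<kappa> \<le> \<eta> x)"

text \<open>
  The smooth functions \<open>\<psi> n\<close> and \<open>s n\<close> approximate the envelopes of the cones over \<open>S n\<close> up to \<open>\<kappa> n\<close>, and
  \<open>s n\<close> is lifted by \<open>6 * \<kappa> n\<close>. Within \<open>\<kappa> n / K\<close> of \<open>S n\<close> the unlifted functions differ by at most
  \<open>4 * \<kappa> n\<close>, so the lift beats them by \<open>2 * \<kappa> n\<close>; elsewhere the lift is absorbed by the gap or by the
  tolerance.
\<close>

lemma fine_approximation_core:
  fixes f :: "'a::real_normed_vector \<Rightarrow> real" and Scales :: "('a set \<times> real \<times> real) set"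
  assumes K: "K > 0" and f: "K-lipschitz_on UNIV f" and \<Omega>: "open \<Omega>"
    and \<eta>: "\<And>x. x \<in> \<Omega> \<Longrightarrow> 0 \<le> \<eta> x"
    and T: "countable Scales" "Scales \<noteq> {}"
    and ok: "\<And>S r \<kappa>. (S, r, \<kappa>) \<in> Scales \<Longrightarrow> S \<noteq> {} \<and> \<kappa> > 0 \<and> (\<forall>y\<in>S. admissible_scale f K \<eta> y r \<kappa>) \<and>
       smoothly_approximable K (inf_cone K f S) \<and> smoothly_approximable K (inf_cone K (\<lambda>x. - f x) S)"
    and cover: "\<And>x. x \<in> \<Omega> \<Longrightarrow> \<exists>S r \<kappa>. (S, r, \<kappa>) \<in> Scales \<and> (\<exists>y\<in>S. dist x y < \<kappa> / K)"
  shows "\<exists>v. smooth_on \<Omega> v \<and> K-lipschitz_on \<Omega> v \<and> (\<forall>x\<in>\<Omega>. \<bar>v x - f x\<bar> \<le> \<eta> x)"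
proof -
  define S where "S n = fst (from_nat_into Scales n)" for n
  define r where "r n = fst (snd (from_nat_into Scales n))" for n
  define \<kappa> where "\<kappa> n = snd (snd (from_nat_into Scales n))" for n
  have mem: "(S n, r n, \<kappa> n) \<in> Scales" for n
    using from_nat_into[OF T(2), of n] by (simp add: S_def r_def \<kappa>_def)
  have ok': "S n \<noteq> {}" "\<kappa> n > 0" "\<And>y. y \<in> S n \<Longrightarrow> admissible_scale f K \<eta> y (r n) (\<kappa> n)"
    "smoothly_approximable K (inf_cone K f (S n))"
    "smoothly_approximable K (inf_cone K (\<lambda>x. - f x) (S n))" for n
    using ok[OF mem[of n]] by auto
  have mf: "K-lipschitz_on UNIV (\<lambda>x. - f x)" using f by simp
  have "\<forall>n. \<exists>h. smooth_on UNIV h \<and> K-lipschitz_on UNIV h \<and> (\<forall>x. \<bar>h x - inf_cone K f (S n) x\<bar> \<le> \<kappa> n)"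
    using ok'(2,4) unfolding smoothly_approximable_def by blast
  then obtain \<psi> where \<psi>: "\<And>n. smooth_on UNIV (\<psi> n)" "\<And>n. K-lipschitz_on UNIV (\<psi> n)"
    "\<And>n x. \<bar>\<psi> n x - inf_cone K f (S n) x\<bar> \<le> \<kappa> n" by metis
  have "\<forall>n. \<exists>h. smooth_on UNIV h \<and> K-lipschitz_on UNIV h \<and>
      (\<forall>x. \<bar>h x - inf_cone K (\<lambda>x. - f x) (S n) x\<bar> \<le> \<kappa> n)"
    using ok'(2,5) unfolding smoothly_approximable_def by blast
  then obtain h where h: "\<And>n. smooth_on UNIV (h n)" "\<And>n. K-lipschitz_on UNIV (h n)"
    "\<And>n x. \<bar>h n x - inf_cone K (\<lambda>x. - f x) (S n) x\<bar> \<le> \<kappa> n" by metis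
  define s where "s n x = 6 * \<kappa> n - h n x" for n x
  have s_smooth: "smooth_on UNIV (s n)" for n
  proof -
    have "smooth_on UNIV (\<lambda>x. 6 * \<kappa> n + (-1) * h n x)"
      by (rule smooth_form_add[OF smooth_form_const smooth_form_scale[OF h(1)]])
    then show ?thesis by (simp add: s_def[abs_def])
  qed
  have s_lip: "K-lipschitz_on UNIV (s n)" for n
    by (rule lipschitz_absI)
      (use lipschitz_abs[OF h(2)[of n]] K in \<open>auto simp: s_def abs_minus_commute\<close>)
  have subS: "K-lipschitz_on (S n) f" "K-lipschitz_on (S n) (\<lambda>x. - f x)" for n
    using lipschitz_on_subset[OF f] lipschitz_on_subset[OF mf] by auto
  have bounds: "f x - \<eta> x + \<kappa> n \<le> \<psi> n x \<and> s n x \<le> f x + \<eta> x - \<kappa> n" if x: "x \<in> \<Omega>" for x n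
  proof (cases "\<exists>y\<in>S n. dist x y < r n")
    case True
    then have e: "8 * \<kappa> n \<le> \<eta> x" using ok'(3)[of _ n] unfolding admissible_scale_def by blast
    have lip: "f x \<le> f y + K * dist x y" "- f x \<le> - f y + K * dist x y" for y
      using lipschitz_abs[OF f, of x y] by linarith+
    have "f x \<le> inf_cone K f (S n) x"
      by (rule inf_cone_ge[OF ok'(1)]) (rule lip)
    moreover have "- f x \<le> inf_cone K (\<lambda>x. - f x) (S n) x"
      by (rule inf_cone_ge[OF ok'(1)]) (rule lip)
    ultimately show ?thesis
      using e ok'(2)[of n] \<psi>(3)[of n x] h(3)[of n x] unfolding s_def by linarith
  next
    case False
    have gap: "\<bar>f x - f y\<bar> \<le> K * dist x y - 8 * \<kappa> n" if "y \<in> S n" for y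
      using ok'(3)[OF that] False that unfolding admissible_scale_def by force
    have "f x + 8 * \<kappa> n \<le> inf_cone K f (S n) x"
      by (rule inf_cone_ge[OF ok'(1)]) (use gap in \<open>fastforce simp: abs_le_iff\<close>)
    moreover have "- f x + 8 * \<kappa> n \<le> inf_cone K (\<lambda>x. - f x) (S n) x"
      by (rule inf_cone_ge[OF ok'(1)]) (use gap in \<open>fastforce simp: abs_le_iff\<close>)
    ultimately show ?thesis
      using \<eta>[OF x] ok'(2)[of n] \<psi>(3)[of n x] h(3)[of n x] unfolding s_def by linarith
  qed
  have core: "\<exists>n V. open V \<and> x \<in> V \<and> (\<forall>z\<in>V. \<psi> n z + \<kappa> n \<le> s n z)" if x: "x \<in> \<Omega>" for x
  proof -
    obtain S0 r0 \<kappa>0 y where y: "(S0, r0, \<kappa>0) \<in> Scales" "y \<in> S0" "dist x y < \<kappa>0 / K"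
      using cover[OF x] by blast
    obtain n where "from_nat_into Scales n = (S0, r0, \<kappa>0)"
      using from_nat_into_surj[OF T(1) y(1)] by blast
    then have n: "y \<in> S n" "dist x y < \<kappa> n / K" using y by (auto simp: S_def \<kappa>_def)
    have "\<psi> n z + \<kappa> n \<le> s n z" if z: "z \<in> ball y (\<kappa> n / K)" for z
    proof -
      have d: "K * dist z y < \<kappa> n" using z K by (simp add: dist_commute field_simps)
      show ?thesis
        using inf_cone_le[OF subS(1) n(1), of z] inf_cone_le[OF subS(2) n(1), of z] d
          \<psi>(3)[of n z] h(3)[of n z] unfolding s_def by linarith
    qed
    moreover have "x \<in> ball y (\<kappa> n / K)" using n(2) by (simp add: dist_commute)
    ultimately show ?thesis using open_ball by blast
  qed
  obtain v where "smooth_on \<Omega> v" "K-lipschitz_on \<Omega> v"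
    "\<forall>x\<in>\<Omega>. f x - \<eta> x \<le> v x \<and> v x \<le> f x + \<eta> x"
    using nested_min_max_limit[of \<Omega> \<kappa> \<psi> s K "\<lambda>x. f x - \<eta> x" "\<lambda>x. f x + \<eta> x"]
      \<Omega> ok'(2) \<psi>(1,2) s_smooth s_lip bounds core by blast
  then show ?thesis by (intro exI[of _ v]) (auto simp: abs_le_iff)
qed

definition locally_admissible ::
  "('a::metric_space) set \<Rightarrow> ('a \<Rightarrow> real) \<Rightarrow> real \<Rightarrow> ('a \<Rightarrow> real) \<Rightarrow> bool" where
  "locally_admissible \<Omega> f K \<eta> \<longleftrightarrow> (\<forall>x\<in>\<Omega>. \<exists>r0>0. \<forall>r. 0 < r \<and> r < r0 \<longrightarrow>
     (\<exists>\<kappa>0>0. \<forall>\<kappa>. 0 < \<kappa> \<and> \<kappa> < \<kappa>0 \<longrightarrow> admissible_scale f K \<eta> x r \<kappa>))"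

text \<open>
  Approximation with the same Lipschitz constant and with an error bound \<open>\<eta>\<close> that may tend to \<open>0\<close> at the
  boundary of \<open>\<Omega>\<close>. Local admissibility couples the two: the faster \<open>\<eta>\<close> decreases, the more slack below
  slope \<open>K\<close> is needed at small scales.
\<close>

definition fine_approximation :: "'a::real_normed_vector itself \<Rightarrow> bool" where
  "fine_approximation _ \<longleftrightarrow> (\<forall>(\<Omega>::'a set) f K \<eta>. open \<Omega> \<and> K > 0 \<and> K-lipschitz_on UNIV f \<and>
     (\<forall>x\<in>\<Omega>. 0 \<le> \<eta> x) \<and> locally_admissible \<Omega> f K \<eta> \<longrightarrow>
     (\<exists>v. smooth_on \<Omega> v \<and> K-lipschitz_on \<Omega> v \<and> (\<forall>x\<in>\<Omega>. \<bar>v x - f x\<bar> \<le> \<eta> x)))"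

text \<open>
  For fixed \<open>r\<close> and \<open>\<kappa>\<close> all points at which these scales are admissible form one set. Reciprocals of
  integers suffice as scales, so countably many such sets cover \<open>\<Omega>\<close>, however large the space is.
\<close>

lemma fine_approximation_if_uniform:
  assumes GA: "\<And>(g::'a::real_normed_vector \<Rightarrow> real) K. K > 0 \<Longrightarrow> K-lipschitz_on UNIV g \<Longrightarrow> smoothly_approximable K g"
  shows "fine_approximation TYPE('a)"
  unfolding fine_approximation_def
proof (intro allI impI, elim conjE)
  fix \<Omega> :: "'a set" and f K \<eta>
  assume \<Omega>: "open \<Omega>" and K: "K > 0" and f: "K-lipschitz_on UNIV f" and \<eta>: "\<forall>x\<in>\<Omega>. 0 \<le> \<eta> x"
    and loc: "locally_admissible \<Omega> f K \<eta>"
  show "\<exists>v. smooth_on \<Omega> v \<and> K-lipschitz_on \<Omega> v \<and> (\<forall>x\<in>\<Omega>. \<bar>v x - f x\<bar> \<le> \<eta> x)"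
  proof (cases "\<Omega> = {}")
    case True
    then show ?thesis
      using smooth_form_zero[of \<Omega> 0] K by (intro exI[of _ "\<lambda>_. 0"]) (auto intro!: lipschitz_onI)
  next
    case False
    define S where "S i j = {x\<in>\<Omega>. admissible_scale f K \<eta> x (1 / real (Suc i)) (1 / real (Suc j))}" for i j
    define T where "T = (\<lambda>(i, j). (S i j, 1 / real (Suc i), 1 / real (Suc j))) ` {(i, j). S i j \<noteq> {}}"
    have cov: "\<exists>i j. x \<in> S i j" if x: "x \<in> \<Omega>" for x
    proof -
      obtain r0 where "r0 > 0" and r0': "\<forall>r. 0 < r \<and> r < r0 \<longrightarrow>
         (\<exists>\<kappa>0>0. \<forall>\<kappa>. 0 < \<kappa> \<and> \<kappa> < \<kappa>0 \<longrightarrow> admissible_scale f K \<eta> x r \<kappa>)"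
        using bspec[OF loc[unfolded locally_admissible_def] x] by (elim exE conjE)
      note r0 = \<open>r0 > 0\<close> r0'[rule_format, OF conjI]
      obtain i where i: "1 / real (Suc i) < r0" using nat_approx_posE[OF r0(1)] by blast
      obtain \<kappa>0 where k0: "\<kappa>0 > 0" "\<And>\<kappa>. 0 < \<kappa> \<Longrightarrow> \<kappa> < \<kappa>0 \<Longrightarrow> admissible_scale f K \<eta> x (1 / real (Suc i)) \<kappa>"
        using r0(2)[OF _ i] by auto
      obtain j where j: "1 / real (Suc j) < \<kappa>0" using nat_approx_posE[OF k0(1)] by blast
      have "x \<in> S i j" using x k0(2)[OF _ j] by (simp add: S_def)
      then show ?thesis by blast
    qed
    have nf: "K-lipschitz_on UNIV (\<lambda>x. - f x)" using f by simp
    show ?thesis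
    proof (rule fine_approximation_core[OF K f \<Omega>, where Scales = T])
      show "countable T" unfolding T_def by (intro countable_image) simp
      show "T \<noteq> {}" using cov False unfolding T_def by blast
      show "0 \<le> \<eta> x" if "x \<in> \<Omega>" for x using \<eta> that by blast
    next
      fix U r \<kappa> assume "(U, r, \<kappa>) \<in> T"
      then obtain i j where ij: "U = S i j" "r = 1 / real (Suc i)" "\<kappa> = 1 / real (Suc j)" "S i j \<noteq> {}"
        by (auto simp: T_def)
      show "U \<noteq> {} \<and> \<kappa> > 0 \<and> (\<forall>y\<in>U. admissible_scale f K \<eta> y r \<kappa>) \<and>
       smoothly_approximable K (inf_cone K f U) \<and> smoothly_approximable K (inf_cone K (\<lambda>x. - f x) U)"
      proof (intro conjI)
        show "U \<noteq> {}" "\<kappa> > 0" using ij by auto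
        show "\<forall>y\<in>U. admissible_scale f K \<eta> y r \<kappa>" using ij by (auto simp: S_def)
        show "smoothly_approximable K (inf_cone K f U)"
          by (rule GA[OF K inf_cone_lipschitz[OF lipschitz_on_subset[OF f]]]) (use ij in auto)
        show "smoothly_approximable K (inf_cone K (\<lambda>x. - f x) U)"
          by (rule GA[OF K inf_cone_lipschitz[OF lipschitz_on_subset[OF nf]]]) (use ij in auto)
      qed
    next
      fix x assume "x \<in> \<Omega>"
      then obtain i j where x: "x \<in> S i j" using cov by blast
      have "(S i j, 1 / real (Suc i), 1 / real (Suc j)) \<in> T"
        using x unfolding T_def by (intro image_eqI[where x = "(i, j)"]) auto
      moreover have "\<exists>y\<in>S i j. dist x y < 1 / real (Suc j) / K"
        using x K by (intro bexI[of _ x]) auto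
      ultimately show "\<exists>U r \<kappa>. (U, r, \<kappa>) \<in> T \<and> (\<exists>y\<in>U. dist x y < \<kappa> / K)" by blast
    qed
  qed
qed

lemma inf_cone_singleton: "inf_cone K f {y} x = f y + K * dist x y"
  by (simp add: inf_cone_def)

text \<open>
  The sets are single points. Covering \<open>\<Omega>\<close> by the balls of radius \<open>\<kappa> x / K\<close> needs some care, as \<open>\<kappa> x\<close> is
  not continuous: for each point \<open>d\<close> of the dense set and each \<open>m\<close>, one \<open>x\<close> near \<open>d\<close> is chosen for which
  the radius is at least \<open>2 / Suc m\<close>.
\<close>

lemma fine_approximation_if_separable:
  fixes D :: "'a::real_normed_vector set"
  assumes D: "countable D" "\<And>x e. e > 0 \<Longrightarrow> \<exists>d\<in>D. dist x d < e"
    and cones: "\<And>c K (y::'a). K > 0 \<Longrightarrow> smoothly_approximable K (\<lambda>x. c + K * dist x y)"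
  shows "fine_approximation TYPE('a)"
  unfolding fine_approximation_def
proof (intro allI impI, elim conjE)
  fix \<Omega> :: "'a set" and f K \<eta>
  assume \<Omega>: "open \<Omega>" and K: "K > 0" and f: "K-lipschitz_on UNIV f" and \<eta>: "\<forall>x\<in>\<Omega>. 0 \<le> \<eta> x"
    and loc: "locally_admissible \<Omega> f K \<eta>"
  show "\<exists>v. smooth_on \<Omega> v \<and> K-lipschitz_on \<Omega> v \<and> (\<forall>x\<in>\<Omega>. \<bar>v x - f x\<bar> \<le> \<eta> x)"
  proof (cases "\<Omega> = {}")
    case True
    then show ?thesis
      using smooth_form_zero[of \<Omega> 0] K by (intro exI[of _ "\<lambda>_. 0"]) (auto intro!: lipschitz_onI)
  next
    case False
    have "\<exists>r \<kappa>. \<kappa> > 0 \<and> admissible_scale f K \<eta> x r \<kappa>" if x: "x \<in> \<Omega>" for x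
    proof -
      obtain r0 where "r0 > 0" and r0': "\<forall>r. 0 < r \<and> r < r0 \<longrightarrow>
         (\<exists>\<kappa>0>0. \<forall>\<kappa>. 0 < \<kappa> \<and> \<kappa> < \<kappa>0 \<longrightarrow> admissible_scale f K \<eta> x r \<kappa>)"
        using bspec[OF loc[unfolded locally_admissible_def] x] by (elim exE conjE)
      note r0 = \<open>r0 > 0\<close> r0'[rule_format, OF conjI]
      obtain \<kappa>0 where k0: "\<kappa>0 > 0" "\<And>\<kappa>. 0 < \<kappa> \<Longrightarrow> \<kappa> < \<kappa>0 \<Longrightarrow> admissible_scale f K \<eta> x (r0 / 2) \<kappa>"
        using r0(2)[of "r0 / 2"] r0(1) by auto
      then show ?thesis using k0(2)[of "\<kappa>0 / 2"] by (intro exI[of _ "r0 / 2"] exI[of _ "\<kappa>0 / 2"]) auto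
    qed
    then obtain r \<kappa> where rk: "\<And>x. x \<in> \<Omega> \<Longrightarrow> \<kappa> x > 0" "\<And>x. x \<in> \<Omega> \<Longrightarrow> admissible_scale f K \<eta> x (r x) (\<kappa> x)"
      by metis
    define P where "P d m x \<longleftrightarrow> x \<in> \<Omega> \<and> dist x d < 1 / real (Suc m) \<and> 2 / real (Suc m) \<le> \<kappa> x / K" for d m x
    define c where "c = (\<lambda>(d, m). SOME x. P d m x)"
    define T where "T = (\<lambda>p. ({c p}, r (c p), \<kappa> (c p))) ` {(d, m). d \<in> D \<and> (\<exists>x. P d m x)}"
    have c: "P d m (c (d, m))" if "P d m x" for d m x
      unfolding c_def prod.case using that by (rule someI)
    have cov: "\<exists>d\<in>D. \<exists>m. (\<exists>x. P d m x) \<and> dist x (c (d, m)) < \<kappa> (c (d, m)) / K" if x: "x \<in> \<Omega>" for x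
    proof -
      have "\<kappa> x / K / 2 > 0" using rk(1)[OF x] K by simp
      then obtain m where m: "1 / real (Suc m) < \<kappa> x / K / 2" using nat_approx_posE by blast
      obtain d where d: "d \<in> D" "dist x d < 1 / real (Suc m)"
        using D(2)[of "1 / real (Suc m)" x] by auto
      have Px: "P d m x" using x d m by (simp add: P_def)
      note Pc = c[OF Px]
      have "dist x (c (d, m)) \<le> dist x d + dist (c (d, m)) d" by (rule dist_triangle2)
      also have "\<dots> < 2 / real (Suc m)" using d(2) Pc by (simp add: P_def)
      also have "\<dots> \<le> \<kappa> (c (d, m)) / K" using Pc by (simp add: P_def)
      finally show ?thesis using d(1) Px by blast
    qed
    show ?thesis
    proof (rule fine_approximation_core[OF K f \<Omega>, where Scales = T])
      have "countable {(d, m). d \<in> D \<and> (\<exists>x. P d m x)}"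
        by (rule countable_subset[of _ "D \<times> UNIV"]) (use D(1) in auto)
      then show "countable T" unfolding T_def by (rule countable_image)
      show "T \<noteq> {}" using cov False unfolding T_def by blast
      show "0 \<le> \<eta> x" if "x \<in> \<Omega>" for x using \<eta> that by blast
    next
      fix U r' \<kappa>' assume "(U, r', \<kappa>') \<in> T"
      then obtain d m x where dm: "U = {c (d, m)}" "r' = r (c (d, m))" "\<kappa>' = \<kappa> (c (d, m))" "P d m x"
        by (auto simp: T_def)
      have c\<Omega>: "c (d, m) \<in> \<Omega>" using c[OF dm(4)] by (simp add: P_def)
      show "U \<noteq> {} \<and> \<kappa>' > 0 \<and> (\<forall>y\<in>U. admissible_scale f K \<eta> y r' \<kappa>') \<and>
       smoothly_approximable K (inf_cone K f U) \<and> smoothly_approximable K (inf_cone K (\<lambda>x. - f x) U)"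
        using rk[OF c\<Omega>] cones[OF K, of "f (c (d, m))" "c (d, m)"]
          cones[OF K, of "- f (c (d, m))" "c (d, m)"]
        by (simp add: dm(1-3) inf_cone_singleton[abs_def])
    next
      fix x assume "x \<in> \<Omega>"
      then obtain d m z where dm: "d \<in> D" "P d m z" "dist x (c (d, m)) < \<kappa> (c (d, m)) / K"
        using cov by blast
      then have "({c (d, m)}, r (c (d, m)), \<kappa> (c (d, m))) \<in> T"
        unfolding T_def by (intro image_eqI[where x = "(d, m)"]) auto
      with dm(3) show "\<exists>U r \<kappa>. (U, r, \<kappa>) \<in> T \<and> (\<exists>y\<in>U. dist x y < \<kappa> / K)" by blast
    qed
  qed
qed

section \<open>Separable inner product spaces\<close>

lemma smooth_real_powr: "smooth_real {0<..} (\<lambda>t. k * t powr p)"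
proof (coinduction arbitrary: k p)
  case smooth_real
  have "((\<lambda>t. k * t powr p) has_real_derivative (k * p) * t powr (p - 1)) (at t)" if "t \<in> {0<..}" for t
    using DERIV_cmult[OF has_real_derivative_powr[of t p], of k] that by (simp add: mult.assoc)
  moreover have "\<exists>k' p'. (\<lambda>t::real. (k * p) * t powr (p - 1)) = (\<lambda>t. k' * t powr p')" by blast
  ultimately show ?case
    by (intro exI[of _ "\<lambda>t. k * t powr p"] exI[of _ "\<lambda>t. (k * p) * t powr (p - 1)"]) simp
qed

lemma length_2_iff: "length vs = Suc (Suc 0) \<longleftrightarrow> (\<exists>a b. vs = [a, b])"
  by (auto simp: length_Suc_conv)

lemma smooth_on_inner_square:
  fixes y :: "'h::real_inner"
  shows "smooth_on U (\<lambda>x. c + (x - y) \<bullet> (x - y))"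
proof (rule smooth_form_step[OF bounded_multilinear_form_0])
  show "has_multilinear_derivative 0 (\<lambda>x _. c + (x - y) \<bullet> (x - y)) (\<lambda>vs. 2 * ((x - y) \<bullet> hd vs)) x" for x
    by (rule has_multilinear_derivative_one_form[where f' = "\<lambda>h. 2 * ((x - y) \<bullet> h)"])
      (auto intro!: derivative_eq_intros simp: inner_commute)
  show "smooth_form U (Suc 0) (\<lambda>x vs. 2 * ((x - y) \<bullet> hd vs))"
  proof (rule smooth_form_step)
    show "bounded_multilinear_form (Suc 0) (\<lambda>vs. 2 * ((x - y) \<bullet> hd vs))" for x
    proof (rule bounded_multilinear_formI[where C = "2 * norm (x - y)"])
      show "linear (\<lambda>h. 2 * ((x - y) \<bullet> hd (vs[i := h])))" if "length vs = Suc 0" "i < Suc 0" for vs i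
        using that by (auto simp: length_Suc_conv linear_iff inner_add_right algebra_simps)
      show "\<bar>2 * ((x - y) \<bullet> hd vs)\<bar> \<le> 2 * norm (x - y) * norm_prod vs" if "length vs = Suc 0" for vs
        using that Cauchy_Schwarz_ineq2[of "x - y" "hd vs"] by (auto simp: length_Suc_conv)
    qed
    have b2: "bounded_multilinear_form (Suc (Suc 0)) (\<lambda>vs. 2 * (hd vs \<bullet> (vs ! 1 :: 'h)))"
    proof (rule bounded_multilinear_formI[where C = 2])
      show "linear (\<lambda>h. 2 * (hd (vs[i := h]) \<bullet> vs[i := h] ! 1))"
        if "length vs = Suc (Suc 0)" "i < Suc (Suc 0)" for vs :: "'h list" and i
        using that unfolding length_2_iff less_Suc_eq
        by (auto simp: linear_iff inner_add_right inner_add_left algebra_simps)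
      show "\<bar>2 * (hd vs \<bullet> (vs ! 1))\<bar> \<le> 2 * norm_prod vs" if "length vs = Suc (Suc 0)" for vs :: "'h list"
        using that Cauchy_Schwarz_ineq2[of "hd vs" "vs ! 1"] unfolding length_2_iff by auto
    qed
    show "has_multilinear_derivative (Suc 0) (\<lambda>x vs. 2 * ((x - y) \<bullet> hd vs)) (\<lambda>vs. 2 * (hd vs \<bullet> (vs ! 1))) x" for x
      unfolding has_multilinear_derivative_def
    proof (intro conjI allI impI b2 always_eventually)
      fix e :: real and z :: 'h and vs :: "'h list" assume "e > 0" "length vs = Suc 0"
      then obtain v where v: "vs = [v]" by (auto simp: length_Suc_conv)
      have "2 * ((z - y) \<bullet> hd vs) - 2 * ((x - y) \<bullet> hd vs) - 2 * (hd ((z - x) # vs) \<bullet> ((z - x) # vs) ! 1) = 0"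
        by (simp add: v inner_diff_left)
      then show "\<bar>2 * ((z - y) \<bullet> hd vs) - 2 * ((x - y) \<bullet> hd vs)
          - 2 * (hd ((z - x) # vs) \<bullet> ((z - x) # vs) ! 1)\<bar> \<le> e * norm (z - x) * norm_prod vs"
        using \<open>e > 0\<close> norm_prod_nonneg[of vs] by simp
    qed
    show "smooth_form U (Suc (Suc 0)) (\<lambda>x vs. 2 * (hd vs \<bullet> (vs ! 1 :: 'h)))"
    proof (rule smooth_form_step[OF b2 _ smooth_form_zero])
      show "has_multilinear_derivative (Suc (Suc 0)) (\<lambda>x vs. 2 * (hd vs \<bullet> (vs ! 1 :: 'h))) (\<lambda>_. 0) x" for x
        unfolding has_multilinear_derivative_def
        by (auto simp: bounded_multilinear_form_zero norm_prod_nonneg intro!: mult_nonneg_nonneg)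
    qed
  qed
qed

text \<open>
  \<open>norm (r, x - y)\<close>, the norm in the product with the real line, is smooth in \<open>x\<close> because it stays away
  from \<open>0\<close>, and it inherits the constant \<open>1\<close> from the triangle inequality.
\<close>

lemma cone_approximable_inner:
  fixes y :: "'h::real_inner"
  assumes K: "K > 0"
  shows "smoothly_approximable K (\<lambda>x. c + K * dist x y)"
  unfolding smoothly_approximable_def
proof (intro allI impI)
  fix d :: real assume d: "d > 0"
  define r where "r = d / K"
  have r: "r > 0" using d K by (simp add: r_def)
  define h where "h x = c + K * norm (r, x - y)" for x
  have sq: "K * norm (r, x - y) = K * (r\<^sup>2 + (x - y) \<bullet> (x - y)) powr (1/2)" for x
    by (simp add: norm_Pair powr_half_sqrt power2_norm_eq_inner)
  have pos: "r\<^sup>2 + (x - y) \<bullet> (x - y) > 0" for x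
    using r by (simp add: add_pos_nonneg)
  have "smooth_on UNIV (\<lambda>x. K * (r\<^sup>2 + (x - y) \<bullet> (x - y)) powr (1/2))"
    by (rule smooth_on_compose[OF smooth_on_inner_square smooth_real_powr]) (use pos in auto)
  from smooth_form_add[OF smooth_form_const[of UNIV c] this]
  have "smooth_on UNIV h" by (simp add: h_def[abs_def] sq)
  moreover have "K-lipschitz_on UNIV h"
  proof (rule lipschitz_absI)
    fix x z
    have "\<bar>norm (r, x - y) - norm (r, z - y)\<bar> \<le> norm ((r, x - y) - (r, z - y))"
      by (rule norm_triangle_ineq3)
    also have "\<dots> = dist x z" by (simp add: norm_Pair dist_norm)
    finally have "K * \<bar>norm (r, x - y) - norm (r, z - y)\<bar> \<le> K * dist x z"
      using K by simp
    then show "\<bar>h x - h z\<bar> \<le> K * dist x z"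
      using K by (simp add: h_def right_diff_distrib[symmetric] abs_mult)
  qed (use K in simp)
  moreover have "\<bar>h x - (c + K * dist x y)\<bar> \<le> d" for x
  proof -
    have "\<bar>norm (r, x - y) - norm (0::real, x - y)\<bar> \<le> norm ((r, x - y) - (0, x - y))"
      by (rule norm_triangle_ineq3)
    also have "\<dots> = r" using r by (simp add: norm_Pair)
    finally have "K * \<bar>norm (r, x - y) - norm (x - y)\<bar> \<le> K * r"
      using K by (simp add: norm_Pair)
    then show ?thesis
      using K by (simp add: h_def dist_norm right_diff_distrib[symmetric] abs_mult r_def)
  qed
  ultimately show "\<exists>h. smooth_on UNIV h \<and> K-lipschitz_on UNIV h \<and>
      (\<forall>x. \<bar>h x - (c + K * dist x y)\<bar> \<le> d)" by blast
qed

lemma fine_approximation_inner: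
  assumes "separable_space (euclidean :: 'h::real_inner topology)"
  shows "fine_approximation TYPE('h)"
proof -
  obtain D :: "'h set" where D: "countable D" "closure D = UNIV"
    using assms by (auto simp: separable_space_def)
  show ?thesis
  proof (rule fine_approximation_if_separable[OF D(1)])
    show "\<exists>d\<in>D. dist x d < e" if "e > 0" for x e
      using closure_approachable[of x D] D(2) that by (auto simp: dist_commute)
  qed (rule cone_approximable_inner)
qed

section \<open>Finite dimension\<close>

text \<open>
  If the coefficients over \<open>E\<close> are controlled, then the span of \<open>E\<close> is closed, so that a further
  independent vector \<open>e\<close> has positive distance from it; this controls the coefficient of \<open>e\<close>.
\<close>

lemma independent_coefficients_bounded:
  assumes "finite E" "independent (E :: 'a::real_normed_vector set)"
  shows "\<exists>C\<ge>0. \<forall>c. \<forall>e\<in>E. \<bar>c e\<bar> \<le> C * norm (\<Sum>f\<in>E. c f *\<^sub>R f)"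
  using assms
proof (induction E)
  case (insert e E)
  have ind: "independent E" "e \<notin> span E"
    using insert.prems insert.hyps by (auto simp: independent_insert)
  obtain C where C: "C \<ge> 0" "\<And>c f. f \<in> E \<Longrightarrow> \<bar>c f\<bar> \<le> C * norm (\<Sum>f\<in>E. c f *\<^sub>R f)"
    using insert.IH[OF ind(1)] by blast
  have "\<exists>d>0. \<forall>c. d \<le> norm (e + (\<Sum>f\<in>E. c f *\<^sub>R f))"
  proof (rule ccontr)
    assume "\<not> ?thesis"
    then have "\<exists>c. norm (e + (\<Sum>f\<in>E. c f *\<^sub>R f)) < 1 / real (Suc n)" for n
      by (metis not_le of_nat_0_less_iff zero_less_Suc zero_less_divide_1_iff)
    then obtain c where c: "\<And>n. norm (e + (\<Sum>f\<in>E. c n f *\<^sub>R f)) < 1 / real (Suc n)" by metis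
    have "convergent (\<lambda>n. c n f)" if f: "f \<in> E" for f
    proof (rule real_Cauchy_convergent, rule metric_CauchyI)
      fix r :: real assume r: "r > 0"
      then have "r / (2 * (C + 1)) > 0" using C(1) by simp
      then obtain N where N: "1 / real (Suc N) < r / (2 * (C + 1))" using nat_approx_posE by blast
      have "dist (c m f) (c n f) < r" if mn: "m \<ge> N" "n \<ge> N" for m n
      proof -
        have le: "1 / real (Suc k) \<le> 1 / real (Suc N)" if "k \<ge> N" for k
          using that by (simp add: frac_le)
        have "(\<Sum>f\<in>E. (c m f - c n f) *\<^sub>R f) =
            (e + (\<Sum>f\<in>E. c m f *\<^sub>R f)) - (e + (\<Sum>f\<in>E. c n f *\<^sub>R f))"
          by (simp add: scaleR_diff_left sum_subtractf)
        then have "norm (\<Sum>f\<in>E. (c m f - c n f) *\<^sub>R f)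
           \<le> norm (e + (\<Sum>f\<in>E. c m f *\<^sub>R f)) + norm (e + (\<Sum>f\<in>E. c n f *\<^sub>R f))"
          using norm_triangle_ineq4[of "e + (\<Sum>f\<in>E. c m f *\<^sub>R f)" "e + (\<Sum>f\<in>E. c n f *\<^sub>R f)"]
          by simp
        then have "norm (\<Sum>f\<in>E. (c m f - c n f) *\<^sub>R f) \<le> 2 * (1 / real (Suc N))"
          using c[of m] c[of n] le[OF mn(1)] le[OF mn(2)] by linarith
        then have "C * norm (\<Sum>f\<in>E. (c m f - c n f) *\<^sub>R f) \<le> C * (2 * (1 / real (Suc N)))"
          using C(1) by (rule mult_left_mono)
        then have "\<bar>c m f - c n f\<bar> \<le> C * (2 * (1 / real (Suc N)))"
          using C(2)[OF f, of "\<lambda>f. c m f - c n f"] by linarith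
        also have "\<dots> \<le> (C + 1) * (2 * (1 / real (Suc N)))" by (intro mult_right_mono) auto
        also have "\<dots> < (C + 1) * (2 * (r / (2 * (C + 1))))"
          using N C(1) by (intro mult_strict_left_mono) auto
        also have "\<dots> = r"
        proof -
          have "2 * C + 2 \<noteq> 0" using C(1) by linarith
          then show ?thesis by (simp add: field_simps)
        qed
        finally show ?thesis by (simp add: dist_real_def)
      qed
      then show "\<exists>M. \<forall>m\<ge>M. \<forall>n\<ge>M. dist (c m f) (c n f) < r" by blast
    qed
    then have lim: "(\<lambda>n. c n f) \<longlonglongrightarrow> lim (\<lambda>n. c n f)" if "f \<in> E" for f
      using that by (simp add: convergent_LIMSEQ_iff)
    have "(\<lambda>n. e + (\<Sum>f\<in>E. c n f *\<^sub>R f)) \<longlonglongrightarrow> e + (\<Sum>f\<in>E. lim (\<lambda>n. c n f) *\<^sub>R f)"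
      by (intro tendsto_add tendsto_const tendsto_sum tendsto_scaleR lim)
    moreover have "(\<lambda>n. e + (\<Sum>f\<in>E. c n f *\<^sub>R f)) \<longlonglongrightarrow> 0"
    proof (rule Lim_null_comparison)
      show "\<forall>\<^sub>F n in sequentially. norm (e + (\<Sum>f\<in>E. c n f *\<^sub>R f)) \<le> inverse (real (Suc n))"
        using c by (auto intro!: always_eventually less_imp_le simp: inverse_eq_divide)
    qed (rule LIMSEQ_inverse_real_of_nat)
    ultimately have "e + (\<Sum>f\<in>E. lim (\<lambda>n. c n f) *\<^sub>R f) = 0" by (rule LIMSEQ_unique)
    then have "e = - (\<Sum>f\<in>E. lim (\<lambda>n. c n f) *\<^sub>R f)" by (simp add: eq_neg_iff_add_eq_0)
    also have "\<dots> \<in> span E" by (intro span_neg span_sum span_scale span_base)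
    finally show False using ind(2) by simp
  qed
  then obtain d where d: "d > 0" "\<And>c. d \<le> norm (e + (\<Sum>f\<in>E. c f *\<^sub>R f))" by blast
  have ce: "\<bar>c e\<bar> \<le> (1 / d) * norm (\<Sum>f\<in>insert e E. c f *\<^sub>R f)" for c
  proof (cases "c e = 0")
    case False
    have "(\<Sum>f\<in>insert e E. c f *\<^sub>R f) = c e *\<^sub>R (e + (\<Sum>f\<in>E. (c f / c e) *\<^sub>R f))"
      using insert.hyps False by (simp add: scaleR_add_right scaleR_sum_right)
    then have "norm (\<Sum>f\<in>insert e E. c f *\<^sub>R f) = \<bar>c e\<bar> * norm (e + (\<Sum>f\<in>E. (c f / c e) *\<^sub>R f))"
      by simp
    also have "\<dots> \<ge> \<bar>c e\<bar> * d" using d(2) by (intro mult_left_mono) auto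
    finally show ?thesis using d(1) by (simp add: field_simps)
  qed (use d in simp)
  have cf: "\<bar>c f\<bar> \<le> (C * (1 + norm e / d)) * norm (\<Sum>f\<in>insert e E. c f *\<^sub>R f)" if f: "f \<in> E" for c f
  proof -
    have "(\<Sum>f\<in>E. c f *\<^sub>R f) = (\<Sum>f\<in>insert e E. c f *\<^sub>R f) - c e *\<^sub>R e" using insert.hyps by simp
    then have "norm (\<Sum>f\<in>E. c f *\<^sub>R f) \<le> norm (\<Sum>f\<in>insert e E. c f *\<^sub>R f) + \<bar>c e\<bar> * norm e"
      using norm_triangle_ineq4[of "\<Sum>f\<in>insert e E. c f *\<^sub>R f" "c e *\<^sub>R e"] by simp
    also have "\<dots> \<le> norm (\<Sum>f\<in>insert e E. c f *\<^sub>R f)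
        + ((1 / d) * norm (\<Sum>f\<in>insert e E. c f *\<^sub>R f)) * norm e"
      using ce by (intro add_left_mono mult_right_mono) auto
    also have "\<dots> = (1 + norm e / d) * norm (\<Sum>f\<in>insert e E. c f *\<^sub>R f)"
      by (simp add: algebra_simps)
    finally have "C * norm (\<Sum>f\<in>E. c f *\<^sub>R f) \<le> C * ((1 + norm e / d) * norm (\<Sum>f\<in>insert e E. c f *\<^sub>R f))"
      using C(1) by (rule mult_left_mono)
    then show ?thesis using C(2)[OF f, of c] by (simp add: mult.assoc)
  qed
  define M where "M = max (1 / d) (C * (1 + norm e / d))"
  show ?case
  proof (intro exI conjI allI ballI)
    show "0 \<le> M" using d by (simp add: M_def le_max_iff_disj)
    fix c f assume "f \<in> insert e E"
    then show "\<bar>c f\<bar> \<le> M * norm (\<Sum>f\<in>insert e E. c f *\<^sub>R f)"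
    proof
      assume "f = e"
      have "(1 / d) * norm (\<Sum>f\<in>insert e E. c f *\<^sub>R f) \<le> M * norm (\<Sum>f\<in>insert e E. c f *\<^sub>R f)"
        by (intro mult_right_mono) (auto simp: M_def)
      from order_trans[OF ce[of c] this] show ?thesis using \<open>f = e\<close> by simp
    next
      assume "f \<in> E"
      have "(C * (1 + norm e / d)) * norm (\<Sum>f\<in>insert e E. c f *\<^sub>R f) \<le> M * norm (\<Sum>f\<in>insert e E. c f *\<^sub>R f)"
        by (intro mult_right_mono) (auto simp: M_def)
      from order_trans[OF cf[OF \<open>f \<in> E\<close>, of c] this] show ?thesis .
    qed
  qed
qed (auto intro: exI[of _ 0])

lemma iterated_dconv:
  assumes m: "mollifier \<rho>" and g: "K-lipschitz_on UNIV g"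
  defines "u \<equiv> \<lambda>es. foldr (dconv \<rho>) es g"
  shows "dir_smooth (set es) (u es)" "K-lipschitz_on UNIV (u es)"
    "\<bar>u es x - g x\<bar> \<le> K * (\<Sum>e\<leftarrow>es. norm e)"
proof -
  have K: "K \<ge> 0" using g by (rule lipschitz_on_nonneg)
  have lip: "K-lipschitz_on UNIV (u es)" for es
    by (induction es) (auto simp: u_def g intro: mollifier_dconv_lipschitz[OF m])
  show "K-lipschitz_on UNIV (u es)" by (rule lip)
  show "dir_smooth (set es) (u es)"
    by (induction es) (auto simp: u_def intro: dir_smooth_empty[OF g] dir_smooth_dconv mollifier_kernel[OF m])
  show "\<bar>u es x - g x\<bar> \<le> K * (\<Sum>e\<leftarrow>es. norm e)"
  proof (induction es arbitrary: x)
    case (Cons e es)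
    have "\<bar>dconv \<rho> e (u es) x - u es x\<bar> \<le> K * norm e"
    proof (rule mollifier_dconv_close[OF m lip])
      fix t :: real assume t: "\<bar>t\<bar> \<le> 1"
      have "\<bar>u es (x - t *\<^sub>R e) - u es x\<bar> \<le> K * (\<bar>t\<bar> * norm e)"
        using lipschitz_abs[OF lip, of es "x - t *\<^sub>R e" x] by (simp add: dist_norm)
      also have "\<dots> \<le> K * (1 * norm e)" using t K by (intro mult_left_mono mult_right_mono) auto
      finally show "\<bar>u es (x - t *\<^sub>R e) - u es x\<bar> \<le> K * norm e" by simp
    qed
    then show ?case using Cons[of x] by (simp add: u_def algebra_simps)
  qed (simp add: u_def)
qed

text \<open>
  The basis is scaled by a small \<open>\<tau>\<close>, so that convolving with one fixed kernel along all basis vectors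
  moves the function by at most \<open>d\<close>.
\<close>

lemma uniform_approximation_finite_dim:
  fixes g :: "'a::real_normed_vector \<Rightarrow> real"
  assumes B: "finite B" "span B = (UNIV :: 'a set)" and K: "K > 0" and g: "K-lipschitz_on UNIV g"
  shows "smoothly_approximable K g"
  unfolding smoothly_approximable_def
proof (intro allI impI)
  fix d :: real assume d: "d > 0"
  obtain E where E: "E \<subseteq> B" "independent E" "B \<subseteq> span E"
    using maximal_independent_subset[of B] by blast
  have fE: "finite E" using E(1) B(1) by (rule finite_subset)
  have spE: "span E = UNIV" using B(2) E(3) span_minimal[OF E(3)] by auto
  obtain es where es: "set es = E" "distinct es" using finite_distinct_list[OF fE] by blast
  define M where "M = (\<Sum>e\<leftarrow>es. norm e)"
  have M: "M \<ge> 0" by (auto simp: M_def intro!: sum_list_nonneg)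
  define \<tau> where "\<tau> = d / (K * M + 1)"
  have KM: "K * M + 1 > 0" using K M by (simp add: add_nonneg_pos)
  have \<tau>: "\<tau> > 0" using d KM by (simp add: \<tau>_def)
  obtain \<rho> where m: "mollifier \<rho>" using mollifier_exists by blast
  define fs where "fs = map ((*\<^sub>R) \<tau>) es"
  define u where "u = foldr (dconv \<rho>) fs g"
  note u = iterated_dconv[OF m g, where es = fs, folded u_def]
  have "\<bar>u x - g x\<bar> \<le> d" for x
  proof -
    have "K * (\<Sum>e\<leftarrow>fs. norm e) = \<tau> * (K * M)"
      using \<tau> by (simp add: fs_def M_def o_def sum_list_const_mult)
    also have "\<dots> \<le> \<tau> * (K * M + 1)" using \<tau> by simp
    also have "\<dots> = d" using KM by (simp add: \<tau>_def)
    finally show ?thesis using u(3)[of x] by linarith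
  qed
  moreover have "smooth_on UNIV u"
  proof (rule smooth_on_if_dir_smooth[OF u(1), where b = "\<lambda>f v. representation E v ((1 / \<tau>) *\<^sub>R f) / \<tau>"])
    show "finite (set fs)" by simp
    show "open (UNIV :: 'a set)" by simp
    obtain C where C: "C \<ge> 0" "\<And>c e. e \<in> E \<Longrightarrow> \<bar>c e\<bar> \<le> C * norm (\<Sum>f\<in>E. c f *\<^sub>R f)"
      using independent_coefficients_bounded[OF fE E(2)] by blast
    have rep: "(\<Sum>e\<in>E. representation E v e *\<^sub>R e) = v" for v
      by (rule sum_representation_eq) (use E spE fE in auto)
    have bl: "bounded_linear (\<lambda>v. representation E v e)" if e: "e \<in> E" for e
    proof (rule bounded_linear_intro)
      show "representation E (v + w) e = representation E v e + representation E w e" for v w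
        by (simp add: representation_add E(2) spE)
      show "representation E (r *\<^sub>R v) e = r *\<^sub>R representation E v e" for r v
        by (simp add: representation_scale E(2) spE)
      show "norm (representation E v e) \<le> norm v * C" for v
        using C(2)[OF e, of "representation E v"] by (simp add: rep mult.commute)
    qed
    show "bounded_linear (\<lambda>v. representation E v ((1 / \<tau>) *\<^sub>R f) / \<tau>)" if "f \<in> set fs" for f
    proof -
      have "(1 / \<tau>) *\<^sub>R f \<in> E" using that \<tau> es by (auto simp: fs_def)
      from bounded_linear_compose[OF bounded_linear_divide bl[OF this]] show ?thesis .
    qed
    show "representation E f ((1 / \<tau>) *\<^sub>R e) / \<tau> = of_bool (e = f)" if ef: "e \<in> set fs" "f \<in> set fs" for e f
    proof -
      obtain e' f' where e': "e = \<tau> *\<^sub>R e'" "f = \<tau> *\<^sub>R f'" "e' \<in> E" "f' \<in> E"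
        using ef es by (auto simp: fs_def)
      have "representation E f e' = \<tau> * (if f' = e' then 1 else 0)"
        using representation_basis[OF E(2) e'(4)]
        by (simp add: e'(2) representation_scale E(2) spE)
      then show ?thesis using \<tau> by (auto simp: e'(1,2))
    qed
    show "u x = u y" if xy: "\<forall>f\<in>set fs. representation E x ((1 / \<tau>) *\<^sub>R f) / \<tau> = representation E y ((1 / \<tau>) *\<^sub>R f) / \<tau>" for x y
    proof -
      have "representation E x e = representation E y e" if e: "e \<in> E" for e
      proof -
        have "\<tau> *\<^sub>R e \<in> set fs" using e es by (auto simp: fs_def)
        from bspec[OF xy this] \<tau> show ?thesis by simp
      qed
      then have "(\<Sum>e\<in>E. representation E x e *\<^sub>R e) = (\<Sum>e\<in>E. representation E y e *\<^sub>R e)"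
        by simp
      then show ?thesis by (simp add: rep)
    qed
  qed
  ultimately show "\<exists>h. smooth_on UNIV h \<and> K-lipschitz_on UNIV h \<and> (\<forall>x. \<bar>h x - g x\<bar> \<le> d)"
    using u(2) by blast
qed

lemma fine_approximation_finite_dim:
  assumes "finite B" "span B = (UNIV :: 'a::real_normed_vector set)"
  shows "fine_approximation TYPE('a)"
  by (rule fine_approximation_if_uniform) (rule uniform_approximation_finite_dim[OF assms])

section \<open>The space of null families\<close>

lemma c0_apply_le_norm: "\<bar>c0_apply f i\<bar> \<le> norm f"
  by transfer (auto intro: cSUP_upper c0_bdd_above)

lemma c0_norm_le: "(\<And>i. \<bar>c0_apply f i\<bar> \<le> b) \<Longrightarrow> norm f \<le> b"
  by transfer (auto intro: cSUP_least)

lemma finite_c0_large: "e > 0 \<Longrightarrow> finite {i. e \<le> \<bar>c0_apply f i\<bar>}"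
  using c0_apply[of f] by auto

lift_definition c0_unit :: "'g \<Rightarrow> 'g c0" is "\<lambda>i j. of_bool (j = i)"
proof -
  fix i :: 'g and e :: real assume "e > 0"
  then have "{j. e \<le> \<bar>of_bool (j = i)\<bar>} \<subseteq> {i}" by auto
  then show "finite {j. e \<le> \<bar>of_bool (j = i) :: real\<bar>}" by (rule finite_subset) simp
qed

lemma c0_apply_simps:
  "c0_apply (x - y) i = c0_apply x i - c0_apply y i"
  "c0_apply (x + y) i = c0_apply x i + c0_apply y i"
  "c0_apply (c *\<^sub>R x) i = c * c0_apply x i"
  "c0_apply (c0_unit j) i = of_bool (i = j)"
  by (simp_all add: minus_c0.rep_eq plus_c0.rep_eq scaleR_c0.rep_eq c0_unit.rep_eq)

lemma bounded_linear_c0_apply: "bounded_linear (\<lambda>x. c0_apply x i)"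
  by (rule bounded_linear_intro[where K = 1]) (auto simp: c0_apply_simps c0_apply_le_norm)

text \<open>
  Soft thresholding: nonexpansive, within \<open>a\<close> of the identity, and zero on \<open>[-a, a]\<close>.
\<close>

definition soft :: "real \<Rightarrow> real \<Rightarrow> real" where
  "soft a t = t - max (- a) (min a t)"

lemma soft_zero: "\<bar>t\<bar> \<le> a \<Longrightarrow> soft a t = 0"
  by (simp add: soft_def)

lemma soft_close: "a \<ge> 0 \<Longrightarrow> \<bar>soft a t - t\<bar> \<le> a"
  by (simp add: soft_def)

lemma soft_lipschitz: "\<bar>soft a s - soft a t\<bar> \<le> \<bar>s - t\<bar>"
  by (auto simp: soft_def max_def min_def abs_if)

lift_definition c0_soft :: "real \<Rightarrow> 'g c0 \<Rightarrow> 'g c0" is "\<lambda>a f i. soft \<bar>a\<bar> (f i)"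
proof -
  fix a e :: real and f :: "'g \<Rightarrow> real" assume f: "\<And>e. 0 < e \<Longrightarrow> finite {i. e \<le> \<bar>f i\<bar>}" and e: "0 < e"
  have "{i. e \<le> \<bar>soft \<bar>a\<bar> (f i)\<bar>} \<subseteq> {i. e \<le> \<bar>f i\<bar>}"
    using soft_lipschitz[of "\<bar>a\<bar>" "f _" 0] soft_zero[of 0 "\<bar>a\<bar>"] order_trans by fastforce
  then show "finite {i. e \<le> \<bar>soft \<bar>a\<bar> (f i)\<bar>}" using f e finite_subset by blast
qed

lemma c0_soft_lipschitz: "dist (c0_soft a x) (c0_soft a y) \<le> dist x y"
  unfolding dist_norm
proof (rule c0_norm_le)
  fix i
  have "\<bar>c0_apply (c0_soft a x - c0_soft a y) i\<bar> \<le> \<bar>c0_apply (x - y) i\<bar>"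
    by (simp add: c0_apply_simps c0_soft.rep_eq soft_lipschitz)
  then show "\<bar>c0_apply (c0_soft a x - c0_soft a y) i\<bar> \<le> norm (x - y)"
    using c0_apply_le_norm[of "x - y" i] by linarith
qed

lemma c0_soft_close: "a \<ge> 0 \<Longrightarrow> dist (c0_soft a x) x \<le> a"
  unfolding dist_norm by (rule c0_norm_le) (simp add: c0_apply_simps c0_soft.rep_eq soft_close)

lemma c0_soft_eq:
  assumes "a \<ge> 0" "\<And>i. c0_apply x i = c0_apply y i \<or> (\<bar>c0_apply x i\<bar> \<le> a \<and> \<bar>c0_apply y i\<bar> \<le> a)"
  shows "c0_soft a x = c0_soft a y"
proof -
  have "c0_apply (c0_soft a x) i = c0_apply (c0_soft a y) i" for i
    using assms(2)[of i] assms(1) by (auto simp: c0_soft.rep_eq soft_zero)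
  then show ?thesis by (simp add: c0_apply_inject[symmetric] fun_eq_iff)
qed

text \<open>
  Convolution in the coordinate \<open>i\<close>. By Fubini these operators commute on Lipschitz functions; being
  the identity on all others, they commute everywhere, so that they can be folded over a finite set of
  coordinates without fixing an order.
\<close>

definition smooth_coord :: "(real \<Rightarrow> real) \<Rightarrow> real \<Rightarrow> 'g \<Rightarrow> ('g c0 \<Rightarrow> real) \<Rightarrow> 'g c0 \<Rightarrow> real" where
  "smooth_coord \<rho> a i u =
     (if \<exists>L. L-lipschitz_on UNIV u then dconv \<rho> (a *\<^sub>R c0_unit i) u else u)"

definition smooth_coords :: "(real \<Rightarrow> real) \<Rightarrow> real \<Rightarrow> 'g set \<Rightarrow> ('g c0 \<Rightarrow> real) \<Rightarrow> 'g c0 \<Rightarrow> real" where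
  "smooth_coords \<rho> a F u = Finite_Set.fold (smooth_coord \<rho> a) u F"

lemma comp_fun_commute_smooth_coord:
  assumes m: "mollifier \<rho>"
  shows "comp_fun_commute (smooth_coord \<rho> a)"
proof
  fix i j :: 'g
  have "smooth_coord \<rho> a j (smooth_coord \<rho> a i u) = smooth_coord \<rho> a i (smooth_coord \<rho> a j u)" for u
  proof (cases "\<exists>L. L-lipschitz_on UNIV u")
    case True
    then obtain L where L: "L-lipschitz_on UNIV u" by blast
    have "\<exists>M. M-lipschitz_on UNIV (dconv \<rho> e u)" for e
      using mollifier_dconv_lipschitz[OF m L] by blast
    then show ?thesis
      using True dconv_commute[OF mollifier_kernel[OF m] mollifier_kernel[OF m] L]
      by (simp add: smooth_coord_def)
  qed (simp add: smooth_coord_def)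
  then show "smooth_coord \<rho> a j \<circ> smooth_coord \<rho> a i = smooth_coord \<rho> a i \<circ> smooth_coord \<rho> a j"
    by (simp add: fun_eq_iff)
qed

context
  fixes \<rho> :: "real \<Rightarrow> real" and a K :: real and h :: "'g c0 \<Rightarrow> real"
  assumes m: "mollifier \<rho>" and a: "a > 0" and h: "K-lipschitz_on UNIV h"
begin

lemma smooth_coords_empty: "smooth_coords \<rho> a {} h = h"
  by (simp add: smooth_coords_def)

lemma smooth_coords_lipschitz:
  assumes "finite F" shows "K-lipschitz_on UNIV (smooth_coords \<rho> a F h)"
  using assms
proof induction
  case (insert i F)
  interpret comp_fun_commute "smooth_coord \<rho> a" by (rule comp_fun_commute_smooth_coord[OF m])
  show ?case
    using insert mollifier_dconv_lipschitz[OF m insert.IH]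
    by (auto simp: smooth_coords_def smooth_coord_def)
qed (simp add: smooth_coords_empty h)

lemma smooth_coords_insert:
  assumes "finite F" "i \<notin> F"
  shows "smooth_coords \<rho> a (insert i F) h = dconv \<rho> (a *\<^sub>R c0_unit i) (smooth_coords \<rho> a F h)"
proof -
  interpret comp_fun_commute "smooth_coord \<rho> a" by (rule comp_fun_commute_smooth_coord[OF m])
  show ?thesis
    using assms smooth_coords_lipschitz[OF assms(1)]
    by (auto simp: smooth_coords_def smooth_coord_def)
qed

lemma smooth_coords_dir_smooth:
  assumes "finite F" shows "dir_smooth ((\<lambda>i. a *\<^sub>R c0_unit i) ` F) (smooth_coords \<rho> a F h)"
  using assms
proof induction
  case (insert i F)
  then show ?case
    using dir_smooth_dconv[OF mollifier_kernel[OF m] insert.IH] by (simp add: smooth_coords_insert)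
qed (simp add: smooth_coords_empty dir_smooth_empty[OF h])

text \<open>
  Smoothing in the coordinates of \<open>F\<close> averages over points at sup distance at most \<open>a\<close>, however many
  coordinates there are; a bound summed over the steps would grow with the size of \<open>F\<close>.
\<close>

lemma smooth_coords_bound:
  assumes "finite F"
    and "\<And>z. \<forall>j. j \<notin> F \<longrightarrow> c0_apply z j = c0_apply x j \<Longrightarrow>
       \<forall>j. \<bar>c0_apply z j - c0_apply x j\<bar> \<le> a \<Longrightarrow> \<bar>h z - c\<bar> \<le> M"
  shows "\<bar>smooth_coords \<rho> a F h x - c\<bar> \<le> M"
  using assms
proof (induction F arbitrary: x)
  case empty
  show ?case unfolding smooth_coords_empty by (rule empty) (use a in auto)
next
  case (insert i F)
  show ?case
    unfolding smooth_coords_insert[OF insert.hyps]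
  proof (rule mollifier_dconv_close[OF m smooth_coords_lipschitz[OF insert.hyps(1)]])
    fix t :: real assume t: "\<bar>t\<bar> \<le> 1"
    have ta: "\<bar>t * a\<bar> \<le> a" using t a by (simp add: abs_mult)
    show "\<bar>smooth_coords \<rho> a F h (x - t *\<^sub>R a *\<^sub>R c0_unit i) - c\<bar> \<le> M"
    proof (rule insert.IH)
      fix z assume z: "\<forall>j. j \<notin> F \<longrightarrow> c0_apply z j = c0_apply (x - t *\<^sub>R a *\<^sub>R c0_unit i) j"
        "\<forall>j. \<bar>c0_apply z j - c0_apply (x - t *\<^sub>R a *\<^sub>R c0_unit i) j\<bar> \<le> a"
      show "\<bar>h z - c\<bar> \<le> M"
      proof (rule insert.prems; intro allI impI)
        show "c0_apply z j = c0_apply x j" if "j \<notin> insert i F" for j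
          using z(1) that by (simp add: c0_apply_simps)
        show "\<bar>c0_apply z j - c0_apply x j\<bar> \<le> a" for j
        proof (cases "j = i")
          case True
          then show ?thesis using z(1) insert.hyps(2) ta by (simp add: c0_apply_simps)
        next
          case False
          then show ?thesis using z(2)[rule_format, of j] by (simp add: c0_apply_simps)
        qed
      qed
    qed
  qed
qed

text \<open>
  Here \<open>h\<close> does not react to coordinates of size at most \<open>b\<close>. Convolution in the coordinates of \<open>G\<close> does
  not touch the others, so this remains true outside \<open>G\<close>.
\<close>

lemma smooth_coords_local:
  assumes dep: "\<And>x y. (\<And>i. c0_apply x i = c0_apply y i \<or> (\<bar>c0_apply x i\<bar> \<le> b \<and> \<bar>c0_apply y i\<bar> \<le> b)) \<Longrightarrow> h x = h y"
    and "finite F" "F \<subseteq> G"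
    and "\<And>i. i \<in> G \<Longrightarrow> c0_apply x i = c0_apply y i"
    and "\<And>i. i \<notin> G \<Longrightarrow> \<bar>c0_apply x i\<bar> \<le> b \<and> \<bar>c0_apply y i\<bar> \<le> b"
  shows "smooth_coords \<rho> a F h x = smooth_coords \<rho> a F h y"
  using assms(2-)
proof (induction F arbitrary: x y)
  case empty
  show ?case unfolding smooth_coords_empty by (rule dep) (use empty in blast)
next
  case (insert i F)
  have "smooth_coords \<rho> a F h (x - t *\<^sub>R a *\<^sub>R c0_unit i) = smooth_coords \<rho> a F h (y - t *\<^sub>R a *\<^sub>R c0_unit i)" for t
  proof (rule insert.IH)
    show "F \<subseteq> G" using insert.prems by auto
    show "c0_apply (x - t *\<^sub>R a *\<^sub>R c0_unit i) j = c0_apply (y - t *\<^sub>R a *\<^sub>R c0_unit i) j" if "j \<in> G" for j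
      using insert.prems(2)[OF that] by (simp add: c0_apply_simps)
    show "\<bar>c0_apply (x - t *\<^sub>R a *\<^sub>R c0_unit i) j\<bar> \<le> b \<and> \<bar>c0_apply (y - t *\<^sub>R a *\<^sub>R c0_unit i) j\<bar> \<le> b" if "j \<notin> G" for j
      using insert.prems(3)[OF that] insert.prems(1) that by (auto simp: c0_apply_simps)
  qed
  then show ?case unfolding smooth_coords_insert[OF insert.hyps] dconv_def by simp
qed

text \<open>
  Convolving in a coordinate of size at most \<open>b\<close> averages a constant, since that coordinate stays within
  \<open>2 * b\<close>.
\<close>

lemma smooth_coords_superset:
  assumes dep: "\<And>x y. (\<And>i. c0_apply x i = c0_apply y i \<or> (\<bar>c0_apply x i\<bar> \<le> 2 * b \<and> \<bar>c0_apply y i\<bar> \<le> 2 * b)) \<Longrightarrow> h x = h y"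
    and "finite F" "finite H" "\<And>j. j \<notin> F \<Longrightarrow> \<bar>c0_apply x j\<bar> \<le> b" and ab: "a \<le> b"
  shows "smooth_coords \<rho> a (F \<union> H) h x = smooth_coords \<rho> a F h x"
  using assms(3)
proof induction
  case (insert i H)
  show ?case
  proof (cases "i \<in> F \<union> H")
    case True
    then show ?thesis using insert by (simp add: insert_absorb)
  next
    case False
    define G where "G = F \<union> H"
    have G: "finite G" "i \<notin> G" "F \<subseteq> G" using False insert assms(2) by (auto simp: G_def)
    have "\<bar>dconv \<rho> (a *\<^sub>R c0_unit i) (smooth_coords \<rho> a G h) x - smooth_coords \<rho> a G h x\<bar> \<le> 0"
    proof (rule mollifier_dconv_close[OF m smooth_coords_lipschitz[OF G(1)]])
      fix t :: real assume t: "\<bar>t\<bar> \<le> 1"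
      have ta: "\<bar>t * a\<bar> \<le> a" using t a by (simp add: abs_mult)
      have "smooth_coords \<rho> a G h (x - t *\<^sub>R a *\<^sub>R c0_unit i) = smooth_coords \<rho> a G h x"
      proof (rule smooth_coords_local[OF dep G(1) subset_refl])
        show "c0_apply (x - t *\<^sub>R a *\<^sub>R c0_unit i) j = c0_apply x j" if "j \<in> G" for j
          using that G(2) by (auto simp: c0_apply_simps)
        show "\<bar>c0_apply (x - t *\<^sub>R a *\<^sub>R c0_unit i) j\<bar> \<le> 2 * b \<and> \<bar>c0_apply x j\<bar> \<le> 2 * b" if j: "j \<notin> G" for j
        proof -
          have "\<bar>c0_apply x j\<bar> \<le> b" using assms(4)[of j] G(3) j by auto
          then show ?thesis using ta ab a by (cases "j = i") (auto simp: c0_apply_simps)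
        qed
      qed
      then show "\<bar>smooth_coords \<rho> a G h (x - t *\<^sub>R a *\<^sub>R c0_unit i) - smooth_coords \<rho> a G h x\<bar> \<le> 0"
        by simp
    qed
    then have "smooth_coords \<rho> a (insert i G) h x = smooth_coords \<rho> a G h x"
      by (simp add: smooth_coords_insert[OF G(1,2)])
    then show ?thesis using insert.IH by (simp add: G_def)
  qed
qed simp

end

text \<open>
  At \<open>x\<close> the function \<open>h\<close>, obtained from \<open>g\<close> by thresholding at \<open>2 * b\<close>, is smoothed in the finitely many
  coordinates of size at least \<open>b\<close>. Enlarging this set changes nothing, so near a given point, or for
  two given points, one common finite set of coordinates may be used.
\<close>

lemma uniform_approximation_c0:
  fixes g :: "'g c0 \<Rightarrow> real"
  assumes K: "K > 0" and g: "K-lipschitz_on UNIV g"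
  shows "smoothly_approximable K g"
  unfolding smoothly_approximable_def
proof (intro allI impI)
  fix d :: real assume d: "d > 0"
  \<comment> \<open>thresholding at \<open>2 * b\<close> costs \<open>2 * K * b\<close>, smoothing costs \<open>K * b\<close>\<close>
  define b where "b = d / (3 * K)"
  have b: "b > 0" using d K by (simp add: b_def)
  obtain \<rho> where m: "mollifier \<rho>" using mollifier_exists by blast
  define h where "h x = g (c0_soft (2 * b) x)" for x
  have h: "K-lipschitz_on UNIV h"
  proof (rule lipschitz_absI)
    fix x y :: "'g c0"
    have "\<bar>h x - h y\<bar> \<le> K * dist (c0_soft (2 * b) x) (c0_soft (2 * b) y)"
      unfolding h_def by (rule lipschitz_abs[OF g])
    also have "\<dots> \<le> K * dist x y" using K c0_soft_lipschitz by (intro mult_left_mono) auto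
    finally show "\<bar>h x - h y\<bar> \<le> K * dist x y" .
  qed (use K in simp)
  have hg: "\<bar>h x - g x\<bar> \<le> 2 * K * b" for x
  proof -
    have "\<bar>h x - g x\<bar> \<le> K * dist (c0_soft (2 * b) x) x"
      unfolding h_def by (rule lipschitz_abs[OF g])
    also have "\<dots> \<le> K * (2 * b)" using K b c0_soft_close[of "2 * b" x] by (intro mult_left_mono) auto
    finally show ?thesis by simp
  qed
  have dep: "h x = h y"
    if "\<And>i. c0_apply x i = c0_apply y i \<or> (\<bar>c0_apply x i\<bar> \<le> 2 * b \<and> \<bar>c0_apply y i\<bar> \<le> 2 * b)" for x y
    unfolding h_def using b that by (subst c0_soft_eq[of "2 * b" x y]) auto
  let ?A = "\<lambda>F. smooth_coords \<rho> b F h"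
  define large where "large x = {i. b \<le> \<bar>c0_apply x i\<bar>}" for x :: "'g c0"
  have fl: "finite (large x)" for x unfolding large_def by (rule finite_c0_large[OF b])
  define v where "v x = ?A (large x) x" for x
  have v: "v x = ?A F x" if F: "finite F" "large x \<subseteq> F" for x F
  proof -
    have "?A (large x \<union> F) x = ?A (large x) x"
    proof (rule smooth_coords_superset[OF m b h dep fl F(1), where b = b])
      show "\<bar>c0_apply x j\<bar> \<le> b" if "j \<notin> large x" for j using that by (simp add: large_def)
    qed auto
    moreover have "large x \<union> F = F" using F(2) by auto
    ultimately show ?thesis by (simp add: v_def)
  qed
  have "K-lipschitz_on UNIV v"
  proof (rule lipschitz_absI)
    fix x y
    have "finite (large x \<union> large y)" using fl by simp
    then show "\<bar>v x - v y\<bar> \<le> K * dist x y"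
      using v[of "large x \<union> large y" x] v[of "large x \<union> large y" y]
        lipschitz_abs[OF smooth_coords_lipschitz[OF m b h, of "large x \<union> large y"], of x y] by simp
  qed (use K in simp)
  moreover have "\<bar>v x - g x\<bar> \<le> d" for x
  proof -
    have "\<bar>v x - h x\<bar> \<le> K * b"
      unfolding v_def
    proof (rule smooth_coords_bound[OF m b h fl])
      fix z assume z: "\<forall>j. \<bar>c0_apply z j - c0_apply x j\<bar> \<le> b"
      have "dist z x \<le> b" unfolding dist_norm by (rule c0_norm_le) (use z in \<open>simp add: c0_apply_simps\<close>)
      then have "K * dist z x \<le> K * b" using K by simp
      then show "\<bar>h z - h x\<bar> \<le> K * b" using lipschitz_abs[OF h, of z x] by linarith
    qed
    then have "\<bar>v x - g x\<bar> \<le> 3 * (K * b)" using hg[of x] by linarith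
    also have "\<dots> = d" using K by (simp add: b_def)
    finally show ?thesis .
  qed
  moreover have "smooth_on UNIV v"
  proof (rule smooth_form_local[OF open_UNIV])
    fix x0 :: "'g c0"
    define F where "F = {i. b / 2 \<le> \<bar>c0_apply x0 i\<bar>}"
    have F: "finite F" unfolding F_def by (rule finite_c0_large) (use b in simp)
    let ?V = "ball x0 (b / 2)"
    have small: "\<bar>c0_apply x j\<bar> < b" if "x \<in> ?V" "j \<notin> F" for x j
      using c0_apply_le_norm[of "x - x0" j] that
      by (auto simp: F_def c0_apply_simps dist_norm norm_minus_commute abs_if split: if_splits)
    define e where "e i = b *\<^sub>R c0_unit i" for i :: 'g
    have inj: "e i = e j \<longleftrightarrow> i = j" for i j
    proof
      assume "e i = e j"
      then have "c0_apply (e i) i = c0_apply (e j) i" by simp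
      then show "i = j" using b by (simp add: e_def c0_apply_simps split: if_splits)
    qed simp
    define ix where "ix f = (SOME i. f = e i)" for f
    have ix: "ix (e i) = i" for i unfolding ix_def by (rule some_equality) (auto simp: inj)
    have "smooth_on ?V (?A F)"
    proof (rule smooth_on_if_dir_smooth[where S = "e ` F" and b = "\<lambda>f x. c0_apply x (ix f) / b"])
      show "dir_smooth (e ` F) (?A F)"
        using smooth_coords_dir_smooth[OF m b h F] by (simp add: e_def[abs_def])
      show "finite (e ` F)" using F by simp
      show "bounded_linear (\<lambda>x. c0_apply x (ix f) / b)" for f
        by (rule bounded_linear_compose[OF bounded_linear_divide bounded_linear_c0_apply])
      show "c0_apply f' (ix f) / b = of_bool (f = f')" if "f \<in> e ` F" "f' \<in> e ` F" for f f'
        using that b by (auto simp: ix inj) (auto simp: e_def c0_apply_simps)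
      show "?A F x = ?A F y"
        if "x \<in> ?V" "y \<in> ?V" "\<forall>f\<in>e ` F. c0_apply x (ix f) / b = c0_apply y (ix f) / b" for x y
      proof (rule smooth_coords_local[OF m b h dep F subset_refl])
        show "c0_apply x i = c0_apply y i" if "i \<in> F" for i
          using \<open>\<forall>f\<in>e ` F. _ f\<close> that b by (auto simp: ix)
        show "\<bar>c0_apply x i\<bar> \<le> 2 * b \<and> \<bar>c0_apply y i\<bar> \<le> 2 * b" if "i \<notin> F" for i
          using small[OF \<open>x \<in> ?V\<close> that] small[OF \<open>y \<in> ?V\<close> that] b by linarith
      qed
    qed (rule open_ball)
    moreover have "v x = ?A F x" if "x \<in> ?V" for x
    proof (rule v[OF F])
      show "large x \<subseteq> F" using small[OF that] by (force simp: large_def)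
    qed
    ultimately show "\<exists>V F'. open V \<and> x0 \<in> V \<and> smooth_form V 0 F' \<and>
       (\<forall>y\<in>V. \<forall>vs. length vs = 0 \<longrightarrow> v y = F' y vs)"
      using b by (intro exI[of _ ?V] exI[of _ "\<lambda>x _. ?A F x"]) simp
  qed
  ultimately show "\<exists>h. smooth_on UNIV h \<and> K-lipschitz_on UNIV h \<and> (\<forall>x. \<bar>h x - g x\<bar> \<le> d)"
    by blast
qed

lemma fine_approximation_c0: "fine_approximation TYPE('g c0)"
  by (rule fine_approximation_if_uniform) (rule uniform_approximation_c0)

section \<open>Preserving boundary values and the Lipschitz constant\<close>

lemma Lip_set_nonempty:
  assumes "L-lipschitz_on S u"
  shows "{L. L > 0 \<and> (\<forall>x\<in>S. \<forall>y\<in>S. \<bar>u x - u y\<bar> \<le> L * dist x y)} \<noteq> {}"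
proof -
  have "max L 1 > 0 \<and> (\<forall>x\<in>S. \<forall>y\<in>S. \<bar>u x - u y\<bar> \<le> max L 1 * dist x y)"
  proof (intro conjI ballI)
    fix x y assume "x \<in> S" "y \<in> S"
    then show "\<bar>u x - u y\<bar> \<le> max L 1 * dist x y"
      using lipschitz_on_abs[OF assms, of x y] mult_right_mono[of L "max L 1" "dist x y"] by simp
  qed simp
  then show ?thesis by blast
qed

lemma Lip_nonneg: "L-lipschitz_on S u \<Longrightarrow> 0 \<le> Lip u S"
  unfolding Lip_def by (intro cInf_greatest Lip_set_nonempty) auto

lemma Lip_le:
  assumes "K > 0" "K-lipschitz_on S v" shows "Lip v S \<le> K"
  unfolding Lip_def
proof (rule cInf_lower)
  show "K \<in> {L. L > 0 \<and> (\<forall>x\<in>S. \<forall>y\<in>S. \<bar>v x - v y\<bar> \<le> L * dist x y)}"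
    using assms lipschitz_on_abs[OF assms(2)] by blast
  show "bdd_below {L. L > 0 \<and> (\<forall>x\<in>S. \<forall>y\<in>S. \<bar>v x - v y\<bar> \<le> L * dist x y)}"
    by (rule bdd_belowI[of _ 0]) auto
qed

lemma Lip_lipschitz:
  assumes u: "L-lipschitz_on S u" shows "(Lip u S)-lipschitz_on S u"
proof (rule lipschitz_onI)
  fix x y assume xy: "x \<in> S" "y \<in> S"
  show "dist (u x) (u y) \<le> Lip u S * dist x y"
  proof (cases "x = y")
    case False
    then have d: "dist x y > 0" by simp
    have "\<bar>u x - u y\<bar> / dist x y \<le> Lip u S"
      unfolding Lip_def
    proof (rule cInf_greatest[OF Lip_set_nonempty[OF u]])
      show "\<bar>u x - u y\<bar> / dist x y \<le> M"
        if "M \<in> {L. L > 0 \<and> (\<forall>x\<in>S. \<forall>y\<in>S. \<bar>u x - u y\<bar> \<le> L * dist x y)}" for M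
        using that xy d by (simp add: divide_le_eq)
    qed
    then show ?thesis using d by (simp add: dist_real_def divide_le_eq)
  qed simp
qed (rule Lip_nonneg[OF u])

definition shrink :: "real \<Rightarrow> real \<Rightarrow> real" where
  "shrink e t = t - e * arctan t"

text \<open>
  \<open>shrink e\<close> has the derivative \<open>1 - e / (1 + t^2)\<close>, which lies in \<open>[0, 1)\<close> and tends to \<open>1\<close> only at
  infinity: this gives slack on bounded sets while the displacement \<open>e * arctan t\<close> stays bounded.
\<close>

lemma shrink_slope:
  assumes e: "0 < e" "e < 1" and p: "\<bar>p\<bar> \<le> M" and q: "\<bar>q\<bar> \<le> M"
  shows "\<exists>l. 0 \<le> l \<and> l \<le> 1 - e / (1 + M\<^sup>2) \<and> shrink e p - shrink e q = l * (p - q)"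
proof -
  have D: "(shrink e has_real_derivative 1 - e / (1 + t\<^sup>2)) (at t)" for t
    unfolding shrink_def[abs_def]
    by (auto intro!: derivative_eq_intros simp: divide_inverse)
  have b: "0 \<le> 1 - e / (1 + t\<^sup>2) \<and> 1 - e / (1 + t\<^sup>2) \<le> 1 - e / (1 + M\<^sup>2)" if t: "\<bar>t\<bar> \<le> M" for t
  proof
    have "e / (1 + t\<^sup>2) \<le> 1" using e by (simp add: divide_le_eq add_pos_nonneg add_increasing2)
    then show "0 \<le> 1 - e / (1 + t\<^sup>2)" by simp
    have "t\<^sup>2 \<le> M\<^sup>2" using t abs_le_square_iff[of t M] by simp
    then show "1 - e / (1 + t\<^sup>2) \<le> 1 - e / (1 + M\<^sup>2)"
      using e by (simp add: frac_le add_pos_nonneg)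
  qed
  have main: "\<exists>l. 0 \<le> l \<and> l \<le> 1 - e / (1 + M\<^sup>2) \<and> shrink e p - shrink e q = l * (p - q)"
    if qp: "q < p" "\<bar>p\<bar> \<le> M" "\<bar>q\<bar> \<le> M" for p q
  proof -
    obtain z where z: "q < z" "z < p" "shrink e p - shrink e q = (p - q) * (1 - e / (1 + z\<^sup>2))"
      using MVT2[OF qp(1), of "shrink e" "\<lambda>t. 1 - e / (1 + t\<^sup>2)"] D by blast
    then have "\<bar>z\<bar> \<le> M" using qp by auto
    from b[OF this] show ?thesis
      using z(3) by (intro exI[of _ "1 - e / (1 + z\<^sup>2)"]) (simp add: mult.commute)
  qed
  consider "q < p" | "p < q" | "p = q" by linarith
  then show ?thesis
  proof cases
    case 2
    obtain l where "0 \<le> l" "l \<le> 1 - e / (1 + M\<^sup>2)" "shrink e q - shrink e p = l * (q - p)"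
      using main[OF 2 q p] by blast
    then show ?thesis by (intro exI[of _ l]) (simp add: algebra_simps)
  next
    case 3
    then show ?thesis using b[OF p] by (intro exI[of _ "1 - e / (1 + p\<^sup>2)"]) simp
  qed (use main p q in blast)
qed

lemma shrink_close:
  assumes "0 \<le> e" shows "\<bar>shrink e t - t\<bar> \<le> 2 * e"
proof -
  have "\<bar>arctan t\<bar> \<le> 2" using arctan_bounded[of t] pi_less_4 by linarith
  then have "e * \<bar>arctan t\<bar> \<le> e * 2" using assms by (rule mult_left_mono)
  then show ?thesis using assms by (simp add: shrink_def abs_mult)
qed

text \<open>
  The increment is \<open>(1 - l)\<close> times that of \<open>w\<close> plus \<open>l\<close> times that of \<open>U\<close>, with \<open>l\<close> a mean slope of
  \<open>shrink e\<close>.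
\<close>

lemma shrink_difference_bound:
  fixes U w :: "'a::metric_space \<Rightarrow> real"
  assumes U: "K-lipschitz_on UNIV U" and w: "K0-lipschitz_on UNIV w" and K: "K0 < K"
    and e: "0 < e" "e < 1" and M: "\<bar>U x - w x\<bar> \<le> M" "\<bar>U y - w y\<bar> \<le> M"
  shows "\<bar>(w x + shrink e (U x - w x)) - (w y + shrink e (U y - w y))\<bar>
    \<le> (K - (K - K0) * (e / (1 + M\<^sup>2))) * dist x y"
proof -
  obtain l where l: "0 \<le> l" "l \<le> 1 - e / (1 + M\<^sup>2)"
    "shrink e (U x - w x) - shrink e (U y - w y) = l * ((U x - w x) - (U y - w y))"
    using shrink_slope[OF e M] by blast
  have l1: "l \<le> 1" using l(2) e by (smt (verit) divide_nonneg_nonneg zero_le_power2)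
  have "(w x + shrink e (U x - w x)) - (w y + shrink e (U y - w y))
      = (1 - l) * (w x - w y) + l * (U x - U y)"
    using l(3) by (simp add: algebra_simps)
  also have "\<bar>\<dots>\<bar> \<le> \<bar>(1 - l) * (w x - w y)\<bar> + \<bar>l * (U x - U y)\<bar>"
    by (rule abs_triangle_ineq)
  also have "\<dots> \<le> (1 - l) * (K0 * dist x y) + l * (K * dist x y)"
    unfolding abs_mult using l l1 lipschitz_abs[OF w, of x y] lipschitz_abs[OF U, of x y]
    by (intro add_mono mult_mono) auto
  also have "\<dots> = (K0 + l * (K - K0)) * dist x y" by (simp add: algebra_simps)
  also have "\<dots> \<le> (K0 + (1 - e / (1 + M\<^sup>2)) * (K - K0)) * dist x y"
    using l(2) K by (intro mult_right_mono add_left_mono) auto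
  also have "\<dots> = (K - (K - K0) * (e / (1 + M\<^sup>2))) * dist x y" by (simp add: algebra_simps)
  finally show ?thesis .
qed

lemma shrink_lipschitz:
  fixes U w :: "'a::metric_space \<Rightarrow> real"
  assumes U: "K-lipschitz_on UNIV U" and w: "K0-lipschitz_on UNIV w" and K: "K0 < K"
    and e: "0 < e" "e < 1"
  shows "K-lipschitz_on UNIV (\<lambda>x. w x + shrink e (U x - w x))"
proof (rule lipschitz_absI)
  fix x y
  define M where "M = max \<bar>U x - w x\<bar> \<bar>U y - w y\<bar>"
  have "\<bar>(w x + shrink e (U x - w x)) - (w y + shrink e (U y - w y))\<bar>
    \<le> (K - (K - K0) * (e / (1 + M\<^sup>2))) * dist x y"
    by (rule shrink_difference_bound[OF U w K e]) (auto simp: M_def)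
  also have "\<dots> \<le> K * dist x y"
    using K e by (intro mult_right_mono) auto
  finally show "\<bar>(w x + shrink e (U x - w x)) - (w y + shrink e (U y - w y))\<bar> \<le> K * dist x y" .
qed (rule lipschitz_on_nonneg[OF U])

text \<open>
  Only the part of the segment from \<open>y\<close> to \<open>x\<close> inside the ball of radius \<open>r\<close> around \<open>y\<close> is used: there
  \<open>U - w\<close> is bounded, and the gain on it is not lost on the rest of the segment.
\<close>

lemma shrink_gap:
  fixes U w :: "'a::real_normed_vector \<Rightarrow> real"
  assumes U: "K-lipschitz_on UNIV U" and w: "K0-lipschitz_on UNIV w" and K: "K0 < K"
    and e: "0 < e" "e < 1" and r: "r > 0"
  defines "f \<equiv> \<lambda>x. w x + shrink e (U x - w x)"
  shows "\<exists>\<gamma>>0. \<forall>x. r \<le> dist x y \<longrightarrow> \<bar>f x - f y\<bar> \<le> K * dist x y - \<gamma>"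
proof -
  define M where "M = \<bar>U y - w y\<bar> + (K + K0) * r"
  have K0: "K0 \<ge> 0" using w by (rule lipschitz_on_nonneg)
  define \<gamma> where "\<gamma> = (K - K0) * (e / (1 + M\<^sup>2)) * r"
  have "\<gamma> > 0" unfolding \<gamma>_def using K e r by (intro mult_pos_pos divide_pos_pos) (auto simp: add_pos_nonneg)
  moreover have "\<bar>f x - f y\<bar> \<le> K * dist x y - \<gamma>" if x: "r \<le> dist x y" for x
  proof -
    define c where "c = r / dist x y"
    have d: "dist x y > 0" using x r by linarith
    have c: "0 < c" "c \<le> 1" using d r x by (auto simp: c_def)
    define z where "z = y + c *\<^sub>R (x - y)"
    have "c * dist x y = r" using d by (simp add: c_def)
    then have zy: "dist z y = r" using c by (simp add: z_def dist_norm)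
    have xz: "x - z = (1 - c) *\<^sub>R (x - y)" by (simp add: z_def algebra_simps)
    have "dist x z = (1 - c) * dist x y" unfolding dist_norm xz using c by simp
    then have zx: "dist x z = dist x y - r"
      using \<open>c * dist x y = r\<close> by (simp add: left_diff_distrib)
    have "\<bar>U z - w z\<bar> \<le> M"
    proof -
      have "\<bar>U z - U y\<bar> \<le> K * r" "\<bar>w z - w y\<bar> \<le> K0 * r"
        using lipschitz_abs[OF U, of z y] lipschitz_abs[OF w, of z y] zy by auto
      then show ?thesis unfolding M_def distrib_right by linarith
    qed
    moreover have "\<bar>U y - w y\<bar> \<le> M" using K K0 r by (simp add: M_def)
    ultimately have "\<bar>f z - f y\<bar> \<le> (K - (K - K0) * (e / (1 + M\<^sup>2))) * r"
      using shrink_difference_bound[OF U w K e, of z M y] zy by (simp add: f_def)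
    moreover have "\<bar>f x - f z\<bar> \<le> K * (dist x y - r)"
      using lipschitz_abs[OF shrink_lipschitz[OF U w K e], of x z] zx by (simp add: f_def)
    ultimately show ?thesis unfolding \<gamma>_def by (simp add: algebra_simps abs_le_iff)
  qed
  ultimately show ?thesis by blast
qed

text \<open>
  Vanishing at the boundary is what makes the approximation match the boundary values. The whole space
  is treated apart because the distance to the empty set is \<open>0\<close> by convention.
\<close>

definition tolerance :: "'a::metric_space set \<Rightarrow> real \<Rightarrow> 'a \<Rightarrow> real" where
  "tolerance \<Omega> \<epsilon> x = (if \<Omega> = UNIV then \<epsilon> else min \<epsilon> (infdist x (- \<Omega>)))"

lemma locally_admissible_if_gap:
  fixes \<Omega> :: "'a::real_normed_vector set"
  assumes \<Omega>: "open \<Omega>" and \<epsilon>: "\<epsilon> > 0"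
    and gap: "\<And>y r. r > 0 \<Longrightarrow> \<exists>\<gamma>>0. \<forall>x. r \<le> dist x y \<longrightarrow> \<bar>f x - f y\<bar> \<le> K * dist x y - \<gamma>"
  shows "locally_admissible \<Omega> f K (tolerance \<Omega> \<epsilon>)"
  unfolding locally_admissible_def
proof
  fix y assume y: "y \<in> \<Omega>"
  obtain R where R: "R > 0" "ball y R \<subseteq> \<Omega>" using \<Omega> y open_contains_ball by blast
  show "\<exists>r0>0. \<forall>r. 0 < r \<and> r < r0 \<longrightarrow>
     (\<exists>\<kappa>0>0. \<forall>\<kappa>. 0 < \<kappa> \<and> \<kappa> < \<kappa>0 \<longrightarrow> admissible_scale f K (tolerance \<Omega> \<epsilon>) y r \<kappa>)"
  proof (rule exI[of _ "R / 2"], intro conjI allI impI)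
    \<comment> \<open>for \<open>r < R / 2\<close>, points within \<open>r\<close> of \<open>y\<close> are still at distance at least \<open>r\<close> from the complement\<close>
    show "R / 2 > 0" using R by simp
    fix r assume r: "0 < r \<and> r < R / 2"
    obtain \<gamma> where \<gamma>: "\<gamma> > 0" "\<And>x. r \<le> dist x y \<Longrightarrow> \<bar>f x - f y\<bar> \<le> K * dist x y - \<gamma>"
      using gap[of r y] r by blast
    show "\<exists>\<kappa>0>0. \<forall>\<kappa>. 0 < \<kappa> \<and> \<kappa> < \<kappa>0 \<longrightarrow> admissible_scale f K (tolerance \<Omega> \<epsilon>) y r \<kappa>"
    proof (intro exI conjI allI impI)
      show "Min {\<gamma>, \<epsilon>, r} / 8 > 0" using \<gamma> \<epsilon> r by simp
      fix \<kappa> assume k: "0 < \<kappa> \<and> \<kappa> < Min {\<gamma>, \<epsilon>, r} / 8"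
      then have k': "8 * \<kappa> < \<gamma>" "8 * \<kappa> < \<epsilon>" "8 * \<kappa> < r" by auto
      show "admissible_scale f K (tolerance \<Omega> \<epsilon>) y r \<kappa>"
        unfolding admissible_scale_def
      proof (intro conjI allI impI)
        show "\<bar>f x - f y\<bar> \<le> K * dist x y - 8 * \<kappa>" if "r \<le> dist x y" for x
          using \<gamma>(2)[OF that] k' by linarith
        show "8 * \<kappa> \<le> tolerance \<Omega> \<epsilon> x" if x: "dist x y < r" for x
        proof (cases "\<Omega> = UNIV")
          case False
          have "r \<le> infdist x (- \<Omega>)"
          proof -
            have "r \<le> dist x z" if "z \<in> - \<Omega>" for z
            proof -
              have "\<not> dist y z < R" using that R(2) by auto
              then show ?thesis using dist_triangle[of y z x] x r by (simp add: dist_commute)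
            qed
            moreover have "- \<Omega> \<noteq> {}" using False by auto
            ultimately show ?thesis by (auto simp: infdist_notempty intro!: cINF_greatest)
          qed
          then show ?thesis using k' False by (simp add: tolerance_def)
        qed (use k' in \<open>simp add: tolerance_def\<close>)
      qed
    qed
  qed
qed

text \<open>
  The fine approximation \<open>v\<close> of \<open>f\<close> is continued by \<open>f\<close> outside \<open>\<Omega>\<close>. Its error at \<open>y\<close> is at most the
  distance from \<open>y\<close> to the complement, so the Lipschitz estimate between a point of \<open>\<Omega>\<close> and a boundary
  point \<open>z\<close> follows by letting \<open>y\<close> tend to \<open>z\<close>.
\<close>

lemma approximation_preserving_Lip:
  fixes \<Omega> :: "'a::real_normed_vector set"
  assumes fine: "fine_approximation TYPE('a)"
    and \<Omega>: "open \<Omega>" and u0: "\<exists>L. L-lipschitz_on (closure \<Omega>) u0"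
    and lt: "Lip u0 (frontier \<Omega>) < Lip u0 (closure \<Omega>)" and \<epsilon>: "\<epsilon> > 0"
  shows "\<exists>v. Cinfinity_on \<Omega> v \<and> (\<exists>L. L-lipschitz_on (closure \<Omega>) v) \<and>
            Lip v (closure \<Omega>) \<le> Lip u0 (closure \<Omega>) \<and>
            (\<forall>x\<in>frontier \<Omega>. v x = u0 x) \<and>
            (\<forall>x\<in>closure \<Omega>. \<bar>u0 x - v x\<bar> \<le> \<epsilon>)"
proof -
  define K where "K = Lip u0 (closure \<Omega>)"
  define K0 where "K0 = Lip u0 (frontier \<Omega>)"
  obtain L where L: "L-lipschitz_on (closure \<Omega>) u0" using u0 by blast
  have fsub: "frontier \<Omega> \<subseteq> closure \<Omega>" by (auto simp: frontier_def)
  have K: "K-lipschitz_on (closure \<Omega>) u0" unfolding K_def by (rule Lip_lipschitz[OF L])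
  have K0: "K0-lipschitz_on (frontier \<Omega>) u0"
    unfolding K0_def by (rule Lip_lipschitz[OF lipschitz_on_subset[OF L fsub]])
  have K0K: "0 \<le> K0" "K0 < K" using lipschitz_on_nonneg[OF K0] lt by (auto simp: K_def K0_def)
  have ne: "closure \<Omega> \<noteq> {}" using lt by (auto simp: frontier_def)
  define U where "U = inf_cone K u0 (closure \<Omega>)"
  have U: "K-lipschitz_on UNIV U" unfolding U_def by (rule inf_cone_lipschitz[OF K ne])
  have Ueq: "U x = u0 x" if "x \<in> closure \<Omega>" for x unfolding U_def by (rule inf_cone_eq[OF K that])
  define w where "w = (if frontier \<Omega> = {} then (\<lambda>_. 0) else inf_cone K0 u0 (frontier \<Omega>))"
  have w: "K0-lipschitz_on UNIV w"
    using inf_cone_lipschitz[OF K0] K0K by (auto simp: w_def intro!: lipschitz_onI)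
  have weq: "w x = u0 x" if "x \<in> frontier \<Omega>" for x
    using inf_cone_eq[OF K0 that] that by (auto simp: w_def)
  \<comment> \<open>one half of \<open>\<epsilon>\<close> is spent on passing from \<open>u0\<close> to \<open>f\<close>, the other on smoothing \<open>f\<close>\<close>
  define e where "e = min (1/2) (\<epsilon> / 4)"
  have e: "0 < e" "e < 1" "2 * e \<le> \<epsilon> / 2" using \<epsilon> by (auto simp: e_def)
  define f where "f x = w x + shrink e (U x - w x)" for x
  have f: "K-lipschitz_on UNIV f"
    using shrink_lipschitz[OF U w K0K(2) e(1,2)] by (simp add: f_def[abs_def])
  have "locally_admissible \<Omega> f K (tolerance \<Omega> (\<epsilon> / 2))"
    using shrink_gap[OF U w K0K(2) e(1,2)] \<epsilon>
    by (intro locally_admissible_if_gap[OF \<Omega>]) (auto simp: f_def[abs_def])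
  moreover have "\<forall>x\<in>\<Omega>. 0 \<le> tolerance \<Omega> (\<epsilon> / 2) x"
    using \<epsilon> by (auto simp: tolerance_def infdist_nonneg)
  ultimately obtain v where v: "smooth_on \<Omega> v" "K-lipschitz_on \<Omega> v"
    "\<And>x. x \<in> \<Omega> \<Longrightarrow> \<bar>v x - f x\<bar> \<le> tolerance \<Omega> (\<epsilon> / 2) x"
    using fine[unfolded fine_approximation_def, rule_format, of \<Omega> K f "tolerance \<Omega> (\<epsilon> / 2)"]
      \<Omega> f K0K by auto
  define V where "V x = (if x \<in> \<Omega> then v x else f x)" for x
  have fr: "frontier \<Omega> = closure \<Omega> - \<Omega>" using \<Omega> by (simp add: frontier_def interior_open)
  have mixed: "\<bar>v x - f z\<bar> \<le> K * dist x z" if x: "x \<in> \<Omega>" and z: "z \<in> closure \<Omega>" "z \<notin> \<Omega>" for x z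
  proof (rule field_le_epsilon)
    fix d :: real assume d: "d > 0"
    \<comment> \<open>the three estimates below cost \<open>K * s\<close>, \<open>s\<close> and \<open>K * s\<close>\<close>
    define s where "s = d / (2 * K + 1)"
    have s: "s > 0" using d K0K by (simp add: s_def)
    obtain y where y: "y \<in> \<Omega>" "dist y z < s"
      using z(1) s closure_approachable by blast
    have "\<bar>v x - v y\<bar> \<le> K * dist x y" by (rule lipschitz_on_abs[OF v(2) x y(1)])
    also have "\<dots> \<le> K * (dist x z + s)"
      using dist_triangle[of x y z] y(2) K0K by (intro mult_left_mono) (auto simp: dist_commute)
    finally have 1: "\<bar>v x - v y\<bar> \<le> K * dist x z + K * s" by (simp add: distrib_left)
    have "\<bar>v y - f y\<bar> \<le> infdist y (- \<Omega>)"
      using v(3)[OF y(1)] z(2) by (auto simp: tolerance_def split: if_splits)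
    also have "\<dots> \<le> dist y z" using z(2) by (intro infdist_le) simp
    finally have 2: "\<bar>v y - f y\<bar> \<le> s" using y(2) by simp
    have "K * dist y z \<le> K * s" using y(2) K0K by (intro mult_left_mono) auto
    then have 3: "\<bar>f y - f z\<bar> \<le> K * s"
      using lipschitz_abs[OF f, of y z] by linarith
    have "(2 * K + 1) * s = d" using K0K by (simp add: s_def)
    then have "K * s + s + K * s = d" by (simp add: algebra_simps)
    then show "\<bar>v x - f z\<bar> \<le> K * dist x z + d" using 1 2 3 by linarith
  qed
  have V: "K-lipschitz_on (closure \<Omega>) V"
  proof (rule lipschitz_onI)
    fix x y assume xy: "x \<in> closure \<Omega>" "y \<in> closure \<Omega>"
    have "\<bar>V x - V y\<bar> \<le> K * dist x y"
      using lipschitz_on_abs[OF v(2), of x y] mixed[of x y] mixed[of y x]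
        lipschitz_abs[OF f, of x y] xy
      by (auto simp: V_def abs_minus_commute dist_commute)
    then show "dist (V x) (V y) \<le> K * dist x y" by (simp add: dist_real_def)
  qed (use K0K in simp)
  have "smooth_on \<Omega> V"
    by (rule smooth_form_local[OF \<Omega>]) (use v(1) \<Omega> in \<open>auto simp: V_def intro!: exI[of _ \<Omega>] exI[of _ "\<lambda>x _. v x"]\<close>)
  then have "Cinfinity_on \<Omega> V" by (rule Cinfinity_on_if_smooth_on)
  moreover have "Lip V (closure \<Omega>) \<le> Lip u0 (closure \<Omega>)"
    using Lip_le[OF _ V] K0K by (simp add: K_def)
  moreover have "V x = u0 x" if x: "x \<in> frontier \<Omega>" for x
  proof -
    have "x \<in> closure \<Omega>" "x \<notin> \<Omega>" using x fr by auto
    then show ?thesis using weq[OF x] Ueq[of x] by (simp add: V_def f_def shrink_def)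
  qed
  moreover have "\<bar>u0 x - V x\<bar> \<le> \<epsilon>" if x: "x \<in> closure \<Omega>" for x
  proof -
    have "\<bar>f x - u0 x\<bar> \<le> 2 * e"
      using shrink_close[of e "U x - w x"] e(1) Ueq[OF x] by (simp add: f_def)
    moreover have "\<bar>V x - f x\<bar> \<le> \<epsilon> / 2"
    proof (cases "x \<in> \<Omega>")
      case True
      have "tolerance \<Omega> (\<epsilon> / 2) x \<le> \<epsilon> / 2"
        by (cases "\<Omega> = UNIV") (simp_all only: tolerance_def if_True if_False simp_thms order_refl min.cobounded1)
      then show ?thesis using v(3)[OF True] True by (simp add: V_def)
    qed (use \<epsilon> in \<open>simp add: V_def\<close>)
    ultimately show ?thesis using e(3) by linarith
  qed
  ultimately show ?thesis using V by blast
qed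

theorem theorem1p2:
  shows
    "((\<exists>B :: 'a::real_normed_vector set. finite B \<and> span B = UNIV) \<longrightarrow>
      (\<forall>(\<Omega> :: 'a set) (u0 :: 'a \<Rightarrow> real) (\<epsilon> :: real).
         open \<Omega> \<and> (\<exists>L. L-lipschitz_on (closure \<Omega>) u0) \<and>
         Lip u0 (frontier \<Omega>) < Lip u0 (closure \<Omega>) \<and> \<epsilon> > 0 \<longrightarrow>
         (\<exists>v :: 'a \<Rightarrow> real.
            Cinfinity_on \<Omega> v \<and>
            (\<exists>L. L-lipschitz_on (closure \<Omega>) v) \<and>
            Lip v (closure \<Omega>) \<le> Lip u0 (closure \<Omega>) \<and>
            (\<forall>x\<in>frontier \<Omega>. v x = u0 x) \<and>
            (\<forall>x\<in>closure \<Omega>. \<bar>u0 x - v x\<bar> \<le> \<epsilon>))))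
     \<and>
     (separable_space (euclidean :: 'h::{real_inner, complete_space} topology) \<longrightarrow>
      (\<forall>(\<Omega> :: 'h set) (u0 :: 'h \<Rightarrow> real) (\<epsilon> :: real).
         open \<Omega> \<and> (\<exists>L. L-lipschitz_on (closure \<Omega>) u0) \<and>
         Lip u0 (frontier \<Omega>) < Lip u0 (closure \<Omega>) \<and> \<epsilon> > 0 \<longrightarrow>
         (\<exists>v :: 'h \<Rightarrow> real.
            Cinfinity_on \<Omega> v \<and>
            (\<exists>L. L-lipschitz_on (closure \<Omega>) v) \<and>
            Lip v (closure \<Omega>) \<le> Lip u0 (closure \<Omega>) \<and>
            (\<forall>x\<in>frontier \<Omega>. v x = u0 x) \<and>
            (\<forall>x\<in>closure \<Omega>. \<bar>u0 x - v x\<bar> \<le> \<epsilon>))))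
     \<and>
     (\<forall>(\<Omega> :: 'g c0 set) (u0 :: 'g c0 \<Rightarrow> real) (\<epsilon> :: real).
         open \<Omega> \<and> (\<exists>L. L-lipschitz_on (closure \<Omega>) u0) \<and>
         Lip u0 (frontier \<Omega>) < Lip u0 (closure \<Omega>) \<and> \<epsilon> > 0 \<longrightarrow>
         (\<exists>v :: 'g c0 \<Rightarrow> real.
            Cinfinity_on \<Omega> v \<and>
            (\<exists>L. L-lipschitz_on (closure \<Omega>) v) \<and>
            Lip v (closure \<Omega>) \<le> Lip u0 (closure \<Omega>) \<and>
            (\<forall>x\<in>frontier \<Omega>. v x = u0 x) \<and>
            (\<forall>x\<in>closure \<Omega>. \<bar>u0 x - v x\<bar> \<le> \<epsilon>)))"
proof (intro conjI impI allI, goal_cases)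
  case (1 \<Omega> u0 \<epsilon>)
  then have "fine_approximation TYPE('a)" using fine_approximation_finite_dim by blast
  with 1 show ?case using approximation_preserving_Lip[of \<Omega> u0 \<epsilon>] by blast
next
  case (2 \<Omega> u0 \<epsilon>)
  then have "fine_approximation TYPE('h)" using fine_approximation_inner by blast
  with 2 show ?case using approximation_preserving_Lip[of \<Omega> u0 \<epsilon>] by blast
next
  case (3 \<Omega> u0 \<epsilon>)
  with fine_approximation_c0 show ?case using approximation_preserving_Lip[of \<Omega> u0 \<epsilon>] by blast
qed

end
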